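(* Let $f \in S^3 V$ be irreducible, with $\dim V = n+1$. The following statements are equivalent: (i) $\mathrm{slrk}(f) = 2$; (ii) for a generic linear subspace $E \subseteq V^*$ with $\dim E = 14$, $\mathrm{slrk}(f|_E) = 2$; (iii) for every linear subspace $E \subseteq V^*$ with $\dim E = 14$, $\mathrm{slrk}(f|_E) \leq 2$.
   Context: $V$ is an $(n+1)$-dimensional vector space over $\mathbb{C}$. $S^dV$ is the space of homogeneous polynomials of degree $d$ on $V^*$ (the $d$-th symmetric power of $V$). For a linear subspace $E\subseteq V^*$, $f|_E\in S^dE^*$ is the restriction of $f \in S^dV$ to $E$. For a vector space $U$ and $F\in S^dU$, the slice rank $\mathrm{slrk}(F)$ is the smallest $r\in\mathbb{N}$ such that $F=\sum_{i=1}^r\ell_ih_i$ with $\ell_i\in S^1U$, $h_i\in S^{d-1}U$. "Generic $E$" means: for all $E$ in some dense Zariski open subset of the Grassmannian $\mathrm{Gr}(14,V^* )$ of 14-dimensional linear subspaces of $V^*$.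
   Formalization: The formal statement assumes n+1 ≥ 14, so that 14-dimensional subspaces E of V^* exist; otherwise (ii) and (iii) are vacuous while (i) can fail, e.g. for a smooth cubic in 5 variables, which has slice rank 3. *)

theory Defs
  imports
    "HOL-Analysis.Analysis"
    "HOL-Library.Function_Algebras"
    "HOL-Algebra.Ring_Divisibility"
    "Jordan_Normal_Form.Determinant"
begin

text \<open>
  A complex vector space is given by a scaling \<^term>\<open>s\<close> on a type, in the sense of the locale
  \<^locale>\<open>Vector_Spaces.vector_space\<close>. For a subspace \<^term>\<open>W\<close> of it, functions on \<^term>\<open>W\<close> are
  represented by functions on the whole type that vanish outside \<^term>\<open>W\<close>, so that equality of
  representatives is equality on \<^term>\<open>W\<close>. Sums and products of functions are the pointwise ones.
\<close>

definition fscale :: "complex \<Rightarrow> ('a \<Rightarrow> complex) \<Rightarrow> ('a \<Rightarrow> complex)" where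
  "fscale c g = (\<lambda>x. c * g x)"

lemma vector_space_fscale: "Vector_Spaces.vector_space fscale"
  by unfold_locales (auto simp: fscale_def fun_eq_iff algebra_simps)

definition restrict_fun :: "'w set \<Rightarrow> ('w \<Rightarrow> complex) \<Rightarrow> ('w \<Rightarrow> complex)" where
  "restrict_fun W F = (\<lambda>w. if w \<in> W then F w else 0)"

definition linear_forms ::
  "(complex \<Rightarrow> 'w::ab_group_add \<Rightarrow> 'w) \<Rightarrow> 'w set \<Rightarrow> ('w \<Rightarrow> complex) set" where
  "linear_forms s W = {l. (\<forall>x\<in>W. \<forall>y\<in>W. l (x + y) = l x + l y) \<and>
     (\<forall>c. \<forall>x\<in>W. l (s c x) = c * l x) \<and> (\<forall>x. x \<notin> W \<longrightarrow> l x = 0)}"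

text \<open>
  The homogeneous polynomials of degree \<^term>\<open>d\<close> on \<^term>\<open>W\<close>, as polynomial functions (the field
  is infinite): linear combinations of products of \<^term>\<open>d\<close> linear forms.
  If \<^term>\<open>W\<close> is the dual of \<open>U\<close>, this is \<open>S\<^sup>d U\<close>.
\<close>

definition hom_polys ::
  "(complex \<Rightarrow> 'w::ab_group_add \<Rightarrow> 'w) \<Rightarrow> 'w set \<Rightarrow> nat \<Rightarrow> ('w \<Rightarrow> complex) set" where
  "hom_polys s W d = module.span fscale
     {restrict_fun W (\<lambda>w. \<Prod>i<d. l i w) | l. \<forall>i<d. l i \<in> linear_forms s W}"

definition poly_ring ::
  "(complex \<Rightarrow> 'w::ab_group_add \<Rightarrow> 'w) \<Rightarrow> 'w set \<Rightarrow> ('w \<Rightarrow> complex) ring" where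
  "poly_ring s W = \<lparr>carrier = module.span fscale (\<Union>d. hom_polys s W d),
     mult = (\<lambda>F G. F * G), one = restrict_fun W (\<lambda>_. 1), zero = 0, add = (\<lambda>F G. F + G)\<rparr>"

text \<open>The slice rank of \<^term>\<open>F \<in> hom_polys s W d\<close>.\<close>

definition slice_rank ::
  "(complex \<Rightarrow> 'w::ab_group_add \<Rightarrow> 'w) \<Rightarrow> 'w set \<Rightarrow> nat \<Rightarrow> ('w \<Rightarrow> complex) \<Rightarrow> nat" where
  "slice_rank s W d F = (LEAST r. \<exists>l h.
     (\<forall>i<r. l i \<in> hom_polys s W 1 \<and> h i \<in> hom_polys s W (d - 1)) \<and> F = (\<Sum>i<r. l i * h i))"

definition dual_space ::
  "(complex \<Rightarrow> 'v::ab_group_add \<Rightarrow> 'v) \<Rightarrow> ('v \<Rightarrow> complex) set" where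
  "dual_space s = {\<phi>. Vector_Spaces.linear s (*) \<phi>}"

text \<open>The Grassmannian of \<^term>\<open>k\<close>-dimensional linear subspaces of the dual space.\<close>

definition dual_grassmannian ::
  "(complex \<Rightarrow> 'v::ab_group_add \<Rightarrow> 'v) \<Rightarrow> nat \<Rightarrow> ('v \<Rightarrow> complex) set set" where
  "dual_grassmannian s k =
     {E. module.subspace fscale E \<and> E \<subseteq> dual_space s \<and> vector_space.dim fscale E = k}"

text \<open>
  \<open>e\<^sub>0 \<and> \<dots> \<and> e\<^sub>k\<^sub>-\<^sub>1\<close> as the alternating form \<open>(v\<^sub>0, \<dots>, v\<^sub>k\<^sub>-\<^sub>1) \<mapsto> det (e\<^sub>j (v\<^sub>i))\<close>
  on the original space; only the first \<^term>\<open>k\<close> entries of \<^term>\<open>e\<close> and \<^term>\<open>v\<close> matter.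
\<close>

definition wedge :: "nat \<Rightarrow> (nat \<Rightarrow> 'v \<Rightarrow> complex) \<Rightarrow> ((nat \<Rightarrow> 'v) \<Rightarrow> complex)" where
  "wedge k e = (\<lambda>v. Determinant.det (Matrix.mat k k (\<lambda>(i, j). e j (v i))))"

definition dual_exterior_power ::
  "(complex \<Rightarrow> 'v::ab_group_add \<Rightarrow> 'v) \<Rightarrow> nat \<Rightarrow> ((nat \<Rightarrow> 'v) \<Rightarrow> complex) set" where
  "dual_exterior_power s k = module.span fscale {wedge k e | e. \<forall>i<k. e i \<in> dual_space s}"

definition ordered_basis ::
  "nat \<Rightarrow> (nat \<Rightarrow> 'v \<Rightarrow> complex) \<Rightarrow> ('v \<Rightarrow> complex) set \<Rightarrow> bool" where
  "ordered_basis k e E \<longleftrightarrow> inj_on e {..<k} \<and> \<not> module.dependent fscale (e ` {..<k}) \<and>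
     module.span fscale (e ` {..<k}) = E"

text \<open>
  The points of the Grassmannian whose image under the Pluecker embedding
  \<open>E \<mapsto> [e\<^sub>0 \<and> \<dots> \<and> e\<^sub>k\<^sub>-\<^sub>1]\<close> is not a zero of \<^term>\<open>p\<close>. For homogeneous \<^term>\<open>p\<close>
  this does not depend on the choice of the basis.
\<close>

definition plucker_nonzero ::
  "(complex \<Rightarrow> 'v::ab_group_add \<Rightarrow> 'v) \<Rightarrow> nat \<Rightarrow> (((nat \<Rightarrow> 'v) \<Rightarrow> complex) \<Rightarrow> complex)
    \<Rightarrow> ('v \<Rightarrow> complex) set set" where
  "plucker_nonzero s k p =
     {E \<in> dual_grassmannian s k. \<exists>e. ordered_basis k e E \<and> p (wedge k e) \<noteq> 0}"

text \<open>
  The Zariski topology, induced from the projective space of the exterior power: the sets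
  \<^term>\<open>plucker_nonzero s k p\<close> for homogeneous polynomials \<^term>\<open>p\<close> of any degree are a base.
\<close>

definition zariski_grassmannian ::
  "(complex \<Rightarrow> 'v::ab_group_add \<Rightarrow> 'v) \<Rightarrow> nat \<Rightarrow> ('v \<Rightarrow> complex) set topology" where
  "zariski_grassmannian s k = topology_generated_by
     {plucker_nonzero s k p | p d. p \<in> hom_polys fscale (dual_exterior_power s k) d}"

definition for_generic_subspace ::
  "(complex \<Rightarrow> 'v::ab_group_add \<Rightarrow> 'v) \<Rightarrow> nat \<Rightarrow> (('v \<Rightarrow> complex) set \<Rightarrow> bool) \<Rightarrow> bool" where
  "for_generic_subspace s k P \<longleftrightarrow> (\<exists>\<U>. openin (zariski_grassmannian s k) \<U> \<and>
     zariski_grassmannian s k closure_of \<U> = topspace (zariski_grassmannian s k) \<and>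
     (\<forall>E\<in>\<U>. P E))"

lemma topspace_zariski_grassmannian:
  fixes s :: "complex \<Rightarrow> 'v::ab_group_add \<Rightarrow> 'v"
  assumes "0 < k"
  shows "topspace (zariski_grassmannian s k) = dual_grassmannian s k"
proof -
  interpret F: Vector_Spaces.vector_space "fscale :: complex \<Rightarrow> ('v \<Rightarrow> complex) \<Rightarrow> _"
    by (rule vector_space_fscale)
  interpret G: Vector_Spaces.vector_space
    "fscale :: complex \<Rightarrow> ((nat \<Rightarrow> 'v) \<Rightarrow> complex) \<Rightarrow> _"
    by (rule vector_space_fscale)
  interpret H: Vector_Spaces.vector_space
    "fscale :: complex \<Rightarrow> (((nat \<Rightarrow> 'v) \<Rightarrow> complex) \<Rightarrow> complex) \<Rightarrow> _"
    by (rule vector_space_fscale)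
  let ?L = "dual_exterior_power s k"
  let ?p = "restrict_fun ?L (\<lambda>_. 1)"
  have p: "?p \<in> hom_polys fscale ?L 0"
    unfolding hom_polys_def by (rule H.span_base) auto
  have "E \<in> plucker_nonzero s k ?p" if E: "E \<in> dual_grassmannian s k" for E
  proof -
    have sub: "F.subspace E" and dual: "E \<subseteq> dual_space s" and dim: "F.dim E = k"
      using E by (auto simp: dual_grassmannian_def)
    obtain B where B: "B \<subseteq> E" "F.independent B" "E \<subseteq> F.span B" "card B = k"
      using F.basis_exists dim by metis
    have "finite B" using B(4) assms card.infinite by fastforce
    then obtain e where e: "bij_betw e {..<k} B"
      using B(4) ex_bij_betw_nat_finite[of B] by (auto simp: atLeast0LessThan)
    then have im: "e ` {..<k} = B" and inj: "inj_on e {..<k}"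
      by (auto simp: bij_betw_def)
    have "F.span B = E" using B sub by (simp add: F.span_minimal subset_antisym)
    then have ob: "ordered_basis k e E"
      using im inj B(2) by (simp add: ordered_basis_def)
    have "\<forall>i<k. e i \<in> dual_space s" using im B(1) dual by blast
    then have "wedge k e \<in> ?L"
      unfolding dual_exterior_power_def by (intro G.span_base) auto
    then have "?p (wedge k e) \<noteq> 0" by (simp add: restrict_fun_def)
    then show ?thesis using E ob unfolding plucker_nonzero_def by blast
  qed
  moreover have "plucker_nonzero s k q \<subseteq> dual_grassmannian s k" for q
    by (auto simp: plucker_nonzero_def)
  ultimately show ?thesis
    unfolding zariski_grassmannian_def topology_generated_by_topspace using p by blast
qed

end

theory Submission
  imports Defs "HOL-Computational_Algebra.Fundamental_Theorem_Algebra"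
begin

text \<open>
  Let \<open>\<phi>\<close> be the polarization of the cubic \<open>f\<close>. Linear forms generate the ideal of a linear
  subspace, so a cubic has slice rank at most \<open>r\<close> if and only if it vanishes on the common kernel of
  \<open>r\<close> linear forms (\<open>slice_rank_le_iff\<close>). All three conditions thus concern subspaces that are
  isotropic for \<open>\<phi>\<close>.
  As \<open>f\<close> is irreducible, its slice rank is at least two, and slice rank does not increase under
  restriction. Three facts remain.

  If all restrictions to dimension \<open>14\<close> have slice rank at most two, so has \<open>f\<close>. The dimension is raised
  one by one (\<open>isotropic_codim_two_step\<close>). Let \<open>N \<ge> 15\<close>, and let every hyperplane contain an isotropic
  subspace of dimension \<open>N - 3\<close>. If \<open>\<phi>\<close> is degenerate, a vector of its kernel can be adjoined to one of
  them. Otherwise consider the sums \<open>L1 + L2\<close> of two such subspaces. If \<open>L1 + L2\<close> is the whole space,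
  the elements of \<open>L1 \<inter> L2\<close> act as \<open>3 \<times> 3\<close> matrices, so \<open>N - 6 \<le> 9\<close>; in the one remaining case \<open>N = 15\<close>
  all matrices occur, and a third isotropic subspace gives a contradiction. If \<open>L1 + L2\<close> is a
  hyperplane, either there are isotropic subspaces of codimension two in it for sufficiently many of
  its own hyperplanes, and the same kind of argument yields one of codimension one
  (\<open>isotropic_hyperplane_step\<close>); or all products of two elements of \<open>L1 \<inter> L2\<close> vanish, and its
  \<open>N - 5 \<ge> 10\<close> dimensions are too many for the nine parameters of the remaining forms. If all sums are
  smaller, then \<open>L1 + L2\<close> itself is isotropic, of codimension two (\<open>sunflower\<close>).

  Generic restrictions of \<open>f\<close> have slice rank at least two, that is, no linear factor. A resultant
  along a line together with the tangent hyperplanes at its intersection points with the cubic gives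
  a polynomial in three vectors that vanishes whenever their span lies in a subspace on which \<open>f\<close> has
  a linear factor (\<open>eliminant_zero_if_linear_factor\<close>), but does not vanish identically
  (\<open>eliminant_nonzero_exists\<close>). Contractions of \<open>e\<^sub>0 \<and> \<dots> \<and> e\<^sub>k\<^sub>-\<^sub>1\<close> with fixed vectors turn it into a
  homogeneous polynomial in the Pluecker coordinates. Its nonvanishing defines a nonempty open set,
  which is dense because any two points of the Grassmannian are joined by a line of tuples along
  which all the polynomials involved are polynomials in one parameter
  (\<open>for_generic_of_nonempty_plucker\<close>).

  Finally, if the slice rank is at most two on a dense open set, it is so everywhere
  (\<open>slice_rank_le_2_of_generic\<close>): every subspace is a limit along such a line, and after normalisation
  the pairs of linear forms that cut out the isotropic subspaces have a convergent subsequence.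
\<close>

section \<open>Subspaces of finite-dimensional spaces\<close>

context finite_dimensional_vector_space
begin

lemma subset_span_Un: "S \<subseteq> span (S \<union> T)" "T \<subseteq> span (S \<union> T)"
  using span_superset[of "S \<union> T"] by auto

lemma mem_span_Un:
  assumes "subspace S" "subspace T"
  shows "x \<in> span (S \<union> T) \<longleftrightarrow> (\<exists>a\<in>S. \<exists>b\<in>T. x = a + b)"
proof -
  have "span S = S" "span T = T" using assms by simp_all
  then show ?thesis unfolding span_Un by (simp only:) blast
qed

lemma dim_span_Un_Int:
  assumes "subspace S" "subspace T"
  shows "dim (span (S \<union> T)) + dim (S \<inter> T) = dim S + dim T"
proof -
  have "span S = S" "span T = T" using assms by simp_all
  then have "span (S \<union> T) = {x + y |x y. x \<in> S \<and> y \<in> T}" unfolding span_Un by (simp only:)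
  then show ?thesis using dim_sums_Int[OF assms] by simp
qed

lemma dim_span_insert:
  assumes "subspace S" "z \<notin> S"
  shows "dim (span (insert z S)) = dim S + 1"
proof -
  have "z \<notin> span S" using assms by (metis span_eq_iff)
  then show ?thesis using dim_insert[of z S] by simp
qed

text \<open>One functional lowers the dimension by at most one, because a vector outside its kernel spans,
  together with the kernel, the whole subspace.\<close>

lemma dim_common_kernel:
  assumes "finite I" "subspace S" "\<And>i. i \<in> I \<Longrightarrow> Vector_Spaces.linear scale (*) (l i)"
  shows "subspace {x \<in> S. \<forall>i\<in>I. l i x = 0} \<and> dim S \<le> dim {x \<in> S. \<forall>i\<in>I. l i x = 0} + card I"
  using assms(1,3)
proof (induction I rule: finite_induct)
  case empty
  then show ?case using assms(2) by simp
next
  case (insert j I)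
  let ?S = "{x \<in> S. \<forall>i\<in>I. l i x = 0}"
  let ?T = "{x \<in> S. \<forall>i\<in>insert j I. l i x = 0}"
  interpret l: Vector_Spaces.linear scale "(*)" "l j" using insert.prems by blast
  have IH: "subspace ?S" "dim S \<le> dim ?S + card I" using insert by auto
  have T: "?T = ?S \<inter> {x. l j x = 0}" by auto
  have sT: "subspace ?T" unfolding T using IH(1) l.subspace_kernel by (rule subspace_inter)
  have "dim ?S \<le> dim ?T + 1"
  proof (cases "?S \<subseteq> ?T")
    case True
    then show ?thesis using dim_subset[OF True] by simp
  next
    case False
    then obtain u where u: "u \<in> ?S" "u \<notin> ?T" by blast
    then have lu: "l j u \<noteq> 0" by auto
    have "?S \<subseteq> span (insert u ?T)"
    proof
      fix x assume x: "x \<in> ?S"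
      have "x - scale (l j x / l j u) u \<in> ?S"
        using x u IH(1) by (meson subspace_diff subspace_scale)
      moreover have "l j (x - scale (l j x / l j u) u) = 0"
        using lu by (simp add: l.diff l.scale)
      ultimately have "x - scale (l j x / l j u) u \<in> span ?T"
        unfolding T by (intro span_base) simp
      then show "x \<in> span (insert u ?T)" using span_breakdown_eq by blast
    qed
    then have "dim ?S \<le> dim (span (insert u ?T))" by (rule dim_subset)
    also have "\<dots> = dim ?T + 1" using dim_span_insert[OF sT u(2)] .
    finally show ?thesis .
  qed
  then show ?case using sT IH(2) insert(1,2) by simp
qed

lemma nonzero_in_common_kernel:
  assumes "finite I" "subspace S" "\<And>i. i \<in> I \<Longrightarrow> Vector_Spaces.linear scale (*) (l i)"
    and "card I < dim S"
  obtains x where "x \<in> S" "x \<noteq> 0" "\<And>i. i \<in> I \<Longrightarrow> l i x = 0"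
proof -
  let ?T = "{x \<in> S. \<forall>i\<in>I. l i x = 0}"
  have "dim ?T \<noteq> 0" using dim_common_kernel[of I S l, OF assms(1-3)] assms(4) by linarith
  then have "\<not> ?T \<subseteq> {0}" using dim_eq_0[of ?T] by simp
  then show ?thesis using that by blast
qed

text \<open>A basis of \<open>G\<close>, followed by \<open>z\<close>, extends to a basis of \<open>Y\<close>; the hyperplane is spanned by that
  basis without \<open>z\<close>.\<close>

lemma hyperplane_avoiding:
  assumes "subspace Y" "subspace G" "G \<subseteq> Y" "z \<in> Y" "z \<notin> G"
  shows "\<exists>H. subspace H \<and> G \<subseteq> H \<and> H \<subseteq> Y \<and> dim H + 1 = dim Y \<and> z \<notin> H"
proof -
  obtain B where B: "B \<subseteq> G" "independent B" "G \<subseteq> span B" "card B = dim G"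
    by (rule basis_exists)
  have spB: "span B = G" using B assms(2) by (simp add: span_subspace)
  have ind: "independent (insert z B)"
    using B(2) assms(5) spB independent_insertI by blast
  have "insert z B \<subseteq> Y" using B assms by blast
  then obtain C where C: "insert z B \<subseteq> C" "C \<subseteq> Y" "independent C" "Y \<subseteq> span C"
    using maximal_independent_subset_extend[OF _ ind] by blast
  have finC: "finite C" using C(3) finiteI_independent by blast
  have cardC: "card C = dim Y" using basis_card_eq_dim C by blast
  let ?H = "span (C - {z})"
  have "z \<notin> B" using spB assms(5) span_base by blast
  then have "B \<subseteq> C - {z}" using C by blast
  then have "G \<subseteq> ?H" using spB span_mono by blast
  moreover have "?H \<subseteq> Y" using C(2) assms(1) span_minimal by blast
  moreover have "z \<notin> ?H" using C(1,3) dependent_def by blast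
  moreover have "dim ?H + 1 = dim Y"
  proof -
    have "dim ?H = card (C - {z})"
      using C(3) by (metis Diff_subset dim_span_eq_card_independent independent_mono)
    then show ?thesis using cardC finC C(1) by (metis Suc_eq_plus1 card.remove insert_subset)
  qed
  ultimately show ?thesis by (intro exI[of _ ?H]) auto
qed

text \<open>If \<open>z\<close> is a multiple of \<open>z'\<close> modulo \<open>G\<close>, a hyperplane through \<open>G\<close> that misses \<open>z\<close> also misses \<open>z'\<close>.
  Otherwise \<open>z\<close> stays outside \<open>G\<close> when \<open>z - z'\<close> is adjoined to it, and every hyperplane that
  contains \<open>z - z'\<close> but not \<open>z\<close> misses \<open>z'\<close> too.\<close>

lemma hyperplane_avoiding_two:
  assumes "subspace Y" "subspace G" "G \<subseteq> Y" "z \<in> Y" "z \<notin> G" "z' \<in> Y" "z' \<notin> G"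
  obtains H where "subspace H" "G \<subseteq> H" "H \<subseteq> Y" "dim H + 1 = dim Y" "z \<notin> H" "z' \<notin> H"
proof (cases "z \<in> span (insert z' G)")
  case True
  then obtain c where c: "z - scale c z' \<in> G"
    using span_breakdown_eq assms(2) by (metis span_eq_iff)
  obtain H where H: "subspace H" "G \<subseteq> H" "H \<subseteq> Y" "dim H + 1 = dim Y" "z \<notin> H"
    using hyperplane_avoiding[OF assms(1-5)] by blast
  have "z' \<notin> H"
  proof
    assume "z' \<in> H"
    then have "(z - scale c z') + scale c z' \<in> H"
      using H c by (meson subsetD subspace_add subspace_scale)
    then show False using H by simp
  qed
  then show ?thesis using that H by blast
next
  case False
  let ?G = "span (insert (z - z') G)"
  have GY: "?G \<subseteq> Y" using assms by (intro span_minimal) (auto intro: subspace_diff)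
  have "z \<notin> ?G"
  proof
    assume "z \<in> ?G"
    then obtain c where c: "z - scale c (z - z') \<in> G"
      using span_breakdown_eq assms(2) by (metis span_eq_iff)
    show False
    proof (cases "c = 1")
      case True
      then show False using c assms(7) by simp
    next
      case False
      have "scale (inverse (1 - c)) (z - scale c (z - z')) \<in> G"
        using c assms(2) by (simp add: subspace_scale)
      moreover have "z - scale c (z - z') = scale (1 - c) z + scale c z'"
        by (simp add: algebra_simps)
      ultimately have "z + scale (inverse (1 - c) * c) z' \<in> G"
        using False by (simp add: scale_right_distrib)
      then have "z - scale (- (inverse (1 - c) * c)) z' \<in> span G"
        by (simp add: span_base)
      then show False using \<open>z \<notin> span (insert z' G)\<close> span_breakdown_eq by blast
    qed
  qed
  then obtain H where H: "subspace H" "?G \<subseteq> H" "H \<subseteq> Y" "dim H + 1 = dim Y" "z \<notin> H"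
    using hyperplane_avoiding[OF assms(1) subspace_span GY assms(4)] by blast
  have "z - z' \<in> H" "G \<subseteq> H" using H(2) span_superset[of "insert (z - z') G"] by auto
  moreover have "z' \<notin> H"
  proof
    assume "z' \<in> H"
    then have "(z - z') + z' \<in> H" using \<open>z - z' \<in> H\<close> H(1) subspace_add by blast
    then show False using H by simp
  qed
  ultimately show ?thesis using that H by blast
qed

lemma dim_Int_hyperplane:
  assumes "subspace Y" "subspace H" "H \<subseteq> Y" "dim H + 1 = dim Y"
    and "subspace F" "F \<subseteq> Y" "\<not> F \<subseteq> H"
  shows "dim (F \<inter> H) + 1 = dim F"
proof -
  have "span (F \<union> H) \<subseteq> Y" using assms by (intro span_minimal) auto
  then have le: "dim (span (F \<union> H)) \<le> dim Y" by (rule dim_subset)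
  have "H \<subseteq> span (F \<union> H)" by (rule subset_span_Un)
  moreover have "H \<noteq> span (F \<union> H)" using assms(7) subset_span_Un(1)[of F H] by blast
  ultimately have "dim H < dim (span (F \<union> H))"
    using dim_psubset[of H "F \<union> H"] assms(2) by (metis dim_span psubsetI span_eq_iff)
  then have "dim (span (F \<union> H)) = dim Y" using le assms(4) by linarith
  then show ?thesis using dim_span_Un_Int[OF assms(5,2)] assms(4) by linarith
qed

end

section \<open>Isotropic subspaces of a symmetric trilinear form\<close>

text \<open>A cubic form is represented by its polarization \<open>\<phi>\<close>, so that its vanishing on a subspace becomes
  a multilinear condition.\<close>

locale cubic_form = finite_dimensional_vector_space scale Basis
  for scale :: "complex \<Rightarrow> 'a::ab_group_add \<Rightarrow> 'a" and Basis :: "'a set" +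
  fixes \<phi> :: "'a \<Rightarrow> 'a \<Rightarrow> 'a \<Rightarrow> complex"
  assumes swap12: "\<phi> x y z = \<phi> y x z" and swap23: "\<phi> x y z = \<phi> x z y"
    and add1: "\<phi> (x + x') y z = \<phi> x y z + \<phi> x' y z"
    and scale1: "\<phi> (scale c x) y z = c * \<phi> x y z"
begin

lemma add2: "\<phi> x (y + y') z = \<phi> x y z + \<phi> x y' z"
  using add1 swap12 by metis

lemma add3: "\<phi> x y (z + z') = \<phi> x y z + \<phi> x y z'"
  using add2 swap23 by metis

lemma scale2: "\<phi> x (scale c y) z = c * \<phi> x y z"
  using scale1 swap12 by metis

lemma scale3: "\<phi> x y (scale c z) = c * \<phi> x y z"
  using scale2 swap23 by metis

lemma linear_first_argument: "Vector_Spaces.linear scale (*) (\<lambda>x. \<phi> x y z)"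
  by unfold_locales (simp_all add: add1 scale1 algebra_simps)

lemma zero1: "\<phi> 0 y z = 0" and zero2: "\<phi> x 0 z = 0" and zero3: "\<phi> x y 0 = 0"
  using scale1[of 0 0] scale2[of _ 0 0] scale3[of _ _ 0 0] by simp_all

lemma minus1: "\<phi> (- x) y z = - \<phi> x y z" and minus2: "\<phi> x (- y) z = - \<phi> x y z"
  and minus3: "\<phi> x y (- z) = - \<phi> x y z"
  using add1[of x "- x"] add2[of _ y "- y"] add3[of _ _ z "- z"]
  by (simp_all add: zero1 zero2 zero3 eq_neg_iff_add_eq_0 add.commute)

definition isotropic :: "'a set \<Rightarrow> bool" where
  "isotropic L \<longleftrightarrow> subspace L \<and> (\<forall>x\<in>L. \<phi> x x x = 0)"

text \<open>Polarization: the values of the cubic on \<open>a + b\<close> and \<open>a - b\<close> determine \<open>\<phi> a a b\<close>, and the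
  quadratic form \<open>\<phi> _ _ z\<close> determines its bilinear form.\<close>

lemma isotropicD:
  assumes "isotropic L" "x \<in> L" "y \<in> L" "z \<in> L"
  shows "\<phi> x y z = 0"
proof -
  have sub: "subspace L" and zero: "\<And>v. v \<in> L \<Longrightarrow> \<phi> v v v = 0"
    using assms by (auto simp: isotropic_def)
  have two: "\<phi> a a b = 0" if "a \<in> L" "b \<in> L" for a b
  proof -
    have "\<phi> (a + b) (a + b) (a + b) = 0" "\<phi> (a + - b) (a + - b) (a + - b) = 0"
      by (rule zero, rule subspace_add[OF sub that])
        (rule zero, rule subspace_add[OF sub that(1) subspace_neg[OF sub that(2)]])
    moreover have "\<phi> (a + b) (a + b) (a + b)
        = \<phi> a a a + 3 * \<phi> a a b + 3 * \<phi> a b b + \<phi> b b b"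
      using swap12[of b a a] swap12[of b a b] swap23[of a b a] swap23[of b b a]
      by (simp add: add1 add2 add3)
    moreover have "\<phi> (a + - b) (a + - b) (a + - b)
        = \<phi> a a a - 3 * \<phi> a a b + 3 * \<phi> a b b - \<phi> b b b"
      using swap12[of b a a] swap12[of b a b] swap23[of a b a] swap23[of b b a]
      by (simp add: add1 add2 add3 minus1 minus2 minus3 del: add_uminus_conv_diff)
    ultimately have "3 * \<phi> a a b + 3 * \<phi> a b b = 0" "3 * \<phi> a b b - 3 * \<phi> a a b = 0"
      using zero[OF that(1)] zero[OF that(2)] by simp_all
    moreover have "6 * \<phi> a a b
        = (3 * \<phi> a a b + 3 * \<phi> a b b) - (3 * \<phi> a b b - 3 * \<phi> a a b)" by simp
    ultimately have "6 * \<phi> a a b = 0" by (simp only: diff_0_right)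
    then show ?thesis by simp
  qed
  have "\<phi> (x + y) (x + y) z = 0" using two assms sub subspace_add by blast
  moreover have "\<phi> (x + y) (x + y) z = \<phi> x x z + 2 * \<phi> x y z + \<phi> y y z"
    using swap12[of y x z] by (simp add: add1 add2)
  ultimately show ?thesis using two assms by simp
qed

lemma nonzero_element:
  assumes "0 < dim V"
  obtains v where "v \<in> V" "v \<noteq> 0"
proof (rule ccontr)
  assume "\<not> thesis"
  then have "V \<subseteq> {0}" using that by blast
  then have "dim V = 0" using dim_eq_0[of V] by (rule iffD2[rotated])
  then show False using assms by linarith
qed

lemma isotropic_subspace: "isotropic L \<Longrightarrow> subspace L"
  by (simp add: isotropic_def)

lemma isotropic_shrink:
  assumes "isotropic L" "d \<le> dim L"
  obtains L' where "isotropic L'" "L' \<subseteq> L" "dim L' = d"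
proof -
  have sp: "span L = L" using assms isotropic_subspace by simp
  obtain T where "subspace T" "T \<subseteq> span L" "dim T = d"
    using choose_subspace_of_subspace[OF assms(2)] by blast
  then show ?thesis using that[of T] assms(1) sp unfolding isotropic_def by auto
qed

lemma form_zero_on_span:
  assumes "\<And>a b. a \<in> S \<Longrightarrow> b \<in> S \<Longrightarrow> \<phi> m a b = 0" "x \<in> span S" "y \<in> span S"
  shows "\<phi> m x y = 0"
proof -
  have "\<phi> m x b = 0" if "b \<in> S" for b
    using assms(2)
  proof (induction rule: span_induct_alt)
    case base
    then show ?case by (simp add: zero2)
  next
    case (step c u v)
    then show ?case using assms(1)[OF step(1) that] by (simp add: add2 scale2)
  qed
  note b = this
  show ?thesis using assms(3)
  proof (induction rule: span_induct_alt)
    case base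
    then show ?case by (simp add: zero3)
  next
    case (step c u v)
    then show ?case using b[OF step(1)] by (simp add: add3 scale3)
  qed
qed

lemma isotropic_insert:
  assumes "isotropic L" "L \<subseteq> Y" "z \<in> Y" "\<And>a b. a \<in> Y \<Longrightarrow> b \<in> Y \<Longrightarrow> \<phi> z a b = 0"
  shows "isotropic (span (insert z L))"
  unfolding isotropic_def
proof (intro conjI ballI)
  show "subspace (span (insert z L))" by simp
  fix x assume "x \<in> span (insert z L)"
  then obtain k where k: "x - scale k z \<in> L"
    using span_breakdown_eq assms(1) isotropic_subspace by (metis span_eq_iff)
  define a where "a = x - scale k z"
  have x: "x = a + scale k z" and a: "a \<in> L" "a \<in> Y" using k assms(2) by (auto simp: a_def)
  have z: "\<phi> z b c = 0" "\<phi> b z c = 0" "\<phi> b c z = 0" if "b \<in> Y" "c \<in> Y" for b c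
    using assms(4) that swap12 swap23 by metis+
  show "\<phi> x x x = 0" unfolding x using a assms(3) z isotropicD[OF assms(1) a(1) a(1) a(1)]
    by (simp add: add1 add2 add3 scale1 scale2 scale3)
qed

lemma subspace_complement:
  assumes "subspace M" "subspace L" "M \<subseteq> L"
  obtains P where "finite P" "P \<subseteq> L" "card P + dim M = dim L" "span (M \<union> P) = L"
proof -
  obtain B where B: "B \<subseteq> M" "independent B" "M \<subseteq> span B" "card B = dim M"
    by (rule basis_exists)
  obtain C where C: "B \<subseteq> C" "C \<subseteq> L" "independent C" "L \<subseteq> span C"
    using maximal_independent_subset_extend[of B L] B assms(3) by blast
  have finC: "finite C" using C(3) finiteI_independent by blast
  have "card (C - B) + dim M = dim L"
  proof -
    have "card B = dim M" "card C = dim L" using basis_card_eq_dim B C by blast+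
    then show ?thesis using C(1) finC
      by (metis add.commute card_Diff_subset card_mono finite_subset le_add_diff_inverse)
  qed
  moreover have "span (M \<union> (C - B)) = L"
  proof (rule subset_antisym)
    show "span (M \<union> (C - B)) \<subseteq> L" using assms C(2) by (intro span_minimal) auto
    have "C \<subseteq> M \<union> (C - B)" using B(1) by blast
    then show "L \<subseteq> span (M \<union> (C - B))" using C(4) span_mono by blast
  qed
  ultimately show ?thesis using that[of "C - B"] finC C(2) by blast
qed

text \<open>For \<open>z\<close> in both isotropic subspaces the bilinear form \<open>\<phi> z\<close> vanishes on \<open>L1 \<times> L1\<close> and on
  \<open>L2 \<times> L2\<close>, so on \<open>L1 + L2\<close> it is given by its block between complements \<open>P\<close> and \<open>Q\<close> of the
  intersection.\<close>

lemma zero_on_transversal_pair: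
  assumes L: "isotropic L1" "isotropic L2" and Y: "span (L1 \<union> L2) = Y"
    and P: "P \<subseteq> L1" "span (L1 \<inter> L2 \<union> P) = L1"
    and Q: "Q \<subseteq> L2" "span (L1 \<inter> L2 \<union> Q) = L2"
    and z: "z \<in> L1 \<inter> L2" "\<And>p q. p \<in> P \<Longrightarrow> q \<in> Q \<Longrightarrow> \<phi> z p q = 0"
    and ab: "a \<in> Y" "b \<in> Y"
  shows "\<phi> z a b = 0"
proof -
  let ?M = "L1 \<inter> L2"
  have pq: "\<phi> z q p = 0" if "p \<in> P" "q \<in> Q" for p q
    using z(2)[OF that] swap23[of z q p] by simp
  have in1: "\<phi> z a b = 0" if "a \<in> L1" "b \<in> L1" for a b
    using isotropicD[OF L(1)] that z(1) by blast
  have in2: "\<phi> z a b = 0" if "a \<in> L2" "b \<in> L2" for a b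
    using isotropicD[OF L(2)] that z(1) by blast
  have gen: "\<phi> z a b = 0" if ab: "a \<in> ?M \<union> P \<union> Q" "b \<in> ?M \<union> P \<union> Q" for a b
  proof -
    consider "a \<in> L1 \<and> b \<in> L1" | "a \<in> L2 \<and> b \<in> L2" | "a \<in> P \<and> b \<in> Q" | "a \<in> Q \<and> b \<in> P"
      using ab P(1) Q(1) by blast
    then show ?thesis using in1 in2 pq z(2) by cases auto
  qed
  have "L1 \<subseteq> span (?M \<union> P \<union> Q)" "L2 \<subseteq> span (?M \<union> P \<union> Q)"
    using P(2) Q(2) span_mono[of "?M \<union> P" "?M \<union> P \<union> Q"]
      span_mono[of "?M \<union> Q" "?M \<union> P \<union> Q"] by auto
  then have "Y \<subseteq> span (?M \<union> P \<union> Q)" unfolding Y[symmetric] by (intro span_minimal) auto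
  then show ?thesis using ab form_zero_on_span[of "?M \<union> P \<union> Q" z a b, OF gen] by blast
qed

text \<open>The entries of that block are linear in \<open>z\<close>. An intersection of dimension larger than the size of
  the block contains a vector that annihilates all of them.\<close>

lemma kernel_of_transversal_pair:
  assumes L: "isotropic L1" "isotropic L2" and Y: "span (L1 \<union> L2) = Y"
    and small: "(dim L1 - dim (L1 \<inter> L2)) * (dim L2 - dim (L1 \<inter> L2)) < dim (L1 \<inter> L2)"
  obtains z where "z \<in> L1 \<inter> L2" "z \<noteq> 0" "\<And>a b. a \<in> Y \<Longrightarrow> b \<in> Y \<Longrightarrow> \<phi> z a b = 0"
proof -
  let ?M = "L1 \<inter> L2"
  have sub: "subspace L1" "subspace L2" "subspace ?M"
    using L by (auto simp: isotropic_def subspace_inter)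
  obtain P where P: "finite P" "P \<subseteq> L1" "card P + dim ?M = dim L1" "span (?M \<union> P) = L1"
    using subspace_complement[OF sub(3,1)] by blast
  obtain Q where Q: "finite Q" "Q \<subseteq> L2" "card Q + dim ?M = dim L2" "span (?M \<union> Q) = L2"
    using subspace_complement[OF sub(3,2)] by blast
  have "card (P \<times> Q) < dim ?M"
    using small P(3) Q(3) by (metis card_cartesian_product diff_add_inverse2)
  then obtain z where z: "z \<in> ?M" "z \<noteq> 0"
    and kill: "\<And>i. i \<in> P \<times> Q \<Longrightarrow> \<phi> z (fst i) (snd i) = 0"
    using nonzero_in_common_kernel[of "P \<times> Q" ?M "\<lambda>i x. \<phi> x (fst i) (snd i)"]
      P(1) Q(1) sub(3) linear_first_argument by (metis finite_cartesian_product)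
  have "\<phi> z p q = 0" if "p \<in> P" "q \<in> Q" for p q
    using kill[of "(p, q)"] that by simp
  then have "\<phi> z a b = 0" if "a \<in> Y" "b \<in> Y" for a b
    using zero_on_transversal_pair[OF L Y P(2,4) Q(2,4) z(1)] that by blast
  then show ?thesis using that[OF z] by blast
qed

text \<open>Isotropic subspaces of dimension \<open>d\<close> whose pairwise sums are as small as possible all lie in the
  sum \<open>F\<close> of two of them, unless they contain the intersection of those two. A hyperplane that does
  not contain the intersection therefore contains a member of the family inside \<open>F\<close>, and this member
  is the trace of the hyperplane on \<open>F\<close>. Such traces cover \<open>F\<close>, so the cubic vanishes on \<open>F\<close>.\<close>

lemma sunflower:
  assumes Y: "subspace Y" and Z: "subspace Z" "Z \<subseteq> Y" "2 \<le> dim Z" and d: "3 \<le> d"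
    and cover: "\<And>K. subspace K \<Longrightarrow> K \<subseteq> Y \<Longrightarrow> dim K + 1 = dim Y \<Longrightarrow> \<not> Z \<subseteq> K \<Longrightarrow>
      \<exists>L. isotropic L \<and> L \<subseteq> K \<and> dim L = d"
    and pair: "\<And>L L'. isotropic L \<Longrightarrow> isotropic L' \<Longrightarrow> L \<subseteq> Y \<Longrightarrow> L' \<subseteq> Y \<Longrightarrow>
      dim L = d \<Longrightarrow> dim L' = d \<Longrightarrow> dim (span (L \<union> L')) \<le> d + 1"
  shows "\<exists>F. isotropic F \<and> F \<subseteq> Y \<and> dim F = d + 1"
proof -
  have dims: "0 < dim Z" using Z(3) by simp
  obtain z where z: "z \<in> Z" "z \<noteq> 0" by (rule nonzero_element[OF dims])
  have triv: "subspace {0}" "{0} \<subseteq> Y" using subspace_0[OF Y] by auto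
  have zY: "z \<in> Y" "z \<notin> {0}" using z Z by auto
  obtain K1 where "{0} \<subseteq> K1" and K1: "subspace K1" "K1 \<subseteq> Y" "dim K1 + 1 = dim Y" "z \<notin> K1"
    by (rule hyperplane_avoiding_two[OF Y triv zY zY])
  obtain L1 where L1: "isotropic L1" "L1 \<subseteq> K1" "dim L1 = d"
    using cover[OF K1(1-3)] K1(4) z by blast
  obtain x where x: "x \<in> L1" "x \<noteq> 0" 
  proof -
    have "0 < dim L1" using L1 d by simp
    then show ?thesis using that by (rule nonzero_element)
  qed
  have xY: "x \<in> Y" "x \<notin> {0}" using x L1 K1 by auto
  obtain K2 where "{0} \<subseteq> K2"
    and K2: "subspace K2" "K2 \<subseteq> Y" "dim K2 + 1 = dim Y" "z \<notin> K2" "x \<notin> K2"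
    by (rule hyperplane_avoiding_two[OF Y triv zY xY])
  obtain L2 where L2: "isotropic L2" "L2 \<subseteq> K2" "dim L2 = d"
    using cover[OF K2(1-3)] K2(4) z by blast
  have sub: "subspace L1" "subspace L2" using L1 L2 isotropic_subspace by auto
  have LY: "L1 \<subseteq> Y" "L2 \<subseteq> Y" using L1 L2 K1 K2 by auto
  let ?F = "span (L1 \<union> L2)" and ?M = "L1 \<inter> L2"
  have M: "subspace ?M" using sub by (rule subspace_inter)
  have FY: "?F \<subseteq> Y" using LY Y by (intro span_minimal) auto
  have L1F: "L1 \<subseteq> ?F" and L2F: "L2 \<subseteq> ?F" by (rule subset_span_Un)+
  have "dim ?F \<noteq> d"
  proof
    assume eq: "dim ?F = d"
    have "L1 = ?F" "L2 = ?F"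
      using eq L1(3) L2(3) subspace_dim_equal[OF sub(1) subspace_span L1F]
        subspace_dim_equal[OF sub(2) subspace_span L2F] by simp_all
    then show False using x K2(5) L2(2) by auto
  qed
  moreover have "d \<le> dim ?F" using dim_subset[OF L1F] L1 by simp
  ultimately have dF: "dim ?F = d + 1"
    using pair[OF L1(1) L2(1) LY L1(3) L2(3)] by linarith
  then have dM: "2 \<le> dim ?M" using dim_span_Un_Int[OF sub] L1 L2 d by linarith
  have "\<phi> x x x = 0" if xF: "x \<in> ?F" for x
  proof -
    let ?G = "span {x}"
    have "dim ?G \<le> 1" using dim_le_card[of "{x}" "{x}"] by (simp add: span_superset)
    then have "\<not> ?M \<subseteq> ?G" "\<not> Z \<subseteq> ?G"
      using dM Z(3) dim_subset[of ?M ?G] dim_subset[of Z ?G] by auto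
    then obtain m z where mz: "m \<in> ?M" "m \<notin> ?G" "z \<in> Z" "z \<notin> ?G" by blast
    have "x \<in> Y" using xF FY by blast
    then have GY: "?G \<subseteq> Y" using Y by (intro span_minimal) auto
    have mzY: "m \<in> Y" "z \<in> Y" using mz LY Z by auto
    obtain K where K: "subspace K" "?G \<subseteq> K" "K \<subseteq> Y" "dim K + 1 = dim Y" "m \<notin> K" "z \<notin> K"
      by (rule hyperplane_avoiding_two[OF Y subspace_span GY mzY(1) mz(2) mzY(2) mz(4)])
    obtain L where L: "isotropic L" "L \<subseteq> K" "dim L = d"
      using cover[OF K(1,3,4)] K(6) mz by blast
    have sL: "subspace L" using L isotropic_subspace by blast
    have LYY: "L \<subseteq> Y" using L K by blast
    \<comment> \<open>Otherwise \<open>L + L1\<close> and \<open>L + L2\<close>, of dimension at most \<open>d + 1\<close>, span more than \<open>d + 1\<close>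
      dimensions, so they meet only in \<open>L\<close>; but both contain \<open>L1 \<inter> L2\<close>, which is not in \<open>K\<close>.\<close>
    have "L \<subseteq> ?F"
    proof (rule ccontr)
      assume notF: "\<not> L \<subseteq> ?F"
      let ?A = "span (L1 \<union> L)" and ?B = "span (L2 \<union> L)"
      have "?F \<subseteq> span (?A \<union> ?B)"
        using subset_span_Un[of L1 L] subset_span_Un[of L2 L] by (intro span_mono) auto
      moreover have "L \<subseteq> span (?A \<union> ?B)"
        using subset_span_Un(2)[of L L1] subset_span_Un(1)[of ?A ?B]
          subset_span_Un(2)[of L1 L] by auto
      ultimately have "?F \<subset> span (?A \<union> ?B)" using notF by blast
      then have "d + 1 < dim (span (?A \<union> ?B))"
        using dF dim_psubset[of ?F "?A \<union> ?B"] by (metis dim_span span_span)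
      moreover have "dim ?A \<le> d + 1" "dim ?B \<le> d + 1"
        using pair L1 L2 L LY LYY by auto
      ultimately have "dim (?A \<inter> ?B) \<le> d"
        using dim_span_Un_Int[of ?A ?B] by simp
      moreover have "L \<subseteq> ?A \<inter> ?B" using subset_span_Un(2) by auto
      ultimately have "L = ?A \<inter> ?B"
        using L(3) sL by (intro subspace_dim_equal) (auto intro: subspace_inter)
      moreover have "?M \<subseteq> ?A \<inter> ?B"
        using subset_span_Un(1)[of L1 L] subset_span_Un(1)[of L2 L] by auto
      ultimately show False using mz K(5) L(2) by blast
    qed
    then have "L \<subseteq> ?F \<inter> K" using L by blast
    moreover have "dim (?F \<inter> K) + 1 = dim ?F"
      using dim_Int_hyperplane[OF Y K(1,3,4) subspace_span FY] mz K(5) L1F by blast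
    ultimately have "L = ?F \<inter> K"
      using L(3) dF sL K(1) by (intro subspace_dim_equal) (auto intro: subspace_inter)
    then have "x \<in> L" using xF K(2) span_base[of x "{x}"] by auto
    then show ?thesis using L(1) by (simp add: isotropic_def)
  qed
  then have "isotropic ?F" by (simp add: isotropic_def)
  then show ?thesis using FY dF by blast
qed

text \<open>If two members of the family span \<open>Y\<close>, their intersection has dimension \<open>dim Y - 4\<close> and carries a
  \<open>2 \<times> 2\<close> block of functionals; as \<open>dim Y - 4 > 4\<close>, some \<open>z\<close> satisfies \<open>\<phi> z = 0\<close> on \<open>Y\<close> and may be
  adjoined to a member that does not contain it. If no two members span \<open>Y\<close>, the previous lemma
  applies. The subspace \<open>Z\<close> allows exceptional hyperplanes, which occur when this is applied below.\<close>

lemma isotropic_hyperplane_step: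
  assumes Y: "subspace Y" "9 \<le> dim Y" and Z: "subspace Z" "Z \<subseteq> Y" "2 \<le> dim Z"
    and cover: "\<And>K. subspace K \<Longrightarrow> K \<subseteq> Y \<Longrightarrow> dim K + 1 = dim Y \<Longrightarrow> \<not> Z \<subseteq> K \<Longrightarrow>
      \<exists>L. isotropic L \<and> L \<subseteq> K \<and> dim L + 2 = dim Y"
  shows "\<exists>F. isotropic F \<and> F \<subseteq> Y \<and> dim F + 1 = dim Y"
proof (cases "\<exists>L1 L2. isotropic L1 \<and> isotropic L2 \<and> dim L1 + 2 = dim Y \<and> dim L2 + 2 = dim Y
    \<and> span (L1 \<union> L2) = Y")
  case True
  then obtain L1 L2 where L: "isotropic L1" "isotropic L2" "dim L1 + 2 = dim Y"
    "dim L2 + 2 = dim Y" and span: "span (L1 \<union> L2) = Y" by blast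
  have dM: "dim (L1 \<inter> L2) + 4 = dim Y"
    using dim_span_Un_Int[of L1 L2] L span isotropic_subspace by simp
  have "dim L1 - dim (L1 \<inter> L2) = 2" "dim L2 - dim (L1 \<inter> L2) = 2" using L dM by linarith+
  then have "(dim L1 - dim (L1 \<inter> L2)) * (dim L2 - dim (L1 \<inter> L2)) < dim (L1 \<inter> L2)"
    using dM Y(2) by simp
  then obtain z where z: "z \<in> L1 \<inter> L2" "z \<noteq> 0" "\<And>a b. a \<in> Y \<Longrightarrow> b \<in> Y \<Longrightarrow> \<phi> z a b = 0"
    using kernel_of_transversal_pair[OF L(1,2) span] by blast
  have zY: "z \<in> Y" "z \<notin> {0}" using z span subset_span_Un(1)[of L1 L2] by auto
  have "0 < dim Z" using Z(3) by simp
  then obtain z' where z'0: "z' \<in> Z" "z' \<noteq> 0" by (rule nonzero_element)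
  then have z': "z' \<in> Z" "z' \<in> Y" "z' \<notin> {0}" using Z by auto
  have triv: "subspace {0}" "{0} \<subseteq> Y" using subspace_0[OF Y(1)] by auto
  obtain K where "{0} \<subseteq> K"
    and K: "subspace K" "K \<subseteq> Y" "dim K + 1 = dim Y" "z \<notin> K" "z' \<notin> K"
    by (rule hyperplane_avoiding_two[OF Y(1) triv zY z'(2,3)])
  obtain L where L: "isotropic L" "L \<subseteq> K" "dim L + 2 = dim Y"
    using cover[OF K(1-3)] K(5) z' by blast
  have LY: "L \<subseteq> Y" and zL: "z \<notin> L" using L K by auto
  have "isotropic (span (insert z L))" by (rule isotropic_insert[OF L(1) LY zY(1) z(3)])
  moreover have "span (insert z L) \<subseteq> Y" using zY L K Y(1) by (intro span_minimal) auto
  moreover have "dim (span (insert z L)) = dim L + 1"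
    by (rule dim_span_insert[OF isotropic_subspace[OF L(1)] zL])
  moreover have "dim (span (insert z L)) + 1 = dim Y" using calculation(3) L(3) by linarith
  ultimately show ?thesis by blast
next
  case False
  have "\<exists>F. isotropic F \<and> F \<subseteq> Y \<and> dim F = (dim Y - 2) + 1"
  proof (rule sunflower[OF Y(1) Z])
    show "3 \<le> dim Y - 2" using Y by simp
    show "\<exists>L. isotropic L \<and> L \<subseteq> K \<and> dim L = dim Y - 2"
      if K: "subspace K" "K \<subseteq> Y" "dim K + 1 = dim Y" "\<not> Z \<subseteq> K" for K
    proof -
      obtain L where "isotropic L" "L \<subseteq> K" "dim L + 2 = dim Y" using cover[OF K] by blast
      moreover then have "dim L = dim Y - 2" by linarith
      ultimately show ?thesis by blast
    qed
    show "dim (span (L \<union> L')) \<le> dim Y - 2 + 1"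
      if "isotropic L" "isotropic L'" "L \<subseteq> Y" "L' \<subseteq> Y" "dim L = dim Y - 2" "dim L' = dim Y - 2"
      for L L'
    proof -
      have sub: "span (L \<union> L') \<subseteq> Y" using that Y by (intro span_minimal) auto
      have "dim L + 2 = dim Y" "dim L' + 2 = dim Y" using that(5,6) Y(2) by linarith+
      then have "span (L \<union> L') \<noteq> Y" using False that(1,2) by blast
      then have "dim (span (L \<union> L')) < dim Y"
        using sub Y dim_psubset[of "L \<union> L'" Y] by (metis dim_span psubsetI span_eq_iff)
      then show ?thesis using Y by linarith
    qed
  qed
  then obtain F where F: "isotropic F" "F \<subseteq> Y" "dim F = (dim Y - 2) + 1" by blast
  then have "dim F + 1 = dim Y" using Y(2) by linarith
  then show ?thesis using F by blast
qed


text \<open>If \<open>\<phi>\<close> is nondegenerate on \<open>L1 + L2\<close> and the block between \<open>P\<close> and \<open>Q\<close> has at most as many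
  entries as the intersection has dimensions, the entries are linearly independent functionals,
  since a common zero of all of them is zero. So all but a prescribed one can be made to vanish.\<close>

lemma separating_kernel_vector:
  assumes L: "isotropic L1" "isotropic L2" and Y: "span (L1 \<union> L2) = Y"
    and concise: "\<And>z. z \<in> Y \<Longrightarrow> (\<And>a b. a \<in> Y \<Longrightarrow> b \<in> Y \<Longrightarrow> \<phi> z a b = 0) \<Longrightarrow> z = 0"
    and P: "finite P" "P \<subseteq> L1" "span (L1 \<inter> L2 \<union> P) = L1" "p \<in> P"
    and Q: "finite Q" "Q \<subseteq> L2" "span (L1 \<inter> L2 \<union> Q) = L2" "q \<in> Q"
    and card: "card P * card Q \<le> dim (L1 \<inter> L2)"
  obtains m where "m \<in> L1 \<inter> L2" "\<phi> m p q \<noteq> 0"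
    "\<forall>p'\<in>P. \<forall>q'\<in>Q. (p', q') \<noteq> (p, q) \<longrightarrow> \<phi> m p' q' = 0"
proof -
  let ?I = "P \<times> Q - {(p, q)}"
  have sub: "subspace (L1 \<inter> L2)" using L by (auto simp: isotropic_def subspace_inter)
  have fin: "finite ?I" using P(1) Q(1) by simp
  have "card ?I < card (P \<times> Q)"
    using P(1,4) Q(1,4) by (intro psubset_card_mono) auto
  then have small: "card ?I < dim (L1 \<inter> L2)" using card by (simp add: card_cartesian_product)
  obtain m where m: "m \<in> L1 \<inter> L2" "m \<noteq> 0"
    and kill: "\<And>i. i \<in> ?I \<Longrightarrow> \<phi> m (fst i) (snd i) = 0"
    by (rule nonzero_in_common_kernel[of ?I "L1 \<inter> L2" "\<lambda>i x. \<phi> x (fst i) (snd i)",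
          OF fin sub linear_first_argument small]) blast
  have k: "\<phi> m p' q' = 0" if "p' \<in> P" "q' \<in> Q" "(p', q') \<noteq> (p, q)" for p' q'
    using kill[of "(p', q')"] that by auto
  have "\<phi> m p q \<noteq> 0"
  proof
    assume "\<phi> m p q = 0"
    then have "\<phi> m p' q' = 0" if "p' \<in> P" "q' \<in> Q" for p' q'
      using k[OF that] by (cases "(p', q') = (p, q)") auto
    then have "\<phi> m a b = 0" if "a \<in> Y" "b \<in> Y" for a b
      using zero_on_transversal_pair[OF L Y P(2,3) Q(2,3) m(1)] that by blast
    moreover have "m \<in> Y" using m(1) Y subset_span_Un(1)[of L1 L2] by auto
    ultimately show False using concise[of m] m(2) by blast
  qed
  then show ?thesis using that[OF m(1)] k by blast
qed

lemma complement_extending: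
  assumes "subspace M" "subspace L" "M \<subseteq> L" "p \<in> L" "p \<notin> M"
  obtains P where "finite P" "P \<subseteq> L" "p \<in> P" "card P + dim M \<le> dim L" "span (M \<union> P) = L"
proof -
  let ?M = "span (insert p M)"
  have sub: "?M \<subseteq> L" using assms by (intro span_minimal) auto
  obtain P where P: "finite P" "P \<subseteq> L" "card P + dim ?M = dim L" "span (?M \<union> P) = L"
    by (rule subspace_complement[OF subspace_span assms(2) sub])
  have "card (insert p P) + dim M \<le> dim L"
    using P(1,3) dim_span_insert[OF assms(1,5)] card_insert_le_m1[of "Suc (card P)" P p]
    by (simp add: card_insert_if split: if_splits)
  moreover have "span (M \<union> insert p P) = L"
  proof (rule subset_antisym)
    show "span (M \<union> insert p P) \<subseteq> L" using assms P(2) by (intro span_minimal) auto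
    have "?M \<subseteq> span (M \<union> insert p P)" by (intro span_mono) auto
    moreover have "P \<subseteq> span (M \<union> insert p P)" using span_superset[of "M \<union> insert p P"] by auto
    ultimately have "span (?M \<union> P) \<subseteq> span (M \<union> insert p P)" by (intro span_minimal) auto
    then show "L \<subseteq> span (M \<union> insert p P)" using P(4) by simp
  qed
  ultimately show ?thesis using that[of "insert p P"] P(1,2) assms(4) by auto
qed

lemma complement_extending_two:
  assumes "subspace M" "subspace L" "M \<subseteq> L" "p \<in> L" "p \<notin> M" "a \<in> L" "a \<notin> span (insert p M)"
  obtains P where "finite P" "P \<subseteq> L" "p \<in> P" "a \<in> P" "card P + dim M \<le> dim L"
    "span (M \<union> P) = L"
proof -
  let ?M = "span (insert p M)"
  have sub: "?M \<subseteq> L" using assms by (intro span_minimal) auto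
  obtain P where P: "finite P" "P \<subseteq> L" "a \<in> P" "card P + dim ?M \<le> dim L" "span (?M \<union> P) = L"
    by (rule complement_extending[OF subspace_span assms(2) sub assms(6,7)])
  have "card (insert p P) + dim M \<le> dim L"
    using P(1,4) dim_span_insert[OF assms(1,5)]
    by (simp add: card_insert_if split: if_splits)
  moreover have "span (M \<union> insert p P) = L"
  proof (rule subset_antisym)
    show "span (M \<union> insert p P) \<subseteq> L" using assms P(2) by (intro span_minimal) auto
    have "?M \<subseteq> span (M \<union> insert p P)" by (intro span_mono) auto
    moreover have "P \<subseteq> span (M \<union> insert p P)" using span_superset[of "M \<union> insert p P"] by auto
    ultimately have "span (?M \<union> P) \<subseteq> span (M \<union> insert p P)" by (intro span_minimal) auto
    then show "L \<subseteq> span (M \<union> insert p P)" using P(5) by simp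
  qed
  ultimately show ?thesis using that[of "insert p P"] P(1,2,3) assms(4) by auto
qed

text \<open>If \<open>a\<close> were independent of \<open>p\<close> modulo the intersection, both could be taken as basis vectors of a
  complement. Some \<open>m\<close> then has \<open>(a, q)\<close> as its only nonzero entry, which contradicts the relation.\<close>

lemma transversal_relation_half:
  assumes L: "isotropic L1" "isotropic L2" and Y: "span (L1 \<union> L2) = Y"
    and concise: "\<And>z. z \<in> Y \<Longrightarrow> (\<And>a b. a \<in> Y \<Longrightarrow> b \<in> Y \<Longrightarrow> \<phi> z a b = 0) \<Longrightarrow> z = 0"
    and dims: "dim L1 = dim (L1 \<inter> L2) + 3" "dim L2 = dim (L1 \<inter> L2) + 3" "9 \<le> dim (L1 \<inter> L2)"
    and p: "p \<in> L1" "p \<notin> L2" and q: "q \<in> L2" "q \<notin> L1"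
    and ab: "a \<in> L1" "b \<in> L2"
    and rel: "\<And>m. m \<in> L1 \<inter> L2 \<Longrightarrow> \<phi> m p b + \<phi> m q a = 0"
  shows "a \<in> span (insert p (L1 \<inter> L2))"
proof (rule ccontr)
  let ?M = "L1 \<inter> L2"
  assume a: "a \<notin> span (insert p ?M)"
  have sub: "subspace L1" "subspace L2" "subspace ?M"
    using L by (auto simp: isotropic_def subspace_inter)
  have pM: "p \<notin> ?M" and qM: "q \<notin> ?M" using p q by auto
  obtain P where P: "finite P" "P \<subseteq> L1" "p \<in> P" "a \<in> P" "card P + dim ?M \<le> dim L1"
    "span (?M \<union> P) = L1"
    by (rule complement_extending_two[OF sub(3,1) Int_lower1 p(1) pM ab(1) a])
  obtain Q where Q: "finite Q" "Q \<subseteq> L2" "q \<in> Q" "card Q + dim ?M \<le> dim L2"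
    "span (?M \<union> Q) = L2"
    by (rule complement_extending[OF sub(3,2) Int_lower2 q(1) qM])
  have "card P * card Q \<le> 3 * 3" using P(5) Q(4) dims by (intro mult_le_mono) linarith+
  then have card: "card P * card Q \<le> dim ?M" using dims by linarith
  obtain m where m: "m \<in> ?M" "\<phi> m a q \<noteq> 0"
    and k: "\<forall>p'\<in>P. \<forall>q'\<in>Q. (p', q') \<noteq> (a, q) \<longrightarrow> \<phi> m p' q' = 0"
    by (rule separating_kernel_vector[OF L Y concise P(1,2,6,4) Q(1,2,5,3) card])
  have "p \<noteq> a" using a span_base[of p "insert p ?M"] by auto
  then have Q0: "\<phi> m p q' = 0" if "q' \<in> Q" for q' using k P(3) that by simp
  have "\<phi> m p b = 0"
  proof -
    have "b \<in> span (?M \<union> Q)" using ab(2) Q(5) by simp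
    then show ?thesis
    proof (induction rule: span_induct_alt)
      case base
      then show ?case by (simp add: zero3)
    next
      case (step c x y)
      then show ?case using Q0 isotropicD[OF L(1), of m p x] m(1) p(1)
        by (auto simp: add3 scale3)
    qed
  qed
  then have "\<phi> m q a = 0" using rel[OF m(1)] by simp
  then show False using m(2) swap23[of m a q] by simp
qed

text \<open>Every \<open>3 \<times> 3\<close> matrix \<open>B\<close> occurs as a block, and \<open>B(p, b) + B(a, q) = 0\<close> for all \<open>B\<close> forces \<open>a\<close> and
  \<open>b\<close> to be opposite multiples of \<open>p\<close> and \<open>q\<close> modulo the intersection.\<close>

lemma transversal_relation:
  assumes L: "isotropic L1" "isotropic L2" and Y: "span (L1 \<union> L2) = Y"
    and concise: "\<And>z. z \<in> Y \<Longrightarrow> (\<And>a b. a \<in> Y \<Longrightarrow> b \<in> Y \<Longrightarrow> \<phi> z a b = 0) \<Longrightarrow> z = 0"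
    and dims: "dim L1 = dim (L1 \<inter> L2) + 3" "dim L2 = dim (L1 \<inter> L2) + 3" "9 \<le> dim (L1 \<inter> L2)"
    and p: "p \<in> L1" "p \<notin> L2" and q: "q \<in> L2" "q \<notin> L1" and w: "w \<in> Y"
    and rel: "\<And>m. m \<in> L1 \<inter> L2 \<Longrightarrow> \<phi> m (p + q) w = 0"
  shows "w \<in> span (insert (p - q) (L1 \<inter> L2))"
proof -
  let ?M = "L1 \<inter> L2"
  have sub: "subspace L1" "subspace L2" "subspace ?M"
    using L by (auto simp: isotropic_def subspace_inter)
  obtain a b where ab: "a \<in> L1" "b \<in> L2" and w: "w = a + b"
    using w Y mem_span_Un[OF sub(1,2)] by blast
  have rel': "\<phi> m p b + \<phi> m q a = 0" if "m \<in> ?M" for m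
    using rel[OF that] isotropicD[OF L(1), of m p a] isotropicD[OF L(2), of m q b] ab p q that
    by (simp add: w add2 add3 add.commute)
  have "a \<in> span (insert p ?M)"
    by (rule transversal_relation_half[OF L Y concise dims p q ab rel'])
  then obtain \<alpha> where \<alpha>: "a - scale \<alpha> p \<in> ?M"
    using span_breakdown_eq[of a p ?M] sub(3) by (metis span_eq_iff)
  have c: "L2 \<inter> L1 = ?M" by blast
  have "span (L2 \<union> L1) = Y" using Y by (simp add: Un_commute)
  then have "b \<in> span (insert q (L2 \<inter> L1))"
    using transversal_relation_half[OF L(2,1) _ concise _ _ _ q p ab(2,1)] rel' dims
    unfolding c by (simp add: add.commute)
  then obtain \<beta> where \<beta>: "b - scale \<beta> q \<in> ?M"
    using span_breakdown_eq[of b q ?M] sub(3) unfolding c by (metis span_eq_iff)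
  have "\<alpha> + \<beta> = 0"
  proof (rule ccontr)
    assume ne: "\<alpha> + \<beta> \<noteq> 0"
    have pM: "p \<notin> ?M" and qM: "q \<notin> ?M" using p q by auto
    obtain P where P: "finite P" "P \<subseteq> L1" "p \<in> P" "card P + dim ?M \<le> dim L1"
      "span (?M \<union> P) = L1"
      by (rule complement_extending[OF sub(3,1) Int_lower1 p(1) pM])
    obtain Q where Q: "finite Q" "Q \<subseteq> L2" "q \<in> Q" "card Q + dim ?M \<le> dim L2"
      "span (?M \<union> Q) = L2"
      by (rule complement_extending[OF sub(3,2) Int_lower2 q(1) qM])
    have "card P * card Q \<le> 3 * 3" using P(4) Q(4) dims by (intro mult_le_mono) linarith+
    then have card: "card P * card Q \<le> dim ?M" using dims by linarith
    obtain m where m: "m \<in> ?M" "\<phi> m p q \<noteq> 0"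
      using separating_kernel_vector[OF L Y concise P(1,2,5,3) Q(1,2,5,3) card] by metis
    have "\<phi> m q (a - scale \<alpha> p) = 0" "\<phi> m p (b - scale \<beta> q) = 0"
      using isotropicD[OF L(2), of m q] isotropicD[OF L(1), of m p] m(1) p q \<alpha> \<beta> by auto
    then have "\<phi> m q a = \<alpha> * \<phi> m p q" "\<phi> m p b = \<beta> * \<phi> m p q"
      using add3[of m q "a - scale \<alpha> p" "scale \<alpha> p"] add3[of m p "b - scale \<beta> q" "scale \<beta> q"]
        swap23[of m q p] by (simp_all add: scale3)
    then have "(\<alpha> + \<beta>) * \<phi> m p q = 0" using rel'[OF m(1)] by (simp add: algebra_simps)
    then show False using ne m(2) by simp
  qed
  then have "\<beta> = - \<alpha>" by (simp add: add_eq_0_iff)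
  then have "w - scale \<alpha> (p - q) = (a - scale \<alpha> p) + (b - scale \<beta> q)"
    by (simp add: w algebra_simps)
  then have "w - scale \<alpha> (p - q) \<in> ?M" using \<alpha> \<beta> sub(3) subspace_add by metis
  then show ?thesis using span_breakdown_eq[of w "p - q" ?M] span_base by blast
qed


text \<open>The inductive step. With \<open>N = dim Y\<close>, the good subspaces are the isotropic ones of dimension \<open>N - 3\<close>.
  Assuming the conclusion fails, \<open>\<phi>\<close> is nondegenerate on \<open>Y\<close>, and two good subspaces span neither \<open>Y\<close>
  nor a hyperplane of \<open>Y\<close>; then \<open>sunflower\<close> proves it after all.\<close>

lemma isotropic_codim_two_step:
  assumes Y: "subspace Y" "15 \<le> dim Y"
    and cover: "\<And>H. subspace H \<Longrightarrow> H \<subseteq> Y \<Longrightarrow> dim H + 1 = dim Y \<Longrightarrow>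
      \<exists>L. isotropic L \<and> L \<subseteq> H \<and> dim L + 3 = dim Y"
  shows "\<exists>F. isotropic F \<and> F \<subseteq> Y \<and> dim F + 2 = dim Y"
proof (rule ccontr)
  assume none: "\<nexists>F. isotropic F \<and> F \<subseteq> Y \<and> dim F + 2 = dim Y"
  have triv: "subspace {0}" "{0} \<subseteq> Y" using subspace_0[OF Y(1)] by auto
  \<comment> \<open>A vector \<open>z\<close> with \<open>\<phi> z = 0\<close> could be adjoined to a good subspace that does not contain it.\<close>
  have concise: "z = 0" if z: "z \<in> Y" "\<And>a b. a \<in> Y \<Longrightarrow> b \<in> Y \<Longrightarrow> \<phi> z a b = 0" for z
  proof (rule ccontr)
    assume "z \<noteq> 0"
    then have z0: "z \<notin> {0}" by simp
    obtain K where "{0} \<subseteq> K" and K: "subspace K" "K \<subseteq> Y" "dim K + 1 = dim Y" "z \<notin> K"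
      by (rule hyperplane_avoiding_two[OF Y(1) triv z(1) z0 z(1) z0])
    obtain L where L: "isotropic L" "L \<subseteq> K" "dim L + 3 = dim Y"
      using cover[OF K(1-3)] by blast
    have LY: "L \<subseteq> Y" and zL: "z \<notin> L" using L K by auto
    have "isotropic (span (insert z L))" by (rule isotropic_insert[OF L(1) LY z])
    moreover have "span (insert z L) \<subseteq> Y" using z L K Y(1) by (intro span_minimal) auto
    moreover have "dim (span (insert z L)) = dim L + 1"
      by (rule dim_span_insert[OF isotropic_subspace[OF L(1)] zL])
    moreover have "dim (span (insert z L)) + 2 = dim Y" using calculation(3) L(3) by linarith
    ultimately show False using none by blast
  qed
  let ?good = "\<lambda>L. isotropic L \<and> L \<subseteq> Y \<and> dim L + 3 = dim Y"
  have span_Y: "span (L \<union> L') \<subseteq> Y" if "?good L" "?good L'" for L L'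
    using that Y by (intro span_minimal) auto
  \<comment> \<open>If good subspaces span \<open>Y\<close>, their intersection \<open>M\<close> has dimension \<open>N - 6\<close> and maps injectively to
    \<open>3 \<times> 3\<close> matrices. So \<open>N = 15\<close> and every matrix occurs. A third good subspace \<open>L3\<close>, contained in a
    hyperplane through \<open>M\<close> that contains neither \<open>L1\<close> nor \<open>L2\<close>, contradicts this by a dimension count.\<close>
  have no_transversal: "span (L1 \<union> L2) \<noteq> Y" if good: "?good L1" "?good L2" for L1 L2
  proof
    assume span: "span (L1 \<union> L2) = Y"
    let ?M = "L1 \<inter> L2"
    have L: "isotropic L1" "isotropic L2" and LY: "L1 \<subseteq> Y" "L2 \<subseteq> Y"
      and dL: "dim L1 + 3 = dim Y" "dim L2 + 3 = dim Y" using good by auto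
    have sub: "subspace L1" "subspace L2" "subspace ?M"
      using L by (auto simp: isotropic_def subspace_inter)
    have "dim Y + dim ?M = dim L1 + dim L2" using dim_span_Un_Int[OF sub(1,2)] span by simp
    then have dM: "dim ?M + 6 = dim Y" "dim L1 = dim ?M + 3" "dim L2 = dim ?M + 3"
      using dL by linarith+
    have "dim ?M \<le> 9"
    proof (rule ccontr)
      assume "\<not> dim ?M \<le> 9"
      then have "(dim L1 - dim ?M) * (dim L2 - dim ?M) < dim ?M" using dM by simp
      then obtain z where z: "z \<in> ?M" "z \<noteq> 0" "\<And>a b. a \<in> Y \<Longrightarrow> b \<in> Y \<Longrightarrow> \<phi> z a b = 0"
        using kernel_of_transversal_pair[OF L span] by metis
      then show False using concise[of z] LY by blast
    qed
    then have dim15: "dim ?M = 9" "dim L1 = 12" "dim L2 = 12" "dim Y = 15"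
      using dM Y(2) by linarith+
    have "\<not> L1 \<subseteq> ?M" "\<not> L2 \<subseteq> ?M" using dim_subset[of L1 ?M] dim_subset[of L2 ?M] dim15 by auto
    then obtain p0 q0 where p0: "p0 \<in> L1" "p0 \<notin> ?M" and q0: "q0 \<in> L2" "q0 \<notin> ?M" by blast
    have p0Y: "p0 \<in> Y" and q0Y: "q0 \<in> Y" and MY: "?M \<subseteq> Y" using p0 q0 LY by auto
    obtain H where H: "subspace H" "?M \<subseteq> H" "H \<subseteq> Y" "dim H + 1 = dim Y" "p0 \<notin> H" "q0 \<notin> H"
      by (rule hyperplane_avoiding_two[OF Y(1) sub(3) MY p0Y p0(2) q0Y q0(2)])
    obtain L3 where L3: "isotropic L3" "L3 \<subseteq> H" "dim L3 + 3 = dim Y"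
      using cover[OF H(1,3,4)] by blast
    have sub3: "subspace L3" using L3 isotropic_subspace by blast
    have dL3: "dim L3 = 12" using L3(3) dim15 by simp
    have "\<not> L3 \<subseteq> L1" "\<not> L3 \<subseteq> L2"
      using subspace_dim_equal[OF sub3 sub(1)] subspace_dim_equal[OF sub3 sub(2)] dim15 dL3
        p0 q0 H L3 by auto
    then obtain x y where xy: "x \<in> L3" "x \<notin> L1" "y \<in> L3" "y \<notin> L2" by blast
    have "\<exists>t\<in>L3. t \<notin> L1 \<and> t \<notin> L2"
    proof (cases "x \<in> L2 \<and> y \<in> L1")
      case True
      have "x + y \<notin> L1"
        using subspace_diff[OF sub(1), of "x + y" y] True xy by auto
      moreover have "x + y \<notin> L2"
        using subspace_diff[OF sub(2), of "x + y" x] True xy by auto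
      ultimately show ?thesis using xy sub3 subspace_add by blast
    next
      case False
      then show ?thesis using xy by blast
    qed
    then obtain t where t: "t \<in> L3" "t \<notin> L1" "t \<notin> L2" by blast
    have "t \<in> Y" using t L3 H by blast
    then obtain p q where pq: "p \<in> L1" "q \<in> L2" "t = p + q"
      using span mem_span_Un[OF sub(1,2)] by blast
    have p: "p \<notin> L2" using t(3) pq subspace_add[OF sub(2), of p q] by blast
    have q: "q \<notin> L1" using t(2) pq subspace_add[OF sub(1), of p q] by blast
    \<comment> \<open>In the pairing \<open>(m, w) \<mapsto> \<phi> m t w\<close> of \<open>M\<close> and \<open>L3\<close> the left kernel contains \<open>M \<inter> L3\<close>, so the right
      kernel has dimension at least \<open>12 - (9 - dim (M \<inter> L3))\<close>. But it lies in \<open>M + \<langle>p - q\<rangle>\<close>, which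
      leaves room for \<open>dim (M \<inter> L3) + 1\<close> only.\<close>
    let ?N = "L3 \<inter> ?M"
    have subN: "subspace ?N" using sub3 sub(3) by (rule subspace_inter)
    obtain R where R: "finite R" "R \<subseteq> ?M" "card R + dim ?N = dim ?M" "span (?N \<union> R) = ?M"
      by (rule subspace_complement[OF subN sub(3) Int_lower2])
    let ?W = "{w \<in> L3. \<forall>m\<in>R. \<phi> m t w = 0}"
    have lin: "Vector_Spaces.linear scale (*) (\<lambda>w. \<phi> m t w)" for m
      by unfold_locales (simp_all add: add3 scale3 algebra_simps)
    have dW: "dim L3 \<le> dim ?W + card R"
      using dim_common_kernel[of R L3 "\<lambda>m w. \<phi> m t w", OF R(1) sub3 lin] by blast
    have "?W \<subseteq> L3 \<inter> span (insert (p - q) ?M)"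
    proof
      fix w assume w: "w \<in> ?W"
      have "\<phi> m t w = 0" if "m \<in> ?M" for m
      proof -
        have "m \<in> span (?N \<union> R)" using that R(4) by simp
        then show ?thesis
        proof (induction rule: span_induct_alt)
          case base
          then show ?case by (simp add: zero1)
        next
          case (step c u v)
          then show ?case using w isotropicD[OF L3(1), of u t w] t(1) by (auto simp: add1 scale1)
        qed
      qed
      then have "w \<in> span (insert (p - q) ?M)"
        using w L3(2) H(3) dim15 pq
        by (intro transversal_relation[OF L span concise dM(2,3) _ pq(1) p pq(2) q]) auto
      then show "w \<in> L3 \<inter> span (insert (p - q) ?M)" using w by blast
    qed
    then have "dim ?W \<le> dim (L3 \<inter> span (insert (p - q) ?M))" by (rule dim_subset)
    moreover have "dim (L3 \<inter> span (insert (p - q) ?M)) \<le> dim ?N + 1"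
    proof -
      have "dim (span (insert (p - q) ?M)) \<le> dim ?M + 1"
        using dim_insert[of "p - q" ?M] by simp
      moreover have "span (L3 \<union> ?M) \<subseteq> span (L3 \<union> span (insert (p - q) ?M))"
        using span_superset[of "insert (p - q) ?M"] by (intro span_mono) auto
      then have "dim (span (L3 \<union> ?M)) \<le> dim (span (L3 \<union> span (insert (p - q) ?M)))"
        by (rule dim_subset)
      ultimately show ?thesis
        using dim_span_Un_Int[OF sub3 subspace_span[of "insert (p - q) ?M"]]
          dim_span_Un_Int[OF sub3 sub(3)] by linarith
    qed
    ultimately show False using dW R(3) dL3 dim15 by linarith
  qed
  \<comment> \<open>Suppose good subspaces span a hyperplane \<open>G\<close>. A bad hyperplane \<open>H\<close> is one on whose trace on
    \<open>M = L1 \<inter> L2\<close> all products \<open>\<phi> x y v\<close> with \<open>v\<close> in \<open>Y\<close> vanish. If the hyperplanes that do not contain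
    some \<open>Z \<subseteq> M\<close> are all harmless, the problem reduces to \<open>G\<close>, with codimension one instead of two.
    Otherwise three bad hyperplanes in general position make all products on \<open>M\<close> vanish.\<close>
  have no_hyperplane: "dim (span (L1 \<union> L2)) + 1 \<noteq> dim Y" if good: "?good L1" "?good L2" for L1 L2
  proof
    let ?M = "L1 \<inter> L2" and ?G = "span (L1 \<union> L2)"
    assume dH0: "dim ?G + 1 = dim Y"
    have L: "isotropic L1" "isotropic L2" and LY: "L1 \<subseteq> Y" "L2 \<subseteq> Y"
      and dL: "dim L1 + 3 = dim Y" "dim L2 + 3 = dim Y" using good by auto
    have sub: "subspace L1" "subspace L2" "subspace ?M"
      using L by (auto simp: isotropic_def subspace_inter)
    have H0Y: "?G \<subseteq> Y" by (rule span_Y[OF good])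
    have LH0: "L1 \<subseteq> ?G" "L2 \<subseteq> ?G" by (rule subset_span_Un)+
    have MH0: "?M \<subseteq> ?G" and MY: "?M \<subseteq> Y" using LH0 LY by auto
    have dM: "dim ?M + 5 = dim Y" using dim_span_Un_Int[OF sub(1,2)] dL dH0 by linarith
    let ?bad = "\<lambda>H. subspace H \<and> H \<subseteq> Y \<and> dim H + 1 = dim Y \<and>
      (\<forall>x\<in>?M \<inter> H. \<forall>y\<in>?M \<inter> H. \<forall>v\<in>Y. \<phi> x y v = 0)"
    have bad_exists: "\<exists>H. ?bad H \<and> \<not> Z \<subseteq> H"
      if Z: "subspace Z" "Z \<subseteq> ?M" "2 \<le> dim Z" for Z
    proof (rule ccontr)
      assume no_bad: "\<nexists>H. ?bad H \<and> \<not> Z \<subseteq> H"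
      have "\<exists>F. isotropic F \<and> F \<subseteq> ?G \<and> dim F + 1 = dim ?G"
      proof (rule isotropic_hyperplane_step[OF subspace_span _ Z(1) _ Z(3)])
        show "9 \<le> dim ?G" using dH0 Y by linarith
        show "Z \<subseteq> ?G" using Z(2) MH0 by blast
        fix K assume K: "subspace K" "K \<subseteq> ?G" "dim K + 1 = dim ?G" "\<not> Z \<subseteq> K"
        have "\<not> Y \<subseteq> ?G" using dim_subset[of Y ?G] dH0 by auto
        then obtain r where r: "r \<in> Y" "r \<notin> ?G" by blast
        let ?H = "span (insert r K)"
        have rK: "r \<notin> K" using r K by blast
        have HY: "?H \<subseteq> Y" using r K H0Y Y by (intro span_minimal) auto
        have dH: "dim ?H + 1 = dim Y" using dim_span_insert[OF K(1) rK] K(3) dH0 by linarith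
        have rH: "r \<in> ?H" and KH: "K \<subseteq> ?H" using span_superset[of "insert r K"] by auto
        have H0H: "\<not> ?G \<subseteq> ?H"
        proof
          assume "?G \<subseteq> ?H"
          moreover have "dim ?H \<le> dim ?G" using dH dH0 by linarith
          ultimately have "?G = ?H" by (rule subspace_dim_equal[OF subspace_span subspace_span])
          then show False using rH r(2) by blast
        qed
        have "dim (?G \<inter> ?H) + 1 = dim ?G"
          by (rule dim_Int_hyperplane[OF Y(1) subspace_span HY dH subspace_span H0Y H0H])
        then have KeqI: "K = ?G \<inter> ?H"
          using K KH by (intro subspace_dim_equal) (auto intro: subspace_inter)
        have ZH: "\<not> Z \<subseteq> ?H" using K(4) KeqI Z(2) MH0 by blast
        obtain L where L': "isotropic L" "L \<subseteq> ?H" "dim L + 3 = dim Y"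
          using cover[OF subspace_span HY dH] by blast
        have sL: "subspace L" using L' isotropic_subspace by blast
        have goodL: "?good L" using L' HY by blast
        show "\<exists>L. isotropic L \<and> L \<subseteq> K \<and> dim L + 2 = dim ?G"
        proof (cases "L \<subseteq> ?G")
          case True
          then have "L \<subseteq> K" using KeqI L'(2) by blast
          moreover have "dim L + 2 = dim ?G" using L'(3) dH0 by linarith
          ultimately show ?thesis using L'(1) by blast
        next
          case False
          let ?A = "span (L1 \<union> L)" and ?B = "span (L2 \<union> L)" and ?U = "span (?M \<union> L)"
          have AB: "L1 \<subseteq> ?A" "L2 \<subseteq> ?B" "L \<subseteq> ?A" "L \<subseteq> ?B" "?A \<subseteq> span (?A \<union> ?B)"
            "?B \<subseteq> span (?A \<union> ?B)" by (rule subset_span_Un)+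
          have ABY: "span (?A \<union> ?B) \<subseteq> Y"
            using span_Y[OF good(1) goodL] span_Y[OF good(2) goodL] Y(1)
            by (intro span_minimal) auto
          have "?G \<subseteq> span (?A \<union> ?B)" using AB by (intro span_minimal) auto
          then have "?G \<subset> span (?A \<union> ?B)" using AB False by blast
          then have "dim ?G < dim (span (?A \<union> ?B))"
            using dim_psubset[of ?G "?A \<union> ?B"] by (metis dim_span span_span)
          then have dAB: "dim (span (?A \<union> ?B)) = dim Y" using dim_subset[OF ABY] dH0 by linarith
          have "dim ?A < dim Y" "dim ?B < dim Y"
            using no_transversal[OF good(1) goodL] no_transversal[OF good(2) goodL]
              dim_psubset[of "L1 \<union> L" Y] dim_psubset[of "L2 \<union> L" Y]
              span_Y[OF good(1) goodL] span_Y[OF good(2) goodL] Y(1)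
            by (metis dim_span psubsetI span_eq_iff)+
          then have dAIB: "dim (?A \<inter> ?B) + 2 \<le> dim Y"
            using dim_span_Un_Int[of ?A ?B] dAB by simp
          have "?U \<subseteq> ?A \<inter> ?B" using AB
            by (intro span_minimal) (auto intro: subspace_inter)
          then have dU: "dim ?U + 2 \<le> dim Y" using dim_subset dAIB by (meson add_le_mono1 le_trans)
          have UY: "?U \<subseteq> Y" using MY L' HY Y(1) by (intro span_minimal) auto
          have MU: "?M \<subseteq> ?U" and LU: "L \<subseteq> ?U" by (rule subset_span_Un)+
          have UH: "\<not> ?U \<subseteq> ?H" using ZH Z(2) MU by blast
          have "dim (?U \<inter> ?H) + 1 = dim ?U"
            by (rule dim_Int_hyperplane[OF Y(1) subspace_span HY dH subspace_span UY UH])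
          then have "dim (?U \<inter> ?H) \<le> dim L" using dU L'(3) by linarith
          then have "L = ?U \<inter> ?H"
            using sL LU L'(2) by (intro subspace_dim_equal) (auto intro: subspace_inter)
          then have MHL: "?M \<inter> ?H \<subseteq> L" using MU by blast
          have Yeq: "Y = span (?G \<union> L)"
          proof -
            have s: "span (?G \<union> L) \<subseteq> Y" using H0Y L' HY Y(1) by (intro span_minimal) auto
            have "?G \<subset> span (?G \<union> L)" using subset_span_Un[where S = ?G and T = L] False by blast
            then have "dim ?G < dim (span (?G \<union> L))"
              using dim_psubset[of ?G "?G \<union> L"] by (metis dim_span span_span)
            then have "dim Y \<le> dim (span (?G \<union> L))" using dH0 by linarith
            then show ?thesis using s Y(1) subspace_dim_equal[OF subspace_span Y(1) s] by simp
          qed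
          \<comment> \<open>\<open>M \<inter> H\<close> is contained in the three isotropic subspaces \<open>L1\<close>, \<open>L2\<close> and \<open>L\<close>, whose sum is \<open>Y\<close>.\<close>
          have "\<phi> x y v = 0" if xy: "x \<in> ?M \<inter> ?H" "y \<in> ?M \<inter> ?H" and v: "v \<in> Y" for x y v
          proof -
            obtain h l where h: "h \<in> ?G" "l \<in> L" "v = h + l"
              using v Yeq mem_span_Un[OF subspace_span sL] by blast
            obtain a b where ab: "a \<in> L1" "b \<in> L2" "h = a + b"
              using h(1) mem_span_Un[OF sub(1,2)] by blast
            have "\<phi> x y a = 0" "\<phi> x y b = 0" "\<phi> x y l = 0"
              using isotropicD[OF L(1), of x y a] isotropicD[OF L(2), of x y b]
                isotropicD[OF L'(1), of x y l] xy ab h MHL by auto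
            then show ?thesis using h ab by (simp add: add3)
          qed
          then have "?bad ?H" using HY dH by auto
          then show ?thesis using no_bad ZH by blast
        qed
      qed
      then obtain F where F: "isotropic F" "F \<subseteq> ?G" "dim F + 1 = dim ?G" by blast
      then have "F \<subseteq> Y" "dim F + 2 = dim Y" using H0Y dH0 by auto
      then show False using none F(1) by blast
    qed
    have "2 \<le> dim ?M" using dM Y(2) by linarith
    then obtain H1 where H1: "?bad H1" "\<not> ?M \<subseteq> H1"
      using bad_exists[OF sub(3) order_refl] by blast
    have s1: "subspace H1" "H1 \<subseteq> Y" "dim H1 + 1 = dim Y" using H1(1) by blast+
    have sM1: "subspace (?M \<inter> H1)" using sub(3) s1(1) by (rule subspace_inter)
    have dM1: "dim (?M \<inter> H1) + 1 = dim ?M" by (rule dim_Int_hyperplane[OF Y(1) s1 sub(3) MY H1(2)])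
    then have "2 \<le> dim (?M \<inter> H1)" using dM Y(2) by linarith
    then obtain H2 where H2: "?bad H2" "\<not> ?M \<inter> H1 \<subseteq> H2"
      using bad_exists[OF sM1] by blast
    have s2: "subspace H2" "H2 \<subseteq> Y" "dim H2 + 1 = dim Y" using H2(1) by blast+
    let ?K = "?M \<inter> H1 \<inter> H2"
    have sK: "subspace ?K" using sM1 s2(1) by (rule subspace_inter)
    have M1Y: "?M \<inter> H1 \<subseteq> Y" using MY by blast
    have dK: "dim ?K + 1 = dim (?M \<inter> H1)"
      by (rule dim_Int_hyperplane[OF Y(1) s2 sM1 M1Y H2(2)])
    then have "2 \<le> dim ?K" using dM1 dM Y(2) by linarith
    then obtain H3 where H3: "?bad H3" "\<not> ?K \<subseteq> H3"
      using bad_exists[OF sK] by blast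
    have s3: "subspace H3" "H3 \<subseteq> Y" "dim H3 + 1 = dim Y" using H3(1) by blast+
    have z1: "\<phi> x y v = 0" if "x \<in> ?M \<inter> H1" "y \<in> ?M \<inter> H1" "v \<in> Y" for x y v
      using H1(1) that by blast
    have z2: "\<phi> x y v = 0" if "x \<in> ?M \<inter> H2" "y \<in> ?M \<inter> H2" "v \<in> Y" for x y v
      using H2(1) that by blast
    have z3: "\<phi> x y v = 0" if "x \<in> ?M \<inter> H3" "y \<in> ?M \<inter> H3" "v \<in> Y" for x y v
      using H3(1) that by blast
    have sM2: "subspace (?M \<inter> H2)" and sM3: "subspace (?M \<inter> H3)"
      using sub(3) s2(1) s3(1) by (auto intro: subspace_inter)
    have MH2: "\<not> ?M \<subseteq> H2" and MH3: "\<not> ?M \<subseteq> H3" using H2(2) H3(2) by blast+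
    have dM2: "dim (?M \<inter> H2) + 1 = dim ?M" by (rule dim_Int_hyperplane[OF Y(1) s2 sub(3) MY MH2])
    have dM3: "dim (?M \<inter> H3) + 1 = dim ?M" by (rule dim_Int_hyperplane[OF Y(1) s3 sub(3) MY MH3])
    have KY: "?K \<subseteq> Y" using MY by blast
    have dK3: "dim (?K \<inter> H3) + 1 = dim ?K" by (rule dim_Int_hyperplane[OF Y(1) s3 sK KY H3(2)])
    have span12: "span ((?M \<inter> H1) \<union> (?M \<inter> H2)) = ?M"
    proof (rule subspace_dim_equal[OF subspace_span sub(3)])
      show "span ((?M \<inter> H1) \<union> (?M \<inter> H2)) \<subseteq> ?M" using sub(3) by (intro span_minimal) auto
      have "(?M \<inter> H1) \<inter> (?M \<inter> H2) = ?K" by blast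
      then show "dim ?M \<le> dim (span ((?M \<inter> H1) \<union> (?M \<inter> H2)))"
        using dim_span_Un_Int[OF sM1 sM2] dM1 dM2 dK by simp
    qed
    have spanK3: "span (?K \<union> (?M \<inter> H3)) = ?M"
    proof (rule subspace_dim_equal[OF subspace_span sub(3)])
      show "span (?K \<union> (?M \<inter> H3)) \<subseteq> ?M" using sub(3) by (intro span_minimal) auto
      have "?K \<inter> (?M \<inter> H3) = ?K \<inter> H3" by blast
      then show "dim ?M \<le> dim (span (?K \<union> (?M \<inter> H3)))"
        using dim_span_Un_Int[OF sK sM3] dM3 dK3 by simp
    qed
    \<comment> \<open>A quadratic form on \<open>M\<close> that vanishes on three hyperplanes without a common codimension-two
      subspace is zero: the intersection \<open>K\<close> of the first two is orthogonal to their sum \<open>M\<close>, and the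
      third supplements \<open>K\<close>.\<close>
    have zK: "\<phi> k x v = 0" if k: "k \<in> ?K" and x: "x \<in> ?M" and v: "v \<in> Y" for k x v
    proof -
      obtain a b where ab: "a \<in> ?M \<inter> H1" "b \<in> ?M \<inter> H2" "x = a + b"
        using x span12 mem_span_Un[OF sM1 sM2] by blast
      have "\<phi> k a v = 0" by (rule z1[OF _ ab(1) v]) (use k in blast)
      moreover have "\<phi> k b v = 0" by (rule z2[OF _ ab(2) v]) (use k in blast)
      ultimately show ?thesis by (simp add: ab(3) add2)
    qed
    have zM: "\<phi> x y v = 0" if x: "x \<in> ?M" and y: "y \<in> ?M" and v: "v \<in> Y" for x y v
    proof -
      obtain k a where ka: "k \<in> ?K" "a \<in> ?M \<inter> H3" "x = k + a"
        using x spanK3 mem_span_Un[OF sK sM3] by blast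
      obtain k' a' where ka': "k' \<in> ?K" "a' \<in> ?M \<inter> H3" "y = k' + a'"
        using y spanK3 mem_span_Un[OF sK sM3] by blast
      have aM: "a \<in> ?M" using ka by blast
      show ?thesis
        using zK[OF ka(1) y v] zK[OF ka'(1) aM v] z3[OF ka(2) ka'(2) v] swap12[of a k' v]
        by (simp add: ka(3) ka'(3) add1 add2)
    qed
    obtain P where P: "finite P" "P \<subseteq> L1" "card P + dim ?M = dim L1" "span (?M \<union> P) = L1"
      by (rule subspace_complement[OF sub(3,1) Int_lower1])
    obtain Q where Q: "finite Q" "Q \<subseteq> L2" "card Q + dim ?M = dim L2" "span (?M \<union> Q) = L2"
      by (rule subspace_complement[OF sub(3,2) Int_lower2])
    obtain R where R: "finite R" "R \<subseteq> Y" "card R + dim ?G = dim Y" "span (?G \<union> R) = Y"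
      by (rule subspace_complement[OF subspace_span Y(1) H0Y])
    have cards: "card P = 2" "card Q = 2" "card R = 1" using P(3) Q(3) R(3) dL dM dH0 by linarith+
    \<comment> \<open>Modulo \<open>M\<close>, the space \<open>Y\<close> has dimension \<open>2 + 2 + 1\<close>. As \<open>\<phi> m\<close> vanishes on \<open>L1\<close> and on \<open>L2\<close> it is
      given by the \<open>4 + 5 = 9\<close> entries in this index set, fewer than \<open>dim M = N - 5\<close>.\<close>
    let ?I = "P \<times> Q \<union> R \<times> (P \<union> Q \<union> R)"
    have "card ?I \<le> card (P \<times> Q) + card (R \<times> (P \<union> Q \<union> R))" by (rule card_Un_le)
    moreover have "card (P \<union> Q \<union> R) \<le> 5"
      using card_Un_le[of "P \<union> Q" R] card_Un_le[of P Q] cards by linarith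
    ultimately have "card ?I \<le> 9" using cards by (simp add: card_cartesian_product)
    then have small: "card ?I < dim ?M" using dM Y(2) by linarith
    have finI: "finite ?I" using P Q R by simp
    obtain z where z: "z \<in> ?M" "z \<noteq> 0"
      and kill: "\<And>i. i \<in> ?I \<Longrightarrow> \<phi> z (fst i) (snd i) = 0"
      by (rule nonzero_in_common_kernel[of ?I ?M "\<lambda>i x. \<phi> x (fst i) (snd i)",
            OF finI sub(3) linear_first_argument small]) blast
    have k: "\<phi> z a b = 0" "\<phi> z b a = 0" if "(a, b) \<in> ?I" for a b
      using kill[OF that] swap23[of z a b] by simp_all
    have gen: "\<phi> z a b = 0" if ab: "a \<in> ?M \<union> P \<union> Q \<union> R" "b \<in> ?M \<union> P \<union> Q \<union> R" for a b
    proof -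
      have abY: "a \<in> Y" "b \<in> Y" using ab MY P(2) Q(2) LY R(2) by blast+
      consider "a \<in> ?M" | "b \<in> ?M" | "a \<in> L1 \<and> b \<in> L1" | "a \<in> L2 \<and> b \<in> L2"
        | "(a, b) \<in> ?I" | "(b, a) \<in> ?I"
        using ab P(2) Q(2) by blast
      then show ?thesis
      proof cases
        case 1
        then show ?thesis using zM[OF z(1) _ abY(2)] by blast
      next
        case 2
        then show ?thesis using zM[OF z(1) _ abY(1)] swap23[of z a b] by simp
      next
        case 3
        then show ?thesis using isotropicD[OF L(1), of z a b] z(1) by blast
      next
        case 4
        then show ?thesis using isotropicD[OF L(2), of z a b] z(1) by blast
      qed (use k in blast)+
    qed
    have "Y \<subseteq> span (?M \<union> P \<union> Q \<union> R)"
    proof -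
      let ?S = "?M \<union> P \<union> Q \<union> R"
      have "L1 \<subseteq> span ?S" using P(4) span_mono[of "?M \<union> P" ?S] by auto
      moreover have "L2 \<subseteq> span ?S" using Q(4) span_mono[of "?M \<union> Q" ?S] by auto
      ultimately have "?G \<subseteq> span ?S" by (intro span_minimal) auto
      moreover have "R \<subseteq> span ?S" using span_superset[of ?S] by blast
      ultimately have "span (?G \<union> R) \<subseteq> span ?S" by (intro span_minimal) auto
      then show ?thesis using R(4) by simp
    qed
    then have "\<phi> z a b = 0" if "a \<in> Y" "b \<in> Y" for a b
      using that form_zero_on_span[of "?M \<union> P \<union> Q \<union> R" z a b, OF gen] by blast
    moreover have "z \<in> Y" using z(1) MY by blast
    ultimately show False using concise[of z] z(2) by blast
  qed
  have "\<exists>F. isotropic F \<and> F \<subseteq> Y \<and> dim F = (dim Y - 3) + 1"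
  proof (rule sunflower[OF Y(1) Y(1) order_refl])
    show "2 \<le> dim Y" "3 \<le> dim Y - 3" using Y by simp_all
    show "\<exists>L. isotropic L \<and> L \<subseteq> K \<and> dim L = dim Y - 3"
      if K: "subspace K" "K \<subseteq> Y" "dim K + 1 = dim Y" for K
    proof -
      obtain L where "isotropic L" "L \<subseteq> K" "dim L + 3 = dim Y" using cover[OF K] by blast
      moreover then have "dim L = dim Y - 3" by linarith
      ultimately show ?thesis by blast
    qed
    show "dim (span (L \<union> L')) \<le> dim Y - 3 + 1"
      if "isotropic L" "isotropic L'" "L \<subseteq> Y" "L' \<subseteq> Y" "dim L = dim Y - 3" "dim L' = dim Y - 3"
      for L L'
    proof -
      have "dim L + 3 = dim Y" "dim L' + 3 = dim Y" using that(5,6) Y(2) by linarith+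
      then have good: "?good L" "?good L'" using that by auto
      have "dim (span (L \<union> L')) < dim Y"
        using span_Y[OF good] no_transversal[OF good] Y dim_psubset[of "L \<union> L'" Y]
        by (metis dim_span psubsetI span_eq_iff)
      then show ?thesis using no_hyperplane[OF good] Y by linarith
    qed
  qed
  then obtain F where F: "isotropic F" "F \<subseteq> Y" "dim F = (dim Y - 3) + 1" by blast
  then have "dim F + 2 = dim Y" using Y(2) by linarith
  then show False using none F by blast
qed

theorem isotropic_codim_two:
  assumes base: "\<And>E. subspace E \<Longrightarrow> dim E = 14 \<Longrightarrow> \<exists>L. isotropic L \<and> L \<subseteq> E \<and> 12 \<le> dim L"
    and Y: "subspace Y" "14 \<le> dim Y"
  shows "\<exists>L. isotropic L \<and> L \<subseteq> Y \<and> dim L + 2 = dim Y"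
  using Y
proof (induction "dim Y" arbitrary: Y rule: less_induct)
  case less
  show ?case
  proof (cases "dim Y = 14")
    case True
    then obtain L where L: "isotropic L" "L \<subseteq> Y" "12 \<le> dim L" using base less by blast
    obtain L' where L': "isotropic L'" "L' \<subseteq> L" "dim L' = 12"
      by (rule isotropic_shrink[OF L(1,3)])
    then show ?thesis using True L(2) by (intro exI[of _ L']) auto
  next
    case False
    show ?thesis
    proof (rule isotropic_codim_two_step[OF less(2)])
      show "15 \<le> dim Y" using False less(3) by simp
      fix H assume H: "subspace H" "H \<subseteq> Y" "dim H + 1 = dim Y"
      then obtain L where "isotropic L" "L \<subseteq> H" "dim L + 2 = dim H"
        using less(1)[of H] False less(3) by auto
      then show "\<exists>L. isotropic L \<and> L \<subseteq> H \<and> dim L + 3 = dim Y"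
        using H(3) by (intro exI[of _ L]) auto
    qed
  qed
qed

end

section \<open>Homogeneous polynomials and slice rank on a subspace\<close>

interpretation fs: Vector_Spaces.vector_space fscale
  by (rule vector_space_fscale)

lemma fscale_apply: "fscale c F x = c * F x"
  by (simp add: fscale_def)

lemma restrict_fun_apply: "restrict_fun W F x = (if x \<in> W then F x else 0)"
  by (simp add: restrict_fun_def)

lemma prod_lessThan_append:
  fixes g :: "nat \<Rightarrow> 'a::comm_monoid_mult"
  shows "(\<Prod>i<d + e. g i) = (\<Prod>i<d. g i) * (\<Prod>i<e. g (d + i))"
  by (induction e) (simp_all add: mult.assoc)

locale polynomials_on_subspace = Vector_Spaces.vector_space s
  for s :: "complex \<Rightarrow> 'w::ab_group_add \<Rightarrow> 'w" +
  fixes W :: "'w set"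
  assumes subspace_W: "subspace W"
begin

lemma linear_formD:
  assumes "l \<in> linear_forms s W"
  shows "x \<in> W \<Longrightarrow> y \<in> W \<Longrightarrow> l (x + y) = l x + l y" "x \<in> W \<Longrightarrow> l (s c x) = c * l x"
    "x \<notin> W \<Longrightarrow> l x = 0" "l 0 = 0" "x \<in> W \<Longrightarrow> y \<in> W \<Longrightarrow> l (x - y) = l x - l y"
proof -
  have add: "\<And>x y. x \<in> W \<Longrightarrow> y \<in> W \<Longrightarrow> l (x + y) = l x + l y"
    and sc: "\<And>c x. x \<in> W \<Longrightarrow> l (s c x) = c * l x" and out: "\<And>x. x \<notin> W \<Longrightarrow> l x = 0"
    using assms by (auto simp: linear_forms_def)
  then show "x \<in> W \<Longrightarrow> y \<in> W \<Longrightarrow> l (x + y) = l x + l y" "x \<in> W \<Longrightarrow> l (s c x) = c * l x"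
    "x \<notin> W \<Longrightarrow> l x = 0" by auto
  show "l 0 = 0" using sc[of 0 0] subspace_0[OF subspace_W] by simp
  assume x: "x \<in> W" and y: "y \<in> W"
  have "l (x + s (-1) y) = l x + l (s (-1) y)"
    by (rule add[OF x subspace_scale[OF subspace_W y]])
  then show "l (x - y) = l x - l y" using sc[OF y, of "-1"] by simp
qed

lemma subspace_linear_forms: "fs.subspace (linear_forms s W)"
  by (rule fs.subspaceI)
    (auto simp: linear_forms_def fscale_apply plus_fun_def zero_fun_def algebra_simps)

lemma linear_form_add: "l \<in> linear_forms s W \<Longrightarrow> m \<in> linear_forms s W \<Longrightarrow> l + m \<in> linear_forms s W"
  and linear_form_diff: "l \<in> linear_forms s W \<Longrightarrow> m \<in> linear_forms s W \<Longrightarrow> l - m \<in> linear_forms s W"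
  and linear_form_scale: "l \<in> linear_forms s W \<Longrightarrow> fscale c l \<in> linear_forms s W"
  and linear_form_zero: "0 \<in> linear_forms s W"
  using subspace_linear_forms
  by (auto intro: fs.subspace_add fs.subspace_diff fs.subspace_scale fs.subspace_0)

lemma subspace_hom_polys: "fs.subspace (hom_polys s W d)"
  unfolding hom_polys_def by (rule fs.subspace_span)

lemma hom_poly_add: "F \<in> hom_polys s W d \<Longrightarrow> G \<in> hom_polys s W d \<Longrightarrow> F + G \<in> hom_polys s W d"
  and hom_poly_diff: "F \<in> hom_polys s W d \<Longrightarrow> G \<in> hom_polys s W d \<Longrightarrow> F - G \<in> hom_polys s W d"
  and hom_poly_scale: "F \<in> hom_polys s W d \<Longrightarrow> fscale c F \<in> hom_polys s W d"
  and hom_poly_zero: "0 \<in> hom_polys s W d"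
  using subspace_hom_polys[of d]
  by (auto intro: fs.subspace_add fs.subspace_diff fs.subspace_scale fs.subspace_0)

lemma hom_poly_product:
  "(\<And>i. i < d \<Longrightarrow> l i \<in> linear_forms s W) \<Longrightarrow> restrict_fun W (\<lambda>w. \<Prod>i<d. l i w) \<in> hom_polys s W d"
  unfolding hom_polys_def by (rule fs.span_base) blast

lemma hom_poly_induct [consumes 1, case_names zero step]:
  assumes "F \<in> hom_polys s W d" "P 0"
    and "\<And>c l G. (\<And>i. i < d \<Longrightarrow> l i \<in> linear_forms s W) \<Longrightarrow> G \<in> hom_polys s W d \<Longrightarrow> P G \<Longrightarrow>
      P (fscale c (restrict_fun W (\<lambda>w. \<Prod>i<d. l i w)) + G)"
  shows "P F"
proof -
  let ?S = "{restrict_fun W (\<lambda>w. \<Prod>i<d. l i w) |l. \<forall>i<d. l i \<in> linear_forms s W}"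
  have "F \<in> fs.span ?S" using assms(1) by (simp add: hom_polys_def)
  then have "P F \<and> F \<in> fs.span ?S"
  proof (induction rule: fs.span_induct_alt)
    case base
    then show ?case using assms(2) fs.span_zero by blast
  next
    case (step c x y)
    then obtain l where l: "x = restrict_fun W (\<lambda>w. \<Prod>i<d. l i w)" "\<forall>i<d. l i \<in> linear_forms s W"
      by blast
    have "P (fscale c x + y)"
    proof -
      have "y \<in> hom_polys s W d" "P y" using step.IH by (auto simp: hom_polys_def)
      then show ?thesis unfolding l(1) using l(2) by (intro assms(3)) auto
    qed
    moreover have "fscale c x + y \<in> fs.span ?S"
      using fs.span_add[OF fs.span_scale[OF fs.span_base[OF step(1)]]] step.IH by blast
    ultimately show ?case by blast
  qed
  then show ?thesis by blast
qed

lemma hom_poly_mult: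
  assumes "F \<in> hom_polys s W d" "G \<in> hom_polys s W e"
  shows "F * G \<in> hom_polys s W (d + e)"
  using assms(1)
proof (induction rule: hom_poly_induct)
  case zero
  have "0 * G = 0" by (simp add: fun_eq_iff fscale_apply restrict_fun_apply)
  then show ?case using hom_poly_zero by (simp only:)
next
  case (step c l F)
  let ?L = "restrict_fun W (\<lambda>w. \<Prod>i<d. l i w)"
  have "?L * G \<in> hom_polys s W (d + e)"
    using assms(2)
  proof (induction rule: hom_poly_induct)
    case zero
    have "?L * 0 = 0" by (simp add: fun_eq_iff fscale_apply restrict_fun_apply)
    then show ?case using hom_poly_zero by (simp only:)
  next
    case (step c' m G)
    let ?k = "\<lambda>i. if i < d then l i else m (i - d)"
    have "restrict_fun W (\<lambda>w. \<Prod>i<d + e. ?k i w) \<in> hom_polys s W (d + e)"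
      using step \<open>\<And>i. i < d \<Longrightarrow> l i \<in> linear_forms s W\<close> by (intro hom_poly_product) auto
    moreover have "restrict_fun W (\<lambda>w. \<Prod>i<d + e. ?k i w)
        = ?L * restrict_fun W (\<lambda>w. \<Prod>i<e. m i w)"
      by (auto simp: fun_eq_iff fscale_apply restrict_fun_apply prod_lessThan_append intro!: arg_cong2[of _ _ _ _ "(*)"] prod.cong)
    ultimately have "fscale c' (?L * restrict_fun W (\<lambda>w. \<Prod>i<e. m i w)) + ?L * G
        \<in> hom_polys s W (d + e)"
      using step.IH by (intro hom_poly_add hom_poly_scale) (simp only:)
    moreover have "fscale c' (?L * restrict_fun W (\<lambda>w. \<Prod>i<e. m i w)) + ?L * G
        = ?L * (fscale c' (restrict_fun W (\<lambda>w. \<Prod>i<e. m i w)) + G)"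
      by (auto simp: fun_eq_iff fscale_apply restrict_fun_apply algebra_simps)
    ultimately show ?case by (simp only:)
  qed
  then have "fscale c (?L * G) + F * G \<in> hom_polys s W (d + e)"
    using step.IH by (intro hom_poly_add hom_poly_scale)
  moreover have "fscale c (?L * G) + F * G = (fscale c ?L + F) * G"
    by (auto simp: fun_eq_iff fscale_apply restrict_fun_apply algebra_simps)
  ultimately show ?case by (simp only:)
qed

lemma hom_poly_of_linear_form:
  assumes "l \<in> linear_forms s W"
  shows "l \<in> hom_polys s W 1"
proof -
  have "restrict_fun W (\<lambda>w. \<Prod>i<(1::nat). l w) \<in> hom_polys s W 1"
    using hom_poly_product[of 1 "\<lambda>_. l"] assms by simp
  moreover have "restrict_fun W (\<lambda>w. \<Prod>i<(1::nat). l w) = l"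
    using linear_formD(3)[OF assms] by (auto simp: fun_eq_iff fscale_apply restrict_fun_apply)
  ultimately show ?thesis by (simp only:)
qed

lemma linear_form_of_hom_poly:
  assumes "F \<in> hom_polys s W 1"
  shows "F \<in> linear_forms s W"
  using assms
proof (induction rule: hom_poly_induct)
  case zero
  then show ?case by (rule linear_form_zero)
next
  case (step c l F)
  have l: "l 0 \<in> linear_forms s W" using step by simp
  have "restrict_fun W (\<lambda>w. \<Prod>i<1. l i w) = l 0"
    using linear_formD(3)[OF l] by (auto simp: fun_eq_iff fscale_apply restrict_fun_apply)
  then show ?case using linear_form_add[OF linear_form_scale[OF l] step(3)] by (simp only:)
qed

lemma hom_poly_const: "restrict_fun W (\<lambda>_. c) \<in> hom_polys s W 0"
proof -
  have "fscale c (restrict_fun W (\<lambda>w. \<Prod>i<(0::nat). 0)) \<in> hom_polys s W 0"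
    using hom_poly_scale[OF hom_poly_product[of 0 "\<lambda>_ _. 0"]] by simp
  moreover have "fscale c (restrict_fun W (\<lambda>w. \<Prod>i<(0::nat). 0)) = restrict_fun W (\<lambda>_. c)"
    by (auto simp: fun_eq_iff fscale_apply restrict_fun_apply)
  ultimately show ?thesis by (simp only:)
qed

lemma hom_poly_outside: "F \<in> hom_polys s W d \<Longrightarrow> x \<notin> W \<Longrightarrow> F x = 0"
  by (induction rule: hom_poly_induct) (auto simp: fscale_apply restrict_fun_apply)

lemma hom_poly_homogeneous:
  assumes "F \<in> hom_polys s W d" "x \<in> W"
  shows "F (s c x) = c ^ d * F x"
  using assms(1)
proof (induction rule: hom_poly_induct)
  case zero
  then show ?case by simp
next
  case (step a l F)
  have "(\<Prod>i<d. l i (s c x)) = (\<Prod>i<d. c * l i x)"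
    using linear_formD(2)[OF step(1) assms(2)] by (intro prod.cong) auto
  then show ?case
    using step(3) assms(2) subspace_scale[OF subspace_W assms(2)]
    by (simp add: fscale_apply restrict_fun_apply prod.distrib algebra_simps)
qed

lemma hom_poly_at_0:
  assumes "F \<in> hom_polys s W d" "0 < d"
  shows "F 0 = 0"
  using hom_poly_homogeneous[OF assms(1) subspace_0[OF subspace_W], of 0] assms(2)
  by (simp add: power_0_left)

text \<open>The condition whose least \<open>r\<close> is the slice rank of a cubic.\<close>

definition slices :: "nat \<Rightarrow> ('w \<Rightarrow> complex) \<Rightarrow> bool" where
  "slices r F \<longleftrightarrow> (\<exists>l h. (\<forall>i<r. l i \<in> hom_polys s W 1 \<and> h i \<in> hom_polys s W 2) \<and>
     F = (\<Sum>i<r. l i * h i))"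

lemma slices_add_term:
  assumes "slices r F" "l \<in> hom_polys s W 1" "h \<in> hom_polys s W 2"
  shows "slices (Suc r) (F + l * h)"
proof -
  obtain l' h' where lh: "\<forall>i<r. l' i \<in> hom_polys s W 1 \<and> h' i \<in> hom_polys s W 2"
    "F = (\<Sum>i<r. l' i * h' i)" using assms(1) by (auto simp: slices_def)
  have "(\<Sum>i<r. (l'(r := l)) i * (h'(r := h)) i) = (\<Sum>i<r. l' i * h' i)"
    by (intro sum.cong) auto
  then show ?thesis unfolding slices_def
    using lh assms(2,3) by (intro exI[of _ "l'(r := l)"] exI[of _ "h'(r := h)"]) auto
qed

lemma slices_mono: "r \<le> r' \<Longrightarrow> slices r F \<Longrightarrow> slices r' F"
proof (induction rule: dec_induct)
  case (step n)
  then show ?case using slices_add_term[of n F 0 0] hom_poly_zero by simp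
qed

lemma slices_exists:
  assumes "F \<in> hom_polys s W 3"
  shows "\<exists>r. slices r F"
  using assms
proof (induction rule: hom_poly_induct)
  case zero
  have "slices 0 0" by (simp add: slices_def)
  then show ?case ..
next
  case (step c l F)
  then obtain r where r: "slices r F" by blast
  have l: "l 0 \<in> linear_forms s W" "l 1 \<in> linear_forms s W" "l 2 \<in> linear_forms s W"
    using step by auto
  then have "fscale c (l 0) \<in> hom_polys s W 1" "l 1 * l 2 \<in> hom_polys s W 2"
    using hom_poly_mult[of "l 1" 1 "l 2" 1] hom_poly_of_linear_form hom_poly_scale
    by (auto simp: numeral_2_eq_2)
  then have "slices (Suc r) (F + fscale c (l 0) * (l 1 * l 2))"
    using slices_add_term[OF r] by blast
  moreover have "F + fscale c (l 0) * (l 1 * l 2)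
      = fscale c (restrict_fun W (\<lambda>w. \<Prod>i<3. l i w)) + F"
    using linear_formD(3)[OF l(1)]
    by (auto simp: fun_eq_iff fscale_apply restrict_fun_apply numeral_3_eq_3 numeral_2_eq_2 algebra_simps)
  ultimately show ?case by metis
qed

lemma slice_rank_le_iff_slices:
  assumes "F \<in> hom_polys s W 3"
  shows "slice_rank s W 3 F \<le> r \<longleftrightarrow> slices r F"
proof -
  have eq: "slice_rank s W 3 F = (LEAST r. slices r F)"
    by (simp add: slice_rank_def slices_def)
  have "slices (slice_rank s W 3 F) F"
    unfolding eq using slices_exists[OF assms] by (rule LeastI_ex)
  then show ?thesis using slices_mono eq Least_le[of "\<lambda>r. slices r F"] by metis
qed

text \<open>The substitution \<open>x \<mapsto> x - l(x) u\<close> changes each linear factor of a product by a multiple of \<open>l\<close>.\<close>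

lemma hom_poly_shear:
  assumes "F \<in> hom_polys s W 3" "l \<in> linear_forms s W" "u \<in> W"
  shows "\<exists>h\<in>hom_polys s W 2. \<forall>x\<in>W. F x - F (x - s (l x) u) = l x * h x"
  using assms(1)
proof (induction rule: hom_poly_induct)
  case zero
  then show ?case using hom_poly_zero by (intro bexI[of _ 0]) auto
next
  case (step c m F)
  then obtain h where h: "h \<in> hom_polys s W 2" "\<forall>x\<in>W. F x - F (x - s (l x) u) = l x * h x"
    by blast
  have m: "m 0 \<in> linear_forms s W" "m 1 \<in> linear_forms s W" "m 2 \<in> linear_forms s W"
    using step by auto
  define m0 m1 where "m0 = m 0 - fscale (m 0 u) l" and "m1 = m 1 - fscale (m 1 u) l"
  have m': "m0 \<in> linear_forms s W" "m1 \<in> linear_forms s W"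
    using m assms(2) by (auto simp: m0_def m1_def intro: linear_form_diff linear_form_scale)
  define k where "k = fscale (m 0 u) (m 1 * m 2) + fscale (m 1 u) (m0 * m 2) + fscale (m 2 u) (m0 * m1)"
  have two: "a * b \<in> hom_polys s W 2" if "a \<in> linear_forms s W" "b \<in> linear_forms s W" for a b
    using hom_poly_mult[of a 1 b 1] that hom_poly_of_linear_form by (auto simp: numeral_2_eq_2)
  have k: "fscale c k + h \<in> hom_polys s W 2"
    unfolding k_def using m m' h(1) two by (intro hom_poly_add hom_poly_scale) auto
  have "(fscale c (restrict_fun W (\<lambda>w. \<Prod>i<3. m i w)) + F) x
      - (fscale c (restrict_fun W (\<lambda>w. \<Prod>i<3. m i w)) + F) (x - s (l x) u)
      = l x * (fscale c k + h) x" if x: "x \<in> W" for x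
  proof -
    have xu: "x - s (l x) u \<in> W"
      using x assms(3) subspace_W by (intro subspace_diff subspace_scale)
    have mi: "m i (x - s (l x) u) = m i x - l x * m i u" if "i < 3" for i
      using linear_formD(5)[OF step(1)[OF that] x subspace_scale[OF subspace_W assms(3)]]
        linear_formD(2)[OF step(1)[OF that] assms(3)] by simp
    have F: "F x = F (x - s (l x) u) + l x * h x" using h(2) x by (simp add: algebra_simps)
    show ?thesis using x xu
      by (simp add: mi F fscale_apply restrict_fun_apply k_def m0_def m1_def numeral_3_eq_3 numeral_2_eq_2 algebra_simps)
  qed
  then show ?case using k by blast
qed

text \<open>The ideal of a linear subspace is generated by linear forms. If the last form takes the value
  one at some \<open>u\<close> on which the others vanish, shearing along \<open>u\<close> replaces \<open>F\<close>, up to a multiple of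
  that form, by a cubic that vanishes on the common kernel of the others; induction applies to it.\<close>

lemma slices_iff_zero_on_kernel:
  assumes "F \<in> hom_polys s W 3"
  shows "slices r F \<longleftrightarrow>
    (\<exists>l. (\<forall>i<r. l i \<in> linear_forms s W) \<and> (\<forall>x\<in>W. (\<forall>i<r. l i x = 0) \<longrightarrow> F x = 0))"
proof
  assume "slices r F"
  then obtain l h where lh: "\<forall>i<r. l i \<in> hom_polys s W 1 \<and> h i \<in> hom_polys s W 2"
    "F = (\<Sum>i<r. l i * h i)" by (auto simp: slices_def)
  have "F x = (\<Sum>i<r. l i x * h i x)" for x
    unfolding lh(2) by (induction r) auto
  then show "\<exists>l. (\<forall>i<r. l i \<in> linear_forms s W) \<and> (\<forall>x\<in>W. (\<forall>i<r. l i x = 0) \<longrightarrow> F x = 0)"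
    using lh linear_form_of_hom_poly by (intro exI[of _ l]) auto
next
  assume "\<exists>l. (\<forall>i<r. l i \<in> linear_forms s W) \<and> (\<forall>x\<in>W. (\<forall>i<r. l i x = 0) \<longrightarrow> F x = 0)"
  then obtain l where "\<forall>i<r. l i \<in> linear_forms s W" "\<forall>x\<in>W. (\<forall>i<r. l i x = 0) \<longrightarrow> F x = 0"
    by blast
  then show "slices r F" using assms
  proof (induction r arbitrary: F)
    case 0
    then have "F x = 0" for x using hom_poly_outside[OF 0(3)] by (cases "x \<in> W") auto
    then have "F = 0" by (simp add: fun_eq_iff fscale_apply restrict_fun_apply)
    then show ?case by (simp add: slices_def zero_fun_def)
  next
    case (Suc r)
    show ?case
    proof (cases "\<forall>x\<in>W. (\<forall>i<r. l i x = 0) \<longrightarrow> l r x = 0")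
      case True
      then have "slices r F" using Suc.prems by (intro Suc.IH) (auto simp: less_Suc_eq)
      then show ?thesis using slices_mono[of r "Suc r"] by simp
    next
      case False
      then obtain u' where u': "u' \<in> W" "\<forall>i<r. l i u' = 0" "l r u' \<noteq> 0" by blast
      define u where "u = s (1 / l r u') u'"
      have lin: "l i \<in> linear_forms s W" if "i \<le> r" for i using Suc.prems(1) that by auto
      have u: "u \<in> W" "\<And>i. i < r \<Longrightarrow> l i u = 0" "l r u = 1"
      using u' linear_formD(2)[OF lin u'(1)] subspace_scale[OF subspace_W u'(1)]
        by (auto simp: u_def)
      obtain h where h: "h \<in> hom_polys s W 2" "\<forall>x\<in>W. F x - F (x - s (l r x) u) = l r x * h x"
        using hom_poly_shear[OF Suc.prems(3) lin[OF order_refl] u(1)] by blast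
      have hp: "l r \<in> hom_polys s W 1" using lin hom_poly_of_linear_form by simp
      have "l r * h \<in> hom_polys s W 3"
        using hom_poly_mult[OF hp h(1)] by (simp add: numeral_3_eq_3 numeral_2_eq_2)
      then have G: "F - l r * h \<in> hom_polys s W 3" using Suc.prems(3) hom_poly_diff by blast
      have "(F - l r * h) x = 0" if x: "x \<in> W" "\<forall>i<r. l i x = 0" for x
      proof -
        let ?y = "x - s (l r x) u"
        have y: "?y \<in> W" using x u subspace_W by (intro subspace_diff subspace_scale)
        have "l i ?y = l i x - l r x * l i u" if "i \<le> r" for i
          using linear_formD(5)[OF lin[OF that] x(1) subspace_scale[OF subspace_W u(1)]]
            linear_formD(2)[OF lin[OF that] u(1)] by simp
        then have "\<forall>i<Suc r. l i ?y = 0" using u x by (auto simp: less_Suc_eq)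
        then have "F ?y = 0" using Suc.prems(2) y by blast
        then show ?thesis using bspec[OF h(2) x(1)] by simp
      qed
      then have "slices r (F - l r * h)"
        using Suc.prems(1) by (intro Suc.IH[OF _ _ G]) auto
      then show ?thesis using slices_add_term[OF _ hp h(1)] by fastforce
    qed
  qed
qed

theorem slice_rank_le_iff:
  assumes "F \<in> hom_polys s W 3"
  shows "slice_rank s W 3 F \<le> r \<longleftrightarrow>
    (\<exists>l. (\<forall>i<r. l i \<in> linear_forms s W) \<and> (\<forall>x\<in>W. (\<forall>i<r. l i x = 0) \<longrightarrow> F x = 0))"
  using slice_rank_le_iff_slices[OF assms] slices_iff_zero_on_kernel[OF assms] by simp

end

lemma linear_form_pullback:
  assumes "Vector_Spaces.linear s' s T" "module.subspace s' W'" "\<And>x. x \<in> W' \<Longrightarrow> T x \<in> W"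
    and "l \<in> linear_forms s W"
  shows "restrict_fun W' (\<lambda>x. l (T x)) \<in> linear_forms s' W'"
proof -
  interpret T: Vector_Spaces.linear s' s T by fact
  have l: "\<And>x y. x \<in> W \<Longrightarrow> y \<in> W \<Longrightarrow> l (x + y) = l x + l y" "\<And>c x. x \<in> W \<Longrightarrow> l (s c x) = c * l x"
    using assms(4) by (auto simp: linear_forms_def)
  show ?thesis
    unfolding linear_forms_def mem_Collect_eq restrict_fun_apply
    using T.vs1.subspace_add[OF assms(2)] T.vs1.subspace_scale[OF assms(2)] assms(3)
    by (auto simp: l T.add T.scale)
qed

lemma hom_poly_pullback:
  assumes "Vector_Spaces.linear s' s T" "module.subspace s' W'" "\<And>x. x \<in> W' \<Longrightarrow> T x \<in> W"
    and W: "module.subspace s W" and "F \<in> hom_polys s W d"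
  shows "restrict_fun W' (\<lambda>x. F (T x)) \<in> hom_polys s' W' d"
proof -
  interpret T: Vector_Spaces.linear s' s T by fact
  interpret P: polynomials_on_subspace s W by unfold_locales fact
  interpret P': polynomials_on_subspace s' W' by unfold_locales fact
  show ?thesis using assms(5)
  proof (induction rule: P.hom_poly_induct)
    case zero
    have "restrict_fun W' (\<lambda>x. (0 :: 'b \<Rightarrow> complex) (T x)) = 0"
      by (simp add: fun_eq_iff restrict_fun_apply)
    then show ?case using P'.hom_poly_zero by metis
  next
    case (step c l F)
    have "restrict_fun W' (\<lambda>w. \<Prod>i<d. restrict_fun W' (\<lambda>x. l i (T x)) w) \<in> hom_polys s' W' d"
      by (intro P'.hom_poly_product linear_form_pullback[OF assms(1-3)] step(1))
    then have "fscale c (restrict_fun W' (\<lambda>w. \<Prod>i<d. restrict_fun W' (\<lambda>x. l i (T x)) w))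
        + restrict_fun W' (\<lambda>x. F (T x)) \<in> hom_polys s' W' d"
      using step(3) by (intro P'.hom_poly_add P'.hom_poly_scale)
    moreover have "fscale c (restrict_fun W' (\<lambda>w. \<Prod>i<d. restrict_fun W' (\<lambda>x. l i (T x)) w))
        + restrict_fun W' (\<lambda>x. F (T x))
      = restrict_fun W' (\<lambda>x. (fscale c (restrict_fun W (\<lambda>w. \<Prod>i<d. l i w)) + F) (T x))"
      using assms(3) by (auto simp: fun_eq_iff fscale_apply restrict_fun_apply)
    ultimately show ?case by (simp only:)
  qed
qed

text \<open>Polarizations are kept as sums of products of three functionals, since in this shape they
  visibly pull back to homogeneous polynomials of degree three and pass to limits.\<close>

inductive trilinear ::
  "(complex \<Rightarrow> 'v::ab_group_add \<Rightarrow> 'v) \<Rightarrow> ('v \<Rightarrow> 'v \<Rightarrow> 'v \<Rightarrow> complex) \<Rightarrow> bool" for s where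
  product: "Vector_Spaces.linear s (*) a \<Longrightarrow> Vector_Spaces.linear s (*) b \<Longrightarrow>
    Vector_Spaces.linear s (*) c \<Longrightarrow> trilinear s (\<lambda>x y z. a x * b y * c z)"
| add: "trilinear s \<phi> \<Longrightarrow> trilinear s \<psi> \<Longrightarrow> trilinear s (\<lambda>x y z. \<phi> x y z + \<psi> x y z)"

lemma linear_functionalD:
  assumes "Vector_Spaces.linear s (*) a"
  shows "a (x + y) = a x + a y" "a (s c x) = c * a x"
proof -
  interpret Vector_Spaces.linear s "(*)" a by fact
  show "a (x + y) = a x + a y" "a (s c x) = c * a x" by (simp_all add: add scale)
qed

lemma linear_functional_iff:
  assumes "Vector_Spaces.vector_space s"
  shows "Vector_Spaces.linear s (*) (a :: _ \<Rightarrow> complex) \<longleftrightarrow>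
    (\<forall>x y. a (x + y) = a x + a y) \<and> (\<forall>c x. a (s c x) = c * a x)"
proof -
  have "Vector_Spaces.vector_space ((*) :: complex \<Rightarrow> complex \<Rightarrow> complex)"
    by unfold_locales (auto simp: algebra_simps)
  then show ?thesis using assms by (auto simp: Vector_Spaces.linear_iff)
qed

lemma trilinear_add1: "trilinear s \<phi> \<Longrightarrow> \<phi> (x + x') y z = \<phi> x y z + \<phi> x' y z"
proof (induction rule: trilinear.induct)
  case (product a b c)
  show ?case by (simp add: linear_functionalD(1)[OF product(1)] algebra_simps)
qed simp

lemma trilinear_scale1: "trilinear s \<phi> \<Longrightarrow> \<phi> (s c x) y z = c * \<phi> x y z"
proof (induction rule: trilinear.induct)
  case (product a b c)
  show ?case by (simp add: linear_functionalD(2)[OF product(1)])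
qed (simp add: algebra_simps)

lemma trilinear_scale:
  assumes "Vector_Spaces.vector_space s"
  shows "trilinear s \<phi> \<Longrightarrow> trilinear s (\<lambda>x y z. k * \<phi> x y z)"
proof (induction rule: trilinear.induct)
  case (product a b c)
  have "Vector_Spaces.linear s (*) (\<lambda>x. k * a x)"
    using product(1) by (simp add: linear_functional_iff[OF assms] algebra_simps)
  from trilinear.product[OF this product(2,3)] show ?case by (simp add: mult.assoc)
next
  case (add \<phi> \<psi>)
  from trilinear.add[OF add.IH] show ?case by (simp add: algebra_simps)
qed

lemma trilinear_swap12: "trilinear s \<phi> \<Longrightarrow> trilinear s (\<lambda>x y z. \<phi> y x z)"
proof (induction rule: trilinear.induct)
  case (product a b c)
  from trilinear.product[OF product(2,1,3)] show ?case by (simp add: mult_ac)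
qed (rule trilinear.add)

lemma trilinear_swap23: "trilinear s \<phi> \<Longrightarrow> trilinear s (\<lambda>x y z. \<phi> x z y)"
proof (induction rule: trilinear.induct)
  case (product a b c)
  from trilinear.product[OF product(1,3,2)] show ?case by (simp add: mult_ac)
qed (rule trilinear.add)

lemma trilinear_of_hom_poly:
  assumes s: "Vector_Spaces.vector_space s" and "F \<in> hom_polys s UNIV 3"
  shows "\<exists>\<phi>. trilinear s \<phi> \<and> (\<forall>x. F x = \<phi> x x x)"
proof -
  interpret Vector_Spaces.vector_space s by fact
  interpret P: polynomials_on_subspace s UNIV by unfold_locales simp
  have lin: "Vector_Spaces.linear s (*) l" if "l \<in> linear_forms s UNIV" for l
    using that by (simp add: linear_functional_iff[OF s] linear_forms_def)
  show ?thesis using assms(2)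
  proof (induction rule: P.hom_poly_induct)
    case zero
    have "Vector_Spaces.linear s (*) (\<lambda>x. 0::complex)" by (simp add: linear_functional_iff[OF s])
    from trilinear.product[OF this this this] show ?case
      by (intro exI[of _ "\<lambda>x y z. 0"]) simp
  next
    case (step c l F)
    then obtain \<phi> where \<phi>: "trilinear s \<phi>" "\<forall>x. F x = \<phi> x x x" by blast
    have "trilinear s (\<lambda>x y z. c * (l 0 x * l 1 y * l 2 z))"
      using step(1) by (intro trilinear_scale[OF s] trilinear.product lin) auto
    from trilinear.add[OF this \<phi>(1)] show ?case
      by (intro exI[of _ "\<lambda>x y z. c * (l 0 x * l 1 y * l 2 z) + \<phi> x y z"])
        (simp add: \<phi>(2) fscale_apply restrict_fun_apply numeral_3_eq_3 numeral_2_eq_2 mult_ac)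
  qed
qed

text \<open>The average over the six permutations of the arguments.\<close>

lemma symmetric_trilinear_of_hom_poly:
  assumes s: "Vector_Spaces.vector_space s" and "F \<in> hom_polys s UNIV 3"
  obtains \<phi> where "trilinear s \<phi>" "\<And>x y z. \<phi> x y z = \<phi> y x z" "\<And>x y z. \<phi> x y z = \<phi> x z y"
    "\<And>x. F x = \<phi> x x x"
proof -
  obtain \<psi> where \<psi>: "trilinear s \<psi>" "\<forall>x. F x = \<psi> x x x"
    using trilinear_of_hom_poly[OF assms] by blast
  define \<phi> where "\<phi> x y z =
    (1 / 6) * (\<psi> x y z + \<psi> x z y + \<psi> y x z + \<psi> y z x + \<psi> z x y + \<psi> z y x)" for x y z
  have p1: "trilinear s (\<lambda>x y z. \<psi> x z y)" "trilinear s (\<lambda>x y z. \<psi> y x z)"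
    by (rule trilinear_swap23[OF \<psi>(1)]) (rule trilinear_swap12[OF \<psi>(1)])
  have p2: "trilinear s (\<lambda>x y z. \<psi> y z x)" "trilinear s (\<lambda>x y z. \<psi> z x y)"
    by (rule trilinear_swap12[OF p1(1)], rule trilinear_swap23[OF p1(2)])
  have p3: "trilinear s (\<lambda>x y z. \<psi> z y x)"
    by (rule trilinear_swap23[OF p2(1)])
  have "trilinear s \<phi>"
    unfolding \<phi>_def[abs_def]
    by (intro trilinear_scale[OF s] trilinear.add \<psi>(1) p1 p2 p3)
  moreover have "\<phi> x y z = \<phi> y x z" "\<phi> x y z = \<phi> x z y" "F x = \<phi> x x x" for x y z
    using \<psi>(2) by (simp_all add: \<phi>_def)
  ultimately show ?thesis using that by blast
qed

lemma trilinear_pullback: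
  assumes "polynomials_on_subspace s' W'"
    and "\<And>a P. Vector_Spaces.linear s (*) a \<Longrightarrow> P \<in> \<P> \<Longrightarrow> restrict_fun W' (\<lambda>x. a (P x)) \<in> linear_forms s' W'"
    and "P \<in> \<P>" "Q \<in> \<P>" "R \<in> \<P>"
  shows "trilinear s \<phi> \<Longrightarrow> restrict_fun W' (\<lambda>x. \<phi> (P x) (Q x) (R x)) \<in> hom_polys s' W' 3"
proof (induction rule: trilinear.induct)
  interpret P': polynomials_on_subspace s' W' by fact
  case (product a b c)
  have "restrict_fun W' (\<lambda>x. a (P x)) * restrict_fun W' (\<lambda>x. b (Q x)) * restrict_fun W' (\<lambda>x. c (R x))
      \<in> hom_polys s' W' (1 + 1 + 1)"
    by (intro P'.hom_poly_mult P'.hom_poly_of_linear_form assms product)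
  moreover have "restrict_fun W' (\<lambda>x. a (P x)) * restrict_fun W' (\<lambda>x. b (Q x)) * restrict_fun W' (\<lambda>x. c (R x))
      = restrict_fun W' (\<lambda>x. a (P x) * b (Q x) * c (R x))"
    by (auto simp: fun_eq_iff restrict_fun_apply)
  moreover have "1 + 1 + 1 = (3::nat)" by simp
  ultimately show ?case by (simp only:)
next
  interpret P': polynomials_on_subspace s' W' by fact
  case (add \<phi> \<psi>)
  have "restrict_fun W' (\<lambda>x. \<phi> (P x) (Q x) (R x)) + restrict_fun W' (\<lambda>x. \<psi> (P x) (Q x) (R x))
      \<in> hom_polys s' W' 3"
    by (intro P'.hom_poly_add add)
  moreover have "restrict_fun W' (\<lambda>x. \<phi> (P x) (Q x) (R x)) + restrict_fun W' (\<lambda>x. \<psi> (P x) (Q x) (R x))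
     = restrict_fun W' (\<lambda>x. \<phi> (P x) (Q x) (R x) + \<psi> (P x) (Q x) (R x))"
    by (auto simp: fun_eq_iff restrict_fun_apply)
  ultimately show ?case by (simp only:)
qed

lemma trilinear_tendsto:
  assumes "\<And>a. Vector_Spaces.linear s (*) a \<Longrightarrow> ((\<lambda>n. a (X n)) \<longlongrightarrow> a x) G"
  shows "trilinear s \<phi> \<Longrightarrow> ((\<lambda>n. \<phi> (X n) (X n) (X n)) \<longlongrightarrow> \<phi> x x x) G"
proof (induction rule: trilinear.induct)
  case (product a b c)
  show ?case by (intro tendsto_mult assms product)
qed (rule tendsto_add)

section \<open>A resultant and the detection of linear factors\<close>

lemma poly_eq_sum_lessThan:
  fixes P :: "'a::comm_semiring_1 poly"
  assumes "degree P < n"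
  shows "poly P x = (\<Sum>j<n. Polynomial.coeff P j * x ^ j)"
proof -
  have "poly P x = (\<Sum>j\<le>degree P. Polynomial.coeff P j * x ^ j)" by (rule poly_altdef)
  also have "\<dots> = (\<Sum>j<n. Polynomial.coeff P j * x ^ j)"
    using assms by (intro sum.mono_neutral_left) (auto simp: coeff_eq_0)
  finally show ?thesis .
qed

text \<open>Over the complex numbers every nonconstant divisor has a root, so the linear factors of \<open>A\<close> can be
  moved to \<open>V\<close> one at a time.\<close>

lemma dvd_of_dvd_mult_no_common_root:
  fixes A B V :: "complex poly"
  assumes "A \<noteq> 0" "\<And>x. poly A x = 0 \<Longrightarrow> poly B x \<noteq> 0" "A dvd V * B"
  shows "A dvd V"
  using assms
proof (induction "degree A" arbitrary: A V)
  case 0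
  then have "is_unit A" by (simp add: is_unit_iff_degree)
  then show ?case by (rule unit_imp_dvd)
next
  case (Suc n)
  have "\<not> constant (poly A)" using Suc(2) by (simp add: constant_degree)
  then obtain a where a: "poly A a = 0" using fundamental_theorem_of_algebra by blast
  then obtain A' where A': "A = [:-a, 1:] * A'" by (auto simp: poly_eq_0_iff_dvd)
  have "[:-a, 1:] dvd V * B" using Suc.prems(3) A' dvd_trans dvd_triv_left by blast
  then have "poly (V * B) a = 0" using poly_eq_0_iff_dvd by blast
  then have "poly V a = 0" using Suc.prems(2)[OF a] by simp
  then obtain V' where V': "V = [:-a, 1:] * V'" by (auto simp: poly_eq_0_iff_dvd)
  have ne: "A' \<noteq> 0" using Suc.prems(1) A' by auto
  have "n = degree A'" using Suc(2) ne unfolding A' by (subst (asm) degree_mult_eq) auto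
  moreover have "A' dvd V' * B"
  proof -
    have "[:-a, 1:] * A' dvd [:-a, 1:] * (V' * B)"
      using Suc.prems(3) unfolding A' V' by (simp only: mult.assoc)
    then show ?thesis by (subst (asm) dvd_mult_cancel_left) auto
  qed
  moreover have "poly B x \<noteq> 0" if "poly A' x = 0" for x
  proof (rule Suc.prems(2))
    show "poly A x = 0" unfolding A' using that by simp
  qed
  ultimately have "A' dvd V'" using Suc(1)[OF _ ne] by blast
  then show ?case unfolding A' V' by (rule mult_dvd_mono[OF dvd_refl])
qed

text \<open>The Sylvester matrix for the formal degrees \<open>3\<close> and \<open>6\<close>. Its size does not depend on the actual
  degree of \<open>B\<close>, so that its determinant is a polynomial in the coefficients.\<close>

definition sylvester93 :: "complex poly \<Rightarrow> complex poly \<Rightarrow> complex mat" where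
  "sylvester93 A B =
     Matrix.mat 9 9 (\<lambda>(i, j). Polynomial.coeff (if i < 6 then Polynomial.monom 1 i * A else Polynomial.monom 1 (i - 6) * B) j)"

lemma degree_sylvester_row:
  fixes A B :: "complex poly"
  assumes "degree A \<le> 3" "degree B \<le> 6" "i < 9"
  shows "degree (if i < 6 then Polynomial.monom 1 i * A else Polynomial.monom 1 (i - 6) * B) < 9"
proof (cases "i < 6")
  case True
  have "degree (Polynomial.monom 1 i * A) \<le> i + 3"
    using degree_mult_le[of "Polynomial.monom 1 i" A] degree_monom_le[of "1::complex" i] assms(1) by linarith
  then show ?thesis using True by simp
next
  case False
  have "degree (Polynomial.monom 1 (i - 6) * B) \<le> (i - 6) + 6"
    using degree_mult_le[of "Polynomial.monom 1 (i - 6)" B] degree_monom_le[of "1::complex" "i - 6"] assms(2)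
    by linarith
  then show ?thesis using False assms(3) by simp
qed

text \<open>The vector of powers of the common root lies in the kernel.\<close>

lemma det_sylvester_zero_if_common_root:
  assumes deg: "degree A \<le> 3" "degree B \<le> 6" and root: "poly A x = 0" "poly B x = 0"
  shows "Determinant.det (sylvester93 A B) = 0"
proof -
  let ?v = "Matrix.vec 9 (\<lambda>j. x ^ j)"
  have M: "sylvester93 A B \<in> carrier_mat 9 9" by (simp add: sylvester93_def)
  have "sylvester93 A B *\<^sub>v ?v = 0\<^sub>v 9"
  proof
    fix i assume "i < dim_vec (0\<^sub>v 9 :: complex Matrix.vec)"
    then have i: "i < 9" by simp
    let ?P = "if i < 6 then Polynomial.monom 1 i * A else Polynomial.monom 1 (i - 6) * B"
    have "(sylvester93 A B *\<^sub>v ?v) $ i = (\<Sum>j<9. Polynomial.coeff ?P j * x ^ j)"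
      using i by (simp add: sylvester93_def scalar_prod_def atLeast0LessThan)
    also have "\<dots> = poly ?P x" using poly_eq_sum_lessThan[OF degree_sylvester_row[OF deg i]] by simp
    also have "\<dots> = 0" using root by simp
    finally show "(sylvester93 A B *\<^sub>v ?v) $ i = 0\<^sub>v 9 $ i" using i by simp
  qed (simp add: sylvester93_def)
  moreover have "?v \<noteq> 0\<^sub>v 9"
  proof
    assume "?v = 0\<^sub>v 9"
    then have "?v $ 0 = 0\<^sub>v 9 $ 0" by simp
    then show False by simp
  qed
  ultimately show ?thesis using det_0_iff_vec_prod_zero[OF M] vec_carrier by blast
qed

text \<open>A vector in the left kernel is a relation \<open>U A + V B = 0\<close> with \<open>degree U < 6\<close> and \<open>degree V < 3\<close>.
  Then \<open>A\<close> divides \<open>V\<close>, so \<open>V = 0\<close> and \<open>U = 0\<close>.\<close>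

lemma det_sylvester_nonzero_if_no_common_root:
  assumes deg: "degree A = 3" "degree B \<le> 6" and root: "\<And>x. poly A x = 0 \<Longrightarrow> poly B x \<noteq> 0"
  shows "Determinant.det (sylvester93 A B) \<noteq> 0"
proof
  assume det0: "Determinant.det (sylvester93 A B) = 0"
  have M: "sylvester93 A B \<in> carrier_mat 9 9" by (simp add: sylvester93_def)
  then have "Determinant.det (transpose_mat (sylvester93 A B)) = 0" using det0 Determinant.det_transpose by metis
  then obtain c where c: "c \<in> carrier_vec 9" "c \<noteq> 0\<^sub>v 9" "transpose_mat (sylvester93 A B) *\<^sub>v c = 0\<^sub>v 9"
    using det_0_iff_vec_prod_zero[of "transpose_mat (sylvester93 A B)" 9] M by auto
  let ?R = "\<lambda>i. if i < 6 then Polynomial.monom 1 i * A else Polynomial.monom 1 (i - 6) * B"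
  have A0: "A \<noteq> 0" using deg by auto
  have comb: "(\<Sum>i<9. Polynomial.smult (c $ i) (?R i)) = 0"
  proof (rule poly_eqI)
    fix j
    have "Polynomial.coeff (\<Sum>i<9. Polynomial.smult (c $ i) (?R i)) j = (\<Sum>i<9. c $ i * Polynomial.coeff (?R i) j)"
      by (simp add: coeff_sum)
    also have "\<dots> = 0"
    proof (cases "j < 9")
      case True
      have "(transpose_mat (sylvester93 A B) *\<^sub>v c) $ j = (\<Sum>i<9. Polynomial.coeff (?R i) j * c $ i)"
        using True c(1) by (simp add: sylvester93_def scalar_prod_def atLeast0LessThan)
      then show ?thesis using c(3) True by (simp add: mult.commute)
    next
      case False
      have "Polynomial.coeff (?R i) j = 0" if "i < 9" for i
        using degree_sylvester_row[of A B i] deg that False by (intro coeff_eq_0) linarith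
      then show ?thesis by simp
    qed
    finally show "Polynomial.coeff (\<Sum>i<9. Polynomial.smult (c $ i) (?R i)) j = Polynomial.coeff 0 j" by simp
  qed
  define U V where "U = (\<Sum>i<6. Polynomial.monom (c $ i) i)" and "V = (\<Sum>i<3. Polynomial.monom (c $ (6 + i)) i)"
  have "(\<Sum>i<9. Polynomial.smult (c $ i) (?R i))
      = (\<Sum>i<6. Polynomial.smult (c $ i) (?R i)) + (\<Sum>i<3. Polynomial.smult (c $ (6 + i)) (?R (6 + i)))"
    using sum.lessThan_Suc by (simp add: eval_nat_numeral)
  also have "\<dots> = U * A + V * B"
    by (simp add: U_def V_def sum_distrib_right smult_monom flip: mult_smult_left)
  finally have UV: "U * A + V * B = 0" using comb by simp
  have "A dvd V * B" using UV by (metis add_eq_0_iff dvd_minus_iff dvd_triv_right)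
  then have dvd: "A dvd V" using dvd_of_dvd_mult_no_common_root[OF A0] root by blast
  have "degree V \<le> 2" unfolding V_def
    by (intro degree_sum_le) (auto intro: order_trans[OF degree_monom_le])
  then have V0: "V = 0" using dvd deg(1) dvd_imp_degree_le[of A V] by fastforce
  then have U0: "U = 0" using UV A0 by simp
  have c0: "c $ i = 0" if "i < 6" for i
  proof -
    have "Polynomial.coeff U i = c $ i" using that unfolding U_def by (simp add: coeff_sum)
    then show ?thesis using U0 by simp
  qed
  have c6: "c $ (6 + i) = 0" if "i < 3" for i
  proof -
    have "Polynomial.coeff V i = c $ (6 + i)" using that unfolding V_def by (simp add: coeff_sum)
    then show ?thesis using V0 by simp
  qed
  have "c $ i = 0" if "i < 9" for i
  proof (cases "i < 6")
    case False
    then have "i - 6 < 3" "i = 6 + (i - 6)" using that by simp_all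
    then show ?thesis using c6[of "i - 6"] by simp
  qed (rule c0)
  then have "c = 0\<^sub>v 9" using c(1) by (intro eq_vecI) auto
  then show False using c(2) by blast
qed

context cubic_form
begin

definition line_poly :: "'a \<Rightarrow> 'a \<Rightarrow> complex poly" where
  "line_poly q p = [:\<phi> q q q, 3 * \<phi> q q p, 3 * \<phi> q p p, \<phi> p p p:]"

lemma swap_repeated:
  "\<phi> q p q = \<phi> q q p" "\<phi> p q q = \<phi> q q p" "\<phi> p q p = \<phi> q p p" "\<phi> p p q = \<phi> q p p"
  using swap12 swap23 by metis+

lemma poly_line_poly: "poly (line_poly q p) t = \<phi> (q + scale t p) (q + scale t p) (q + scale t p)"
  by (simp add: line_poly_def add1 add2 add3 scale1 scale2 scale3 swap_repeated[where q = q and p = p] algebra_simps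
      power2_eq_square)

text \<open>The restriction of the quadratic form \<open>\<phi> w w r\<close> to the line \<open>w = q + t p\<close>.\<close>

definition square_poly :: "'a \<Rightarrow> 'a \<Rightarrow> 'a \<Rightarrow> complex poly" where
  "square_poly q p r = [:\<phi> q q r, 2 * \<phi> q p r, \<phi> p p r:]"

lemma poly_square_poly: "poly (square_poly q p r) t = \<phi> (q + scale t p) (q + scale t p) r"
  by (simp add: square_poly_def add1 add2 scale1 scale2 swap12[of p q] algebra_simps)

text \<open>The values of \<open>tangent_value\<close> along the line \<open>w = q + t p\<close>, as a polynomial in \<open>t\<close>.\<close>

definition tangent_poly :: "'a \<Rightarrow> 'a \<Rightarrow> 'a \<Rightarrow> complex poly" where
  "tangent_poly q p r =
     (let u = square_poly q p p; v = square_poly q p r in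
      Polynomial.smult (\<phi> r r r) (u * u * u) - Polynomial.smult (3 * \<phi> r r p) (u * u * v)
      + Polynomial.smult (3 * \<phi> r p p) (u * v * v) - Polynomial.smult (\<phi> p p p) (v * v * v))"

text \<open>At a smooth zero \<open>w\<close> of the cubic the equation \<open>\<phi> w w x = 0\<close> describes the tangent hyperplane.
  If \<open>\<phi> w w p \<noteq> 0\<close>, then \<open>y\<close> is \<open>\<phi> w w p\<close> times the projection of \<open>r\<close> along \<open>p\<close> into this hyperplane,
  the factor clearing the denominator.\<close>

definition tangent_value :: "'a \<Rightarrow> 'a \<Rightarrow> 'a \<Rightarrow> complex" where
  "tangent_value w p r = (let y = scale (\<phi> w w p) r - scale (\<phi> w w r) p in \<phi> y y y)"

lemma tangent_value_expand:
  "tangent_value w p r = \<phi> r r r * \<phi> w w p ^ 3 - 3 * \<phi> r r p * \<phi> w w p ^ 2 * \<phi> w w r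
     + 3 * \<phi> r p p * \<phi> w w p * \<phi> w w r ^ 2 - \<phi> p p p * \<phi> w w r ^ 3"
proof -
  have "tangent_value w p r = (let y = scale (\<phi> w w p) r + scale (- \<phi> w w r) p in \<phi> y y y)"
    by (simp add: tangent_value_def)
  then show ?thesis
    by (simp add: Let_def add1 add2 add3 scale1 scale2 scale3 swap_repeated[where q = r and p = p] power2_eq_square
        power3_eq_cube algebra_simps del: scale_minus_left)
qed

lemma poly_tangent_poly: "poly (tangent_poly q p r) t = tangent_value (q + scale t p) p r"
  unfolding tangent_value_expand tangent_poly_def Let_def
  by (simp add: poly_square_poly power2_eq_square power3_eq_cube)

lemma degree_line_poly: "degree (line_poly q p) \<le> 3"
  by (simp add: line_poly_def)

lemma degree_tangent_poly: "degree (tangent_poly q p r) \<le> 6"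
proof -
  have 2: "degree (square_poly q p s) \<le> 2" for s by (simp add: square_poly_def)
  have 3: "degree (square_poly q p a * square_poly q p b * square_poly q p c) \<le> 6" for a b c
    using degree_mult_le[of "square_poly q p a * square_poly q p b" "square_poly q p c"]
      degree_mult_le[of "square_poly q p a" "square_poly q p b"] 2[of a] 2[of b] 2[of c] by linarith
  show ?thesis unfolding tangent_poly_def Let_def
    by (intro degree_diff_le degree_add_le order_trans[OF degree_smult_le] 3)
qed

text \<open>If \<open>\<phi> p p p \<noteq> 0\<close>, the cubic has degree three along the line through \<open>q\<close> with direction \<open>p\<close>, and the
  resultant vanishes if and only if \<open>tangent_value w p r = 0\<close> for one of its zeros \<open>w\<close> on this line.\<close>

definition eliminant :: "'a \<Rightarrow> 'a \<Rightarrow> 'a \<Rightarrow> complex" where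
  "eliminant p q r = \<phi> p p p * Determinant.det (sylvester93 (line_poly q p) (tangent_poly q p r))"

text \<open>If the linear form \<open>l\<close> divides the cubic on \<open>E\<close> and \<open>l p \<noteq> 0\<close>, the line meets the kernel of \<open>l\<close> in
  some \<open>w\<close>. The functional \<open>\<phi> w w\<close> is a multiple of \<open>l\<close>, so the projection of \<open>r\<close> lies in the kernel of
  \<open>l\<close> as well.\<close>

lemma eliminant_zero_if_linear_factor:
  assumes E: "subspace E" "p \<in> E" "q \<in> E" "r \<in> E"
    and l: "\<And>x y. x \<in> E \<Longrightarrow> y \<in> E \<Longrightarrow> l (x + y) = l x + l y"
      "\<And>c x. x \<in> E \<Longrightarrow> l (scale c x) = c * l x"
    and zero: "\<And>x. x \<in> E \<Longrightarrow> l x = 0 \<Longrightarrow> \<phi> x x x = 0"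
  shows "eliminant p q r = 0"
proof (cases "l p = 0")
  case True
  then show ?thesis using zero E(2) by (simp add: eliminant_def)
next
  case False
  define \<alpha> where "\<alpha> = - l q / l p"
  define w where "w = q + scale \<alpha> p"
  have lin: "l (x + scale c y) = l x + c * l y" if "x \<in> E" "y \<in> E" for x y c
    using that l subspace_scale[OF E(1)] by simp
  have inE: "x + scale c y \<in> E" if "x \<in> E" "y \<in> E" for x y c
    using that E(1) by (intro subspace_add subspace_scale)
  have w: "w \<in> E" using inE[OF E(3,2)] by (simp only: w_def)
  have lw: "l w = 0" using lin[OF E(3,2), of \<alpha>] False by (simp add: w_def \<alpha>_def)
  have iso: "isotropic {x \<in> E. l x = 0}"
    unfolding isotropic_def
  proof (intro conjI ballI)
    show "subspace {x \<in> E. l x = 0}"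
      using E(1) l l(2)[of 0 0] by (intro subspaceI) (auto intro: subspace_add subspace_scale subspace_0)
  qed (use zero in auto)
  have tangent: "\<phi> w w x = l x / l p * \<phi> w w p" if x: "x \<in> E" for x
  proof -
    let ?x = "x + scale (- (l x / l p)) p"
    have "?x \<in> {x \<in> E. l x = 0}" using inE[OF x E(2)] lin[OF x E(2), of "- (l x / l p)"] False
      by (simp del: scale_minus_left)
    then have "\<phi> w w ?x = 0" using isotropicD[OF iso, of w w ?x] w lw by blast
    moreover have "\<phi> w w ?x = \<phi> w w x + (- (l x / l p)) * \<phi> w w p" by (simp only: add3 scale3)
    ultimately show ?thesis by simp
  qed
  have "poly (line_poly q p) \<alpha> = 0"
    using zero[OF w lw] by (simp add: poly_line_poly w_def)
  moreover have "poly (tangent_poly q p r) \<alpha> = 0"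
  proof -
    let ?y = "scale (\<phi> w w p) r + scale (- \<phi> w w r) p"
    have "?y \<in> E" using inE[OF subspace_scale[OF E(1,4)] E(2)] .
    moreover have "l ?y = 0"
      using lin[OF subspace_scale[OF E(1,4)] E(2), of "\<phi> w w p" "- \<phi> w w r"] l(2)[OF E(4)]
        tangent[OF E(4)] False
      by (simp del: scale_minus_left)
    ultimately have "\<phi> ?y ?y ?y = 0" by (rule zero)
    then show ?thesis by (simp add: poly_tangent_poly tangent_value_def w_def)
  qed
  ultimately show ?thesis
    using det_sylvester_zero_if_common_root[OF degree_line_poly degree_tangent_poly]
    by (simp add: eliminant_def)
qed

text \<open>On the line between a point good for all but one of the functions and a point good for the
  remaining one, all of them are nonzero polynomials in the parameter.\<close>

lemma common_nonzero_point:
  fixes g :: "'i \<Rightarrow> 'a \<Rightarrow> complex"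
  assumes "finite S" "\<And>i. i \<in> S \<Longrightarrow> \<exists>x. g i x \<noteq> 0"
    and "\<And>i x y. i \<in> S \<Longrightarrow> \<exists>P. \<forall>t. g i (x + scale t y) = poly P t"
  shows "\<exists>x. \<forall>i\<in>S. g i x \<noteq> 0"
  using assms
proof (induction S rule: finite_induct)
  case empty
  then show ?case by simp
next
  case (insert j S)
  obtain x where x: "\<forall>i\<in>S. g i x \<noteq> 0" using insert by auto
  obtain y where y: "g j y \<noteq> 0" using insert.prems(1)[of j] by blast
  have "\<forall>i\<in>insert j S. \<exists>P. \<forall>t. g i (x + scale t (y - x)) = poly P t"
    using insert.prems(2) by blast
  then obtain P where P: "\<And>i t. i \<in> insert j S \<Longrightarrow> g i (x + scale t (y - x)) = poly (P i) t"
    by metis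
  have ne: "P i \<noteq> 0" if "i \<in> insert j S" for i
  proof
    assume 0: "P i = 0"
    show False
    proof (cases "i = j")
      case True
      then show False using P[OF that, of 1] 0 y by simp
    next
      case False
      then show False using P[OF that, of 0] 0 x that by auto
    qed
  qed
  have "finite (\<Union>i\<in>insert j S. {t. poly (P i) t = 0})"
    using insert.hyps(1) ne by (intro finite_UN_I) (auto intro: poly_roots_finite)
  then obtain t where "t \<notin> (\<Union>i\<in>insert j S. {t. poly (P i) t = 0})"
    using infinite_UNIV_char_0 by (metis UNIV_eq_I)
  then have "\<forall>i\<in>insert j S. g i (x + scale t (y - x)) \<noteq> 0" using P by auto
  then show ?case by blast
qed

lemma poly_zero_off_0:
  fixes P :: "complex poly"
  assumes "\<And>t. t \<noteq> 0 \<Longrightarrow> poly P t = 0"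
  shows "P = 0"
proof (rule ccontr)
  assume "P \<noteq> 0"
  then have "finite {t. poly P t = 0}" by (rule poly_roots_finite)
  then have "finite (insert 0 {t. poly P t = 0})" by simp
  moreover have "insert 0 {t. poly P t = 0} = UNIV" using assms by auto
  ultimately show False using infinite_UNIV_char_0[where 'a = complex] by simp
qed

text \<open>If every zero is singular, every line through a point \<open>p\<close> with \<open>\<phi> p p p \<noteq> 0\<close> meets the cubic in a
  triple point. For points \<open>q\<close> with \<open>\<phi> p p q = 0\<close> the sum of the roots is zero, so the triple root is
  zero and the cubic vanishes on the hyperplane \<open>\<phi> p p q = 0\<close>.\<close>

lemma smooth_zero_exists:
  assumes no_factor: "\<And>l. Vector_Spaces.linear scale (*) l \<Longrightarrow> \<exists>x. l x = 0 \<and> \<phi> x x x \<noteq> 0"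
  shows "\<exists>w s. \<phi> w w w = 0 \<and> \<phi> w w s \<noteq> 0"
proof (rule ccontr)
  assume "\<nexists>w s. \<phi> w w w = 0 \<and> \<phi> w w s \<noteq> 0"
  then have sing: "\<phi> w w s = 0" if "\<phi> w w w = 0" for w s using that by blast
  have lin: "Vector_Spaces.linear scale (*) (\<lambda>x. \<phi> a b x)" for a b
    by unfold_locales (simp_all add: add3 scale3 algebra_simps)
  have "\<phi> 0 0 x = 0" for x by (simp add: zero1)
  then obtain p where p: "\<phi> p p p \<noteq> 0" using no_factor[OF lin[of 0 0]] by blast
  obtain q where q: "\<phi> p p q = 0" "\<phi> q q q \<noteq> 0" using no_factor[OF lin[of p p]] by blast
  have qpp: "\<phi> q p p = 0" using q(1) swap_repeated by metis
  define a where "a = \<phi> p p p"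
  define c where "c = \<phi> q q p"
  define d where "d = \<phi> q q q"
  have line: "\<phi> (q + scale t p) (q + scale t p) (q + scale t p) = d + 3 * c * t + a * t ^ 3" for t
    unfolding poly_line_poly[symmetric] by (simp add: line_poly_def qpp a_def c_def d_def power3_eq_cube algebra_simps)
  have der: "\<phi> (q + scale t p) (q + scale t p) p = c + a * t ^ 2" for t
    using poly_square_poly[of q p p t]
    by (simp add: square_poly_def qpp a_def c_def power2_eq_square algebra_simps)
  have zero: "c + a * t ^ 2 = 0" if "d + 3 * c * t + a * t ^ 3 = 0" for t
    using sing[of "q + scale t p" p] line[of t] der[of t] that by simp
  have "\<not> constant (poly [:d, 3 * c, 0, a:])"
    using p by (simp add: constant_degree a_def)
  then obtain t where "poly [:d, 3 * c, 0, a:] t = 0"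
    using fundamental_theorem_of_algebra by blast
  then have t: "d + 3 * c * t + a * t ^ 3 = 0" by (simp add: power3_eq_cube algebra_simps)
  have c: "c = - (a * t ^ 2)" using zero[OF t] by (simp add: eq_neg_iff_add_eq_0)
  then have d: "d = 2 * a * t ^ 3" using t by (simp add: power2_eq_square power3_eq_cube algebra_simps)
  \<comment> \<open>The double root \<open>t\<close> has the companion root \<open>-2 t\<close>, which has to be multiple too.\<close>
  have "d + 3 * c * (- 2 * t) + a * (- 2 * t) ^ 3 = 0"
    unfolding c d by (simp add: power2_eq_square power3_eq_cube algebra_simps)
  then have "c + a * (- 2 * t) ^ 2 = 0" by (rule zero)
  then have "3 * (a * t ^ 2) = 0" unfolding c by (simp add: power2_eq_square algebra_simps)
  then have "t = 0" using p by (simp add: a_def)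
  then show False using d q(2) by (simp add: d_def)
qed

text \<open>Take a smooth zero \<open>w\<close>. Lines through \<open>w\<close> meet the cubic in two further points, and these differ
  unless a discriminant vanishes. If it vanished for all lines outside the tangent hyperplane
  \<open>\<phi> w w x = 0\<close>, comparing coefficients along lines \<open>x + t s\<close> transversal to that hyperplane would
  show that the cubic is zero on it.\<close>

lemma transversal_line_exists:
  assumes no_factor: "\<And>l. Vector_Spaces.linear scale (*) l \<Longrightarrow> \<exists>x. l x = 0 \<and> \<phi> x x x \<noteq> 0"
  shows "\<exists>p q. \<phi> p p p \<noteq> 0 \<and> (\<forall>t. poly (line_poly q p) t = 0 \<longrightarrow>
    \<phi> (q + scale t p) (q + scale t p) p \<noteq> 0)"
proof -
  obtain w s where w: "\<phi> w w w = 0" and s: "\<phi> w w s \<noteq> 0"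
    using smooth_zero_exists[OF no_factor] by blast
  have lin: "Vector_Spaces.linear scale (*) (\<lambda>x. \<phi> w w x)"
    by unfold_locales (simp_all add: add3 scale3 algebra_simps)
  have "\<exists>r. \<phi> w w r \<noteq> 0 \<and> 3 * \<phi> w r r ^ 2 \<noteq> 4 * \<phi> w w r * \<phi> r r r"
  proof (rule ccontr)
    assume "\<nexists>r. \<phi> w w r \<noteq> 0 \<and> 3 * \<phi> w r r ^ 2 \<noteq> 4 * \<phi> w w r * \<phi> r r r"
    then have disc: "3 * \<phi> w r r ^ 2 = 4 * \<phi> w w r * \<phi> r r r" if "\<phi> w w r \<noteq> 0" for r
      using that by blast
    obtain x where x: "\<phi> w w x = 0" "\<phi> x x x \<noteq> 0" using no_factor[OF lin] by blast
    define Q where "Q = [:\<phi> w x x, 2 * \<phi> w x s, \<phi> w s s:]"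
    have Q: "\<phi> w (x + scale t s) (x + scale t s) = poly Q t" for t
      by (simp add: Q_def add2 add3 scale2 scale3 swap23[of w s x] algebra_simps)
    define k where "k = \<phi> w w s"
    have "3 * Q ^ 2 - [:0, 4 * k:] * line_poly x s = 0"
    proof (rule poly_zero_off_0)
      fix t :: complex assume t: "t \<noteq> 0"
      have "\<phi> w w (x + scale t s) = t * k" using x by (simp add: add3 scale3 k_def)
      then show "poly (3 * Q ^ 2 - [:0, 4 * k:] * line_poly x s) t = 0"
        using disc[of "x + scale t s"] s t Q[of t] poly_line_poly[of x s t]
        by (simp add: k_def algebra_simps)
    qed
    then have eq: "3 * Q ^ 2 = [:0, 4 * k:] * line_poly x s" by simp
    have "poly (3 * Q ^ 2) 0 = poly ([:0, 4 * k:] * line_poly x s) 0" by (simp only: eq)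
    then have "\<phi> w x x = 0" by (simp add: Q_def)
    then have "Polynomial.coeff (3 * Q ^ 2) 1 = 0"
      by (simp add: Q_def power2_eq_square numeral_poly)
    moreover have "Polynomial.coeff ([:0, 4 * k:] * line_poly x s) 1 = 4 * k * \<phi> x x x"
      by (simp add: line_poly_def)
    ultimately show False using eq x(2) s by (simp add: k_def)
  qed
  then obtain r where r: "\<phi> w w r \<noteq> 0" "3 * \<phi> w r r ^ 2 \<noteq> 4 * \<phi> w w r * \<phi> r r r" by blast
  have "line_poly r w \<noteq> 0"
  proof
    assume "line_poly r w = 0"
    then have "3 * \<phi> r w w = 0" by (simp add: line_poly_def)
    then show False using r(1) swap_repeated[where q = r and p = w] by simp
  qed
  then have "finite {c. poly (line_poly r w) c = 0}" by (rule poly_roots_finite)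
  then obtain c where c: "poly (line_poly r w) c \<noteq> 0"
    using infinite_UNIV_char_0[where 'a = complex] by (metis (mono_tags) UNIV_eq_I mem_Collect_eq)
  \<comment> \<open>Moving \<open>r\<close> along \<open>w\<close> makes the value of the cubic nonzero and leaves the discriminant unchanged.\<close>
  define p where "p = r + scale c w"
  define L where "L = \<phi> w w r"
  have p: "\<phi> p p p \<noteq> 0" using c by (simp add: poly_line_poly p_def)
  have Lp: "\<phi> w w p = L" by (simp add: p_def add3 scale3 w L_def)
  have wpp: "\<phi> w p p = \<phi> w r r + 2 * c * L"
    using swap23[of w r w] by (simp add: p_def add2 add3 scale2 scale3 w L_def algebra_simps)
  have ppp: "\<phi> p p p = \<phi> r r r + 3 * c * \<phi> w r r + 3 * c ^ 2 * L"
  proof -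
    have a: "\<phi> r r w = \<phi> w r r" and b: "\<phi> r w w = L"
      using swap_repeated[where q = r and p = w] by (simp_all add: L_def)
    show ?thesis using poly_line_poly[of r w c]
      by (simp add: p_def line_poly_def w a b power2_eq_square algebra_simps)
  qed
  have disc: "3 * \<phi> w p p ^ 2 \<noteq> 4 * L * \<phi> p p p"
  proof
    assume "3 * \<phi> w p p ^ 2 = 4 * L * \<phi> p p p"
    then have "3 * \<phi> w r r ^ 2 = 4 * L * \<phi> r r r"
      unfolding wpp ppp by (simp add: power2_eq_square algebra_simps)
    then show False using r(2) by (simp add: L_def)
  qed
  have "\<phi> (w + scale t p) (w + scale t p) p \<noteq> 0" if "poly (line_poly w p) t = 0" for t
  proof
    assume "\<phi> (w + scale t p) (w + scale t p) p = 0"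
    then have 2: "L + 2 * t * \<phi> w p p + t ^ 2 * \<phi> p p p = 0"
      using poly_square_poly[of w p p t]
      by (simp add: square_poly_def Lp power2_eq_square algebra_simps)
    have "t * (3 * L + 3 * t * \<phi> w p p + t ^ 2 * \<phi> p p p) = 0"
      using that by (simp add: line_poly_def w Lp power2_eq_square algebra_simps)
    moreover have "t \<noteq> 0" using 2 r(1) by (auto simp: L_def)
    ultimately have 1: "3 * L + 3 * t * \<phi> w p p + t ^ 2 * \<phi> p p p = 0" by simp
    have "2 * L + t * \<phi> w p p
        = (3 * L + 3 * t * \<phi> w p p + t ^ 2 * \<phi> p p p) - (L + 2 * t * \<phi> w p p + t ^ 2 * \<phi> p p p)"
      by (simp add: algebra_simps)
    then have "2 * L + t * \<phi> w p p = 0" by (simp only: 1 2 diff_self)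
    then have 3: "t * \<phi> w p p = - 2 * L" by (simp add: eq_neg_iff_add_eq_0 add.commute)
    have "t ^ 2 * \<phi> p p p = (L + 2 * t * \<phi> w p p + t ^ 2 * \<phi> p p p) - L - 2 * (t * \<phi> w p p)"
      by (simp add: algebra_simps)
    then have 4: "t ^ 2 * \<phi> p p p = 3 * L" by (simp only: 2 3) simp
    have "t ^ 2 * (3 * \<phi> w p p ^ 2) = 3 * (t * \<phi> w p p) ^ 2" by (simp add: power_mult_distrib)
    also have "\<dots> = 4 * L * (t ^ 2 * \<phi> p p p)" unfolding 3 4 by (simp add: power2_eq_square)
    also have "\<dots> = t ^ 2 * (4 * L * \<phi> p p p)" by simp
    finally have "t ^ 2 * (3 * \<phi> w p p ^ 2) = t ^ 2 * (4 * L * \<phi> p p p)" .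
    then show False using \<open>t \<noteq> 0\<close> disc by simp
  qed
  then show ?thesis using p by blast
qed

text \<open>On a line that meets the cubic transversally, each of the finitely many tangent hyperplanes
  at the intersection points contains a point where the cubic is nonzero; a generic \<open>r\<close> serves all of
  them.\<close>

theorem eliminant_nonzero_exists:
  assumes no_factor: "\<And>l. Vector_Spaces.linear scale (*) l \<Longrightarrow> \<exists>x. l x = 0 \<and> \<phi> x x x \<noteq> 0"
  shows "\<exists>p q r. eliminant p q r \<noteq> 0"
proof -
  obtain p q where p: "\<phi> p p p \<noteq> 0"
    and simple: "\<And>t. poly (line_poly q p) t = 0 \<Longrightarrow> \<phi> (q + scale t p) (q + scale t p) p \<noteq> 0"
    using transversal_line_exists[OF no_factor] by blast
  define S where "S = {t. poly (line_poly q p) t = 0}"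
  have deg: "degree (line_poly q p) = 3" using p by (simp add: line_poly_def)
  then have "line_poly q p \<noteq> 0" by auto
  then have fin: "finite S" unfolding S_def by (rule poly_roots_finite)
  have "\<exists>r. \<forall>t\<in>S. tangent_value (q + scale t p) p r \<noteq> 0"
  proof (rule common_nonzero_point[OF fin])
    fix t assume t: "t \<in> S"
    define w where "w = q + scale t p"
    have wp: "\<phi> w w p \<noteq> 0" using simple t by (simp add: S_def w_def)
    have lin: "Vector_Spaces.linear scale (*) (\<lambda>x. \<phi> w w x)"
      by unfold_locales (simp_all add: add3 scale3 algebra_simps)
    obtain z where z: "\<phi> w w z = 0" "\<phi> z z z \<noteq> 0" using no_factor[OF lin] by blast
    have "tangent_value w p z = \<phi> z z z * \<phi> w w p ^ 3" by (simp add: tangent_value_expand z(1))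
    then show "\<exists>r. tangent_value (q + scale t p) p r \<noteq> 0"
      using z(2) wp by (intro exI[of _ z]) (simp add: w_def)
  next
    fix t x y assume "t \<in> S"
    define w where "w = q + scale t p"
    define D where "D = (\<lambda>x. scale (\<phi> w w p) x - scale (\<phi> w w x) p)"
    have "D (x + scale u y) = D x + scale u (D y)" for u
      by (simp add: D_def add3 scale3 algebra_simps)
    then have "tangent_value w p (x + scale u y) = poly (line_poly (D x) (D y)) u" for u
      using poly_line_poly[of "D x" "D y" u] by (simp add: tangent_value_def D_def Let_def)
    then show "\<exists>P. \<forall>u. tangent_value (q + scale t p) p (x + scale u y) = poly P u"
      unfolding w_def by blast
  qed
  then obtain r where r: "\<forall>t\<in>S. tangent_value (q + scale t p) p r \<noteq> 0" by blast
  then have "poly (tangent_poly q p r) t \<noteq> 0" if "poly (line_poly q p) t = 0" for t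
    using that by (simp add: poly_tangent_poly S_def)
  then have "Determinant.det (sylvester93 (line_poly q p) (tangent_poly q p r)) \<noteq> 0"
    by (rule det_sylvester_nonzero_if_no_common_root[OF deg degree_tangent_poly])
  then show ?thesis using p unfolding eliminant_def by (metis mult_eq_0_iff)
qed

end

section \<open>Identification of a space with its dual\<close>

text \<open>Linear forms on a subspace vanish outside of it by convention; this replaces them by functionals
  that are linear everywhere.\<close>

lemma linear_form_extends:
  assumes s: "Vector_Spaces.vector_space s" and S: "module.subspace s S"
    and l: "l \<in> linear_forms s S"
  obtains m where "Vector_Spaces.linear s (*) (m :: _ \<Rightarrow> complex)" "\<And>x. x \<in> S \<Longrightarrow> m x = l x"
proof -
  interpret S: Vector_Spaces.vector_space s by fact
  have c: "Vector_Spaces.vector_space ((*) :: complex \<Rightarrow> complex \<Rightarrow> complex)"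
    by unfold_locales (auto simp: algebra_simps)
  interpret p: vector_space_pair s "(*) :: complex \<Rightarrow> complex \<Rightarrow> complex"
    using s c by (simp add: vector_space_pair_def)
  interpret P: polynomials_on_subspace s S by unfold_locales fact
  obtain B where B: "B \<subseteq> S" "S.independent B" "S \<subseteq> S.span B"
    using S.maximal_independent_subset[of S] by blast
  obtain m where m: "Vector_Spaces.linear s (*) m" "\<forall>x\<in>B. m x = l x"
    using p.linear_independent_extend[OF B(2)] by blast
  interpret m: Vector_Spaces.linear s "(*)" m by (rule m(1))
  have sub: "S.span B \<subseteq> S" using B(1) S by (rule S.span_minimal)
  have "m x = l x" if "x \<in> S" for x
  proof -
    have "x \<in> S.span B" using that B(3) by blast
    then have "m x = l x \<and> x \<in> S.span B"
    proof (induction rule: S.span_induct_alt)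
      case base
      then show ?case using P.linear_formD(4)[OF l] m.zero S.span_zero by simp
    next
      case (step c x y)
      have x: "x \<in> S" and y: "y \<in> S" using step B(1) sub by auto
      have "l (s c x + y) = c * l x + l y"
        using P.linear_formD(1)[OF l S.subspace_scale[OF S x] y] P.linear_formD(2)[OF l x] by simp
      moreover have "m (s c x + y) = c * l x + l y"
        using m.add m.scale step m(2) by simp
      moreover have "s c x + y \<in> S.span B"
        using S.span_add[OF S.span_scale[OF S.span_base[OF step(1)]]] step(2) by blast
      ultimately show ?case by simp
    qed
    then show ?thesis ..
  qed
  then show ?thesis using that[OF m(1)] by blast
qed

lemma linear_form_of_linear:
  assumes "module.subspace s S" "Vector_Spaces.linear s (*) (m :: _ \<Rightarrow> complex)"
  shows "restrict_fun S m \<in> linear_forms s S"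
proof -
  interpret m: Vector_Spaces.linear s "(*)" m by fact
  show ?thesis
    using m.vs1.subspace_add[OF assms(1)] m.vs1.subspace_scale[OF assms(1)]
    by (auto simp: linear_forms_def restrict_fun_apply m.add m.scale)
qed

lemma restrict_hom_poly:
  assumes "module.subspace s W" "module.subspace s E" "E \<subseteq> W" "F \<in> hom_polys s W d"
    and s: "Vector_Spaces.vector_space s"
  shows "restrict_fun E F \<in> hom_polys s E d"
proof -
  interpret Vector_Spaces.vector_space s by fact
  have id: "Vector_Spaces.linear s s (\<lambda>x. x)" by unfold_locales auto
  show ?thesis using hom_poly_pullback[OF id assms(2) _ assms(1,4)] assms(3) by auto
qed

locale dual_identification = finite_dimensional_vector_space scale Basis
  for scale :: "complex \<Rightarrow> 'v::ab_group_add \<Rightarrow> 'v" and Basis :: "'v set"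
begin

text \<open>The isomorphism that sends the chosen basis to the dual basis; \<open>from_dual\<close> is its inverse. It moves
  questions about subspaces of the dual, which is itself a subspace of a function space, to the
  original finite-dimensional space.\<close>

definition to_dual :: "'v \<Rightarrow> 'v \<Rightarrow> complex" where
  "to_dual x = (\<lambda>y. \<Sum>b\<in>Basis. representation Basis x b * representation Basis y b)"

definition from_dual :: "('v \<Rightarrow> complex) \<Rightarrow> 'v" where
  "from_dual \<psi> = (\<Sum>b\<in>Basis. scale (\<psi> b) b)"

lemma in_span_Basis: "x \<in> span Basis"
  using span_Basis by simp

lemma representation_add_scale:
  "representation Basis (x + y) b = representation Basis x b + representation Basis y b"
  "representation Basis (scale c x) b = c * representation Basis x b"
  using representation_add[OF independent_Basis in_span_Basis in_span_Basis]
    representation_scale[OF independent_Basis in_span_Basis] by simp_all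

lemma linear_to_dual: "Vector_Spaces.linear scale fscale to_dual"
  by unfold_locales
    (auto simp: to_dual_def fun_eq_iff fscale_apply representation_add_scale algebra_simps
      sum.distrib sum_distrib_left)

lemma linear_from_dual: "Vector_Spaces.linear fscale scale from_dual"
  by unfold_locales
    (auto simp: from_dual_def fscale_apply scale_left_distrib sum.distrib scale_sum_right algebra_simps)

lemma dual_space_iff: "\<psi> \<in> dual_space scale \<longleftrightarrow>
    (\<forall>x y. \<psi> (x + y) = \<psi> x + \<psi> y) \<and> (\<forall>c x. \<psi> (scale c x) = c * \<psi> x)"
  using linear_functional_iff[OF vector_space_axioms] by (simp add: dual_space_def)

lemma to_dual_in_dual: "to_dual x \<in> dual_space scale"
  by (auto simp: dual_space_iff to_dual_def representation_add_scale algebra_simps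
      sum.distrib sum_distrib_left)

lemma subspace_dual: "fs.subspace (dual_space scale)"
  by (rule fs.subspaceI) (auto simp: dual_space_iff fscale_apply algebra_simps)

lemma basis_expansion: "(\<Sum>b\<in>Basis. scale (representation Basis x b) b) = x"
  by (rule sum_representation_eq[OF independent_Basis in_span_Basis finite_Basis order_refl])

lemma from_dual_to_dual [simp]: "from_dual (to_dual x) = x"
proof -
  have "to_dual x b = representation Basis x b" if "b \<in> Basis" for b
  proof -
    have "to_dual x b = (\<Sum>c\<in>Basis. if c = b then representation Basis x c else 0)"
      unfolding to_dual_def representation_basis[OF independent_Basis that]
      by (intro sum.cong) auto
    then show ?thesis using that finite_Basis by simp
  qed
  then show ?thesis using basis_expansion[of x] by (simp add: from_dual_def)
qed

lemma to_dual_from_dual: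
  assumes "\<psi> \<in> dual_space scale"
  shows "to_dual (from_dual \<psi>) = \<psi>"
proof
  fix y
  interpret \<psi>: Vector_Spaces.linear scale "(*)" \<psi> using assms by (simp add: dual_space_def)
  have "representation Basis (from_dual \<psi>) b = \<psi> b" if "b \<in> Basis" for b
  proof -
    have "representation Basis (from_dual \<psi>) b
        = (\<Sum>c\<in>Basis. \<psi> c * representation Basis c b)"
      unfolding from_dual_def
      using representation_sum[OF independent_Basis, of Basis "\<lambda>c. scale (\<psi> c) c"] in_span_Basis
      by (simp add: representation_add_scale)
    also have "\<dots> = (\<Sum>c\<in>Basis. if c = b then \<psi> c else 0)"
      by (intro sum.cong) (auto simp: representation_basis[OF independent_Basis])
    also have "\<dots> = \<psi> b" using that finite_Basis by simp
    finally show ?thesis .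
  qed
  then have "to_dual (from_dual \<psi>) y = (\<Sum>b\<in>Basis. representation Basis y b * \<psi> b)"
    by (simp add: to_dual_def mult.commute)
  also have "\<dots> = \<psi> (\<Sum>b\<in>Basis. scale (representation Basis y b) b)"
    by (simp add: \<psi>.sum \<psi>.scale)
  finally show "to_dual (from_dual \<psi>) y = \<psi> y" by (simp add: basis_expansion)
qed

lemma inj_to_dual: "inj to_dual"
  using from_dual_to_dual by (metis injI)

lemma subspace_vimage_to_dual:
  assumes "fs.subspace E"
  shows "subspace (to_dual -` E)"
  using linear_to_dual assms by (intro module_hom.subspace_vimage[of scale fscale])
    (simp_all add: module_hom_iff_linear)

lemma image_to_dual_grassmannian:
  assumes "subspace S" "dim S = k"
  shows "to_dual ` S \<in> dual_grassmannian scale k"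
proof -
  interpret p: finite_dimensional_vector_space_pair_1 scale Basis "fscale :: complex \<Rightarrow> ('v \<Rightarrow> complex) \<Rightarrow> _"
    by unfold_locales
  interpret T: Vector_Spaces.linear scale fscale to_dual by (rule linear_to_dual)
  have "fs.dim (to_dual ` S) = dim S"
    by (rule p.dim_image_eq[OF linear_to_dual inj_on_subset[OF inj_to_dual]]) simp
  then show ?thesis
    using assms T.subspace_image[OF assms(1)] to_dual_in_dual
    by (auto simp: dual_grassmannian_def)
qed

lemma slice_rank_restrict_le_iff:
  assumes f: "f \<in> hom_polys fscale (dual_space scale) 3"
    and E: "fs.subspace E" "E \<subseteq> dual_space scale"
  shows "slice_rank fscale E 3 (restrict_fun E f) \<le> r \<longleftrightarrow>
    (\<exists>l. (\<forall>i<r. Vector_Spaces.linear scale (*) (l i)) \<and>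
      (\<forall>x. to_dual x \<in> E \<longrightarrow> (\<forall>i<r. l i x = 0) \<longrightarrow> f (to_dual x) = 0))"
    (is "?L \<longleftrightarrow> ?R")
proof -
  interpret P: polynomials_on_subspace fscale E by unfold_locales (rule E(1))
  have fE: "restrict_fun E f \<in> hom_polys fscale E 3"
    by (rule restrict_hom_poly[OF subspace_dual E f vector_space_fscale])
  show ?thesis unfolding P.slice_rank_le_iff[OF fE]
  proof
    assume "\<exists>l. (\<forall>i<r. l i \<in> linear_forms fscale E) \<and>
        (\<forall>x\<in>E. (\<forall>i<r. l i x = 0) \<longrightarrow> restrict_fun E f x = 0)"
    then obtain l where l: "\<And>i. i < r \<Longrightarrow> l i \<in> linear_forms fscale E"
      "\<And>x. x \<in> E \<Longrightarrow> \<forall>i<r. l i x = 0 \<Longrightarrow> f x = 0"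
      by (auto simp: restrict_fun_apply)
    have "\<exists>m. Vector_Spaces.linear scale (*) (m :: _ \<Rightarrow> complex) \<and>
        (\<forall>x. to_dual x \<in> E \<longrightarrow> m x = l i (to_dual x))" if "i < r" for i
    proof -
      have "restrict_fun (to_dual -` E) (\<lambda>x. l i (to_dual x)) \<in> linear_forms scale (to_dual -` E)"
        by (rule linear_form_pullback[OF linear_to_dual subspace_vimage_to_dual[OF E(1)] _ l(1)[OF that]])
          simp
      then obtain m where "Vector_Spaces.linear scale (*) m"
        "\<And>x. x \<in> to_dual -` E \<Longrightarrow> m x = restrict_fun (to_dual -` E) (\<lambda>x. l i (to_dual x)) x"
        using linear_form_extends[OF vector_space_axioms subspace_vimage_to_dual[OF E(1)]] by metis
      then show ?thesis by (intro exI[of _ m]) (auto simp: restrict_fun_apply)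
    qed
    then obtain m where "\<And>i. i < r \<Longrightarrow> Vector_Spaces.linear scale (*) (m i :: _ \<Rightarrow> complex) \<and>
        (\<forall>x. to_dual x \<in> E \<longrightarrow> m i x = l i (to_dual x))" by metis
    then show ?R using l(2) by (intro exI[of _ m]) auto
  next
    assume ?R
    then obtain l where l: "\<And>i. i < r \<Longrightarrow> Vector_Spaces.linear scale (*) (l i)"
      "\<And>x. to_dual x \<in> E \<Longrightarrow> \<forall>i<r. l i x = 0 \<Longrightarrow> f (to_dual x) = 0" by blast
    let ?m = "\<lambda>i. restrict_fun E (\<lambda>\<psi>. l i (from_dual \<psi>))"
    have "?m i \<in> linear_forms fscale E" if "i < r" for i
      using Vector_Spaces.linear_compose[OF linear_from_dual l(1)[OF that]]
      by (intro linear_form_of_linear[OF E(1)]) (simp add: o_def)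
    moreover have "restrict_fun E f \<psi> = 0" if "\<psi> \<in> E" "\<forall>i<r. ?m i \<psi> = 0" for \<psi>
      using l(2)[of "from_dual \<psi>"] that to_dual_from_dual[of \<psi>] E(2)
      by (auto simp: restrict_fun_apply)
    ultimately show "\<exists>l. (\<forall>i<r. l i \<in> linear_forms fscale E) \<and>
        (\<forall>x\<in>E. (\<forall>i<r. l i x = 0) \<longrightarrow> restrict_fun E f x = 0)"
      by (intro exI[of _ ?m]) blast
  qed
qed

lemma restrict_dual_self:
  assumes "f \<in> hom_polys fscale (dual_space scale) d"
  shows "restrict_fun (dual_space scale) f = f"
proof -
  interpret P: polynomials_on_subspace fscale "dual_space scale" by unfold_locales (rule subspace_dual)
  show ?thesis using P.hom_poly_outside[OF assms] by (auto simp: fun_eq_iff restrict_fun_apply)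
qed

lemma subspace_as_kernel:
  assumes "subspace L" "dim L + r = dim UNIV"
  shows "\<exists>l. (\<forall>i<r. Vector_Spaces.linear scale (*) (l i :: 'v \<Rightarrow> complex)) \<and>
    (\<forall>x. (\<forall>i<r. l i x = 0) \<longrightarrow> x \<in> L)"
  using assms
proof (induction r arbitrary: L)
  case 0
  then have "L = UNIV" by (intro subspace_dim_equal) auto
  then show ?case by simp
next
  case (Suc r)
  have "L \<noteq> UNIV" using Suc.prems(2) by auto
  then obtain z where z: "z \<notin> L" by blast
  let ?L = "span (insert z L)"
  have "dim ?L + r = dim UNIV" using dim_span_insert[OF Suc.prems(1) z] Suc.prems(2) by simp
  then obtain l where l: "\<forall>i<r. Vector_Spaces.linear scale (*) (l i :: 'v \<Rightarrow> complex)"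
    "\<And>x. (\<forall>i<r. l i x = 0) \<Longrightarrow> x \<in> ?L" using Suc.IH[OF subspace_span] by blast
  have c: "Vector_Spaces.vector_space ((*) :: complex \<Rightarrow> complex \<Rightarrow> complex)"
    by unfold_locales (auto simp: algebra_simps)
  interpret p: vector_space_pair scale "(*) :: complex \<Rightarrow> complex \<Rightarrow> complex"
    using vector_space_axioms c by (simp add: vector_space_pair_def)
  obtain B where B: "B \<subseteq> L" "independent B" "L \<subseteq> span B"
    using maximal_independent_subset[of L] by blast
  have "span B \<subseteq> L" using B(1) Suc.prems(1) by (rule span_minimal)
  then have zB: "z \<notin> span B" using z by blast
  then have "independent (insert z B)" using B(2) by (rule independent_insertI)
  then obtain m where m: "Vector_Spaces.linear scale (*) m"
    "\<forall>x\<in>insert z B. m x = (if x = z then 1 else 0 :: complex)"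
    using p.linear_independent_extend[of "insert z B" "\<lambda>x. if x = z then 1 else 0"] by blast
  interpret m: Vector_Spaces.linear scale "(*)" m by (rule m(1))
  have "z \<notin> B" using zB span_base[of z B] by blast
  then have "m x = 0" if "x \<in> B" for x using m(2) that by auto
  then have mL: "m x = 0" if "x \<in> L" for x
    using m.eq_0_on_span[of B x] B(3) that by blast
  have "x \<in> L" if "\<forall>i<Suc r. (l(r := m)) i x = 0" for x
  proof -
    have "m x = 0" using spec[OF that, of r] by simp
    have "l i x = 0" if i: "i < r" for i using spec[OF \<open>\<forall>i<Suc r. (l(r := m)) i x = 0\<close>, of i] i by simp
    then have "x \<in> ?L" by (intro l(2)) blast
    then obtain c where c: "x - scale c z \<in> L"
      using span_breakdown_eq[of x z L] Suc.prems(1) by (metis span_eq_iff)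
    have "m x - c * m z = 0" using mL[OF c] by (simp add: m.diff m.scale)
    then have "c = 0" using \<open>m x = 0\<close> m(2) by simp
    then show ?thesis using c by simp
  qed
  then show ?case using l(1) m(1) by (intro exI[of _ "l(r := m)"]) (auto simp: less_Suc_eq)
qed

end

section \<open>Density of open sets in the Grassmannian\<close>

text \<open>In this form the factor that involves \<open>e j\<close> can be split off for each \<open>j\<close>.\<close>

lemma wedge_expand:
  "wedge k e v = (\<Sum>p | p permutes {0..<k}. signof p * (\<Prod>j<k. e j (v (p j))))"
proof -
  have "wedge k e v = (\<Sum>p | p permutes {0..<k}. signof p *
      (\<Prod>j<k. Matrix.mat k k (\<lambda>(i, j). e j (v i)) $$ (p j, j)))"
    unfolding wedge_def by (rule det_col) simp
  also have "\<dots> = (\<Sum>p | p permutes {0..<k}. signof p * (\<Prod>j<k. e j (v (p j))))"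
  proof (intro sum.cong refl arg_cong2[of _ _ _ _ "(*)"] prod.cong)
    fix p j assume "p \<in> {p. p permutes {0..<k}}" "j \<in> {..<k}"
    then have "p j < k" "j < k" using permutes_in_image[of p "{0..<k}" j] by auto
    then show "Matrix.mat k k (\<lambda>(i, j). e j (v i)) $$ (p j, j) = e j (v (p j))" by simp
  qed
  finally show ?thesis .
qed

lemma wedge_cong: "(\<And>j. j < k \<Longrightarrow> e j = e' j) \<Longrightarrow> wedge k e = wedge k e'"
  unfolding wedge_def by (intro ext arg_cong[of _ _ Determinant.det] eq_matI) auto

lemma wedge_update:
  assumes "m < k"
  shows "wedge k (e(m := fscale a x + fscale b y))
    = fscale a (wedge k (e(m := x))) + fscale b (wedge k (e(m := y)))"
proof
  fix v
  have split: "(\<Prod>j<k. (e(m := z)) j (v (p j))) = z (v (p m)) * (\<Prod>j\<in>{..<k} - {m}. e j (v (p j)))"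
    for z and p :: "nat \<Rightarrow> nat"
    using assms by (subst prod.remove[of "{..<k}" m]) (auto intro!: prod.cong)
  show "wedge k (e(m := fscale a x + fscale b y)) v
      = (fscale a (wedge k (e(m := x))) + fscale b (wedge k (e(m := y)))) v"
    unfolding plus_fun_apply fscale_apply wedge_expand split
    by (simp add: fscale_apply algebra_simps sum.distrib sum_distrib_left)
qed

context dual_identification
begin

lemma wedge_in_power:
  assumes "\<And>j. j < k \<Longrightarrow> e j \<in> dual_space scale"
  shows "wedge k e \<in> dual_exterior_power scale k"
  unfolding dual_exterior_power_def using assms by (intro fs.span_base) blast

lemma subspace_power: "fs.subspace (dual_exterior_power scale k)"
  unfolding dual_exterior_power_def by (rule fs.subspace_span)

definition tuple_line :: "(nat \<Rightarrow> 'v \<Rightarrow> complex) \<Rightarrow> (nat \<Rightarrow> 'v \<Rightarrow> complex) \<Rightarrow> complex \<Rightarrow>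
    nat \<Rightarrow> 'v \<Rightarrow> complex" where
  "tuple_line e e' t = (\<lambda>j. fscale (1 - t) (e j) + fscale t (e' j))"

lemma tuple_line_swap: "tuple_line e e' t = tuple_line e' e (1 - t)"
  by (simp add: tuple_line_def add.commute)

lemma tuple_line_in_dual:
  assumes "e j \<in> dual_space scale" "e' j \<in> dual_space scale"
  shows "tuple_line e e' t j \<in> dual_space scale"
  unfolding tuple_line_def
  using assms subspace_dual by (intro fs.subspace_add fs.subspace_scale)

text \<open>A linear form on the exterior power is linear only on that subspace, so the wedge product is
  expanded inside it, one slot after the other; the first \<open>m\<close> slots move along the line.\<close>

lemma linear_form_on_tuple_line:
  assumes "l0 \<in> linear_forms fscale (dual_exterior_power scale k)"
    and "\<And>j. j < k \<Longrightarrow> e j \<in> dual_space scale" "\<And>j. j < k \<Longrightarrow> e' j \<in> dual_space scale"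
  shows "\<exists>P. \<forall>t. l0 (wedge k (tuple_line e e' t)) = poly P t"
proof -
  interpret L: polynomials_on_subspace fscale "dual_exterior_power scale k"
    by unfold_locales (rule subspace_power)
  have "\<exists>P. \<forall>t. l0 (wedge k (\<lambda>j. if j < m then tuple_line e e' t j else c j)) = poly P t"
    if "m \<le> k" "\<And>j. j < k \<Longrightarrow> c j \<in> dual_space scale" for m c
    using that
  proof (induction m arbitrary: c)
    case 0
    show ?case by (intro exI[of _ "[:l0 (wedge k c):]"]) simp
  next
    case (Suc m)
    have m: "m < k" using Suc.prems by simp
    let ?w = "\<lambda>t z. wedge k (\<lambda>j. if j < m then tuple_line e e' t j else (c(m := z)) j)"
    have dual: "(c(m := z)) j \<in> dual_space scale" if "z \<in> dual_space scale" "j < k" for z j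
      using that Suc.prems(2) by simp
    from Suc.IH[OF less_imp_le_nat[OF m] dual[OF assms(2)[OF m]]]
    obtain P where P: "\<forall>t. l0 (?w t (e m)) = poly P t" ..
    from Suc.IH[OF less_imp_le_nat[OF m] dual[OF assms(3)[OF m]]]
    obtain Q where Q: "\<forall>t. l0 (?w t (e' m)) = poly Q t" ..
    have "l0 (wedge k (\<lambda>j. if j < Suc m then tuple_line e e' t j else c j))
        = poly ([:1, -1:] * P + [:0, 1:] * Q) t" for t
    proof -
      let ?f = "\<lambda>j. if j < m then tuple_line e e' t j else c j"
      have eq: "(\<lambda>j. if j < m then tuple_line e e' t j else (c(m := z)) j) = ?f(m := z)" for z
        by (auto simp: fun_eq_iff)
      have "(\<lambda>j. if j < Suc m then tuple_line e e' t j else c j) = ?f(m := tuple_line e e' t m)"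
        by (auto simp: fun_eq_iff less_Suc_eq)
      then have "wedge k (\<lambda>j. if j < Suc m then tuple_line e e' t j else c j)
          = fscale (1 - t) (?w t (e m)) + fscale t (?w t (e' m))"
        unfolding eq by (simp only: tuple_line_def[of e e' t] wedge_update[OF m])
      moreover have "?w t z \<in> dual_exterior_power scale k" if "z \<in> dual_space scale" for z
        using that assms Suc.prems(2) tuple_line_in_dual by (intro wedge_in_power) auto
      note in_power = this[OF assms(2)[OF m]] this[OF assms(3)[OF m]]
      ultimately have "l0 (wedge k (\<lambda>j. if j < Suc m then tuple_line e e' t j else c j))
          = l0 (fscale (1 - t) (?w t (e m)) + fscale t (?w t (e' m)))" by (simp only:)
      also have "\<dots> = (1 - t) * l0 (?w t (e m)) + t * l0 (?w t (e' m))"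
        using L.linear_formD(1)[OF assms(1) fs.subspace_scale[OF subspace_power in_power(1)]
            fs.subspace_scale[OF subspace_power in_power(2)]]
          L.linear_formD(2)[OF assms(1) in_power(1)] L.linear_formD(2)[OF assms(1) in_power(2)]
        by (simp only:)
      also have "\<dots> = poly ([:1, -1:] * P + [:0, 1:] * Q) t"
        using P Q by (simp add: algebra_simps)
      finally show ?thesis .
    qed
    then show ?case by blast
  qed
  from this[of k e] assms(2) obtain P
    where P: "\<And>t. l0 (wedge k (\<lambda>j. if j < k then tuple_line e e' t j else e j)) = poly P t"
    by auto
  have "wedge k (\<lambda>j. if j < k then tuple_line e e' t j else e j) = wedge k (tuple_line e e' t)" for t
    by (rule wedge_cong) simp
  then show ?thesis using P by metis
qed

lemma hom_poly_on_tuple_line: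
  assumes "q \<in> hom_polys fscale (dual_exterior_power scale k) d"
    and e: "\<And>j. j < k \<Longrightarrow> e j \<in> dual_space scale" "\<And>j. j < k \<Longrightarrow> e' j \<in> dual_space scale"
  shows "\<exists>P. \<forall>t. q (wedge k (tuple_line e e' t)) = poly P t"
proof -
  interpret L: polynomials_on_subspace fscale "dual_exterior_power scale k"
    by unfold_locales (rule subspace_power)
  show ?thesis using assms(1)
  proof (induction rule: L.hom_poly_induct)
    case zero
    show ?case by (intro exI[of _ 0]) simp
  next
    case (step c l q)
    obtain Q where Q: "\<And>t. q (wedge k (tuple_line e e' t)) = poly Q t" using step by blast
    have "\<forall>i<d. \<exists>P. \<forall>t. l i (wedge k (tuple_line e e' t)) = poly P t"
      using linear_form_on_tuple_line[where e = e and e' = e', OF step(1) e] by blast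
    then obtain P where P: "\<And>i t. i < d \<Longrightarrow> l i (wedge k (tuple_line e e' t)) = poly (P i) t"
      by metis
    have "wedge k (tuple_line e e' t) \<in> dual_exterior_power scale k" for t
      using e tuple_line_in_dual by (intro wedge_in_power) auto
    moreover have "(\<Prod>i<d. l i (wedge k (tuple_line e e' t))) = (\<Prod>i<d. poly (P i) t)" for t
      by (intro prod.cong refl P) simp
    ultimately have "(fscale c (restrict_fun (dual_exterior_power scale k) (\<lambda>w. \<Prod>i<d. l i w)) + q)
        (wedge k (tuple_line e e' t)) = poly ([:c:] * (\<Prod>i<d. P i) + Q) t" for t
      by (simp add: fscale_apply restrict_fun_apply Q P poly_prod)
    then show ?case by blast
  qed
qed

lemma eval_linear_form:
  "restrict_fun (dual_exterior_power scale k) (\<lambda>\<omega>. \<omega> v) \<in> linear_forms fscale (dual_exterior_power scale k)"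
  by (rule linear_form_of_linear[OF subspace_power])
    (simp add: linear_functional_iff[OF vector_space_fscale] fscale_apply)

lemma ordered_basis_mem:
  assumes "ordered_basis k e E" "j < k"
  shows "e j \<in> E"
proof -
  have "e j \<in> fs.span (e ` {..<k})" by (rule fs.span_base) (use assms(2) in simp)
  then show ?thesis using assms(1) by (simp add: ordered_basis_def)
qed

lemma span_tuple:
  fixes e :: "nat \<Rightarrow> 'v \<Rightarrow> complex"
  assumes "inj_on e {..<k}"
  shows "x \<in> fs.span (e ` {..<k}) \<longleftrightarrow> (\<exists>c. x = (\<Sum>j<k. fscale (c j) (e j)))"
proof
  assume "x \<in> fs.span (e ` {..<k})"
  then have "x \<in> range (\<lambda>u. \<Sum>y\<in>e ` {..<k}. fscale (u y) y)" by (simp add: fs.span_finite)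
  then obtain u where "x = (\<Sum>y\<in>e ` {..<k}. fscale (u y) y)" by blast
  then have "x = (\<Sum>j<k. fscale (u (e j)) (e j))" by (simp add: sum.reindex[OF assms] o_def)
  then show "\<exists>c. x = (\<Sum>j<k. fscale (c j) (e j))" by (intro exI[of _ "\<lambda>j. u (e j)"])
next
  assume "\<exists>c. x = (\<Sum>j<k. fscale (c j) (e j))"
  then obtain c where x: "x = (\<Sum>j<k. fscale (c j) (e j))" ..
  have "fscale (c j) (e j) \<in> fs.span (e ` {..<k})" if "j \<in> {..<k}" for j
    using that by (intro fs.span_scale) (rule fs.span_base, simp)
  then show "x \<in> fs.span (e ` {..<k})" unfolding x by (rule fs.span_sum)
qed

lemma sum_fscale_apply: "(\<Sum>j\<in>J. fscale (c j) (e j)) x = (\<Sum>j\<in>J. c j * e j x)"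
  by (induction J rule: infinite_finite_induct) (simp_all add: fscale_apply)

text \<open>A linear relation between the \<open>e j\<close> is a vector in the kernel of the matrix \<open>e j (v i)\<close>.\<close>

lemma ordered_basis_of_nonzero_wedge:
  assumes dual: "\<And>j. j < k \<Longrightarrow> e j \<in> dual_space scale" and nz: "wedge k e v \<noteq> 0"
  shows "ordered_basis k e (fs.span (e ` {..<k}))"
    "fs.span (e ` {..<k}) \<in> dual_grassmannian scale k"
proof -
  let ?A = "Matrix.mat k k (\<lambda>(i, j). e j (v i))"
  have A: "?A \<in> carrier_mat k k" by simp
  have zero: "c j = 0" if c: "(\<Sum>j<k. fscale (c j) (e j)) = 0" and j: "j < k" for c j
  proof -
    let ?c = "Matrix.vec k c"
    have "?A *\<^sub>v ?c = 0\<^sub>v k"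
    proof
      fix i assume "i < dim_vec (0\<^sub>v k :: complex Matrix.vec)"
      then have i: "i < k" by simp
      have "vec_index (?A *\<^sub>v ?c) i = (\<Sum>j<k. c j * e j (v i))"
        using i by (simp add: scalar_prod_def atLeast0LessThan mult.commute)
      also have "\<dots> = (\<Sum>j<k. fscale (c j) (e j)) (v i)" by (simp add: sum_fscale_apply)
      finally show "vec_index (?A *\<^sub>v ?c) i = vec_index (0\<^sub>v k) i" using c i by simp
    qed simp
    then have "?c = 0\<^sub>v k"
      using det_0_iff_vec_prod_zero[OF A] nz unfolding wedge_def by (metis vec_carrier)
    then have "vec_index ?c j = 0" using j by simp
    then show ?thesis using j by simp
  qed
  have inj: "inj_on e {..<k}"
  proof
    fix i j assume ij: "i \<in> {..<k}" "j \<in> {..<k}" "e i = e j"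
    show "i = j"
    proof (rule ccontr)
      assume ne: "i \<noteq> j"
      let ?c = "\<lambda>l. (if l = i then 1 else 0) - (if l = j then 1 else 0 :: complex)"
      have "(\<Sum>l<k. fscale (?c l) (e l)) = 0"
        unfolding fun_eq_iff sum_fscale_apply
        using ij by (auto simp: left_diff_distrib sum_subtractf if_distrib[of "\<lambda>a. a * _"] cong: if_cong)
      then have "?c i = 0" by (rule zero) (use ij in auto)
      then show False using ne by simp
    qed
  qed
  have indep: "\<not> fs.dependent (e ` {..<k})"
  proof
    assume "fs.dependent (e ` {..<k})"
    then obtain u where u: "\<exists>v\<in>e ` {..<k}. u v \<noteq> 0" "(\<Sum>v\<in>e ` {..<k}. fscale (u v) v) = 0"
      using fs.dependent_finite[of "e ` {..<k}"] by auto
    then have "(\<Sum>j<k. fscale (u (e j)) (e j)) = 0" by (simp add: sum.reindex[OF inj] o_def)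
    then have "u (e j) = 0" if "j < k" for j using zero that by fastforce
    then show False using u(1) by auto
  qed
  show ob: "ordered_basis k e (fs.span (e ` {..<k}))"
    using inj indep by (simp add: ordered_basis_def)
  have "fs.dim (fs.span (e ` {..<k})) = k"
    using indep inj by (simp add: fs.dim_eq_card_independent card_image)
  moreover have "fs.span (e ` {..<k}) \<subseteq> dual_space scale"
    using dual subspace_dual by (intro fs.span_minimal) auto
  ultimately show "fs.span (e ` {..<k}) \<in> dual_grassmannian scale k"
    by (simp add: dual_grassmannian_def)
qed

text \<open>Subtracting from the last functional its values on the vectors found so far leaves a nonzero
  functional, and hence a vector on which only the last functional is nonzero.\<close>

lemma dual_vectors_exist:
  fixes e :: "nat \<Rightarrow> 'v \<Rightarrow> complex"
  assumes "\<And>j. j < k \<Longrightarrow> e j \<in> dual_space scale"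
    and "\<And>c. (\<Sum>j<k. fscale (c j) (e j)) = 0 \<Longrightarrow> \<forall>j<k. c j = 0"
  shows "\<exists>v. \<forall>i<k. \<forall>j<k. e j (v i) = (if i = j then 1 else 0)"
  using assms
proof (induction k)
  case 0
  then show ?case by simp
next
  case (Suc k)
  have "\<forall>j<k. c j = 0" if "(\<Sum>j<k. fscale (c j) (e j)) = 0" for c
  proof -
    have "(\<Sum>j<Suc k. fscale ((c(k := 0)) j) (e j)) = (\<Sum>j<k. fscale (c j) (e j))"
      by (auto simp: fun_eq_iff fscale_apply intro!: sum.cong)
    then have "\<forall>j<Suc k. (c(k := 0)) j = 0" using that by (intro Suc.prems(2)) simp
    then show ?thesis by (metis fun_upd_other less_SucI less_irrefl)
  qed
  note ind = this
  have "e j \<in> dual_space scale" if "j < k" for j using Suc.prems(1) that by simp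
  from Suc.IH[OF this ind]
  obtain v where v: "\<forall>i<k. \<forall>j<k. e j (v i) = (if i = j then 1 else 0)" ..
  have lin: "Vector_Spaces.linear scale (*) (e j)" if "j < Suc k" for j
    using Suc.prems(1)[OF that] by (simp add: dual_space_def)
  let ?c = "\<lambda>j. if j = k then 1 else - e k (v j)"
  have "(\<Sum>j<Suc k. fscale (?c j) (e j)) \<noteq> 0"
  proof
    assume "(\<Sum>j<Suc k. fscale (?c j) (e j)) = 0"
    then have "\<forall>j<Suc k. ?c j = 0" by (rule Suc.prems(2))
    then have "?c k = 0" by (metis lessI)
    then show False by simp
  qed
  then obtain x where x: "(\<Sum>j<Suc k. fscale (?c j) (e j)) x \<noteq> 0"
    by (auto simp: fun_eq_iff)
  define y where "y = x - (\<Sum>j<k. scale (e j x) (v j))"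
  have ey: "e i y = e i x - (\<Sum>j<k. e j x * e i (v j))" if "i < Suc k" for i
  proof -
    interpret e: Vector_Spaces.linear scale "(*)" "e i" by (rule lin[OF that])
    show ?thesis by (simp add: y_def e.diff e.sum e.scale)
  qed
  have y0: "e i y = 0" if "i < k" for i
  proof -
    have "(\<Sum>j<k. e j x * e i (v j)) = (\<Sum>j<k. if j = i then e i x else 0)"
      using v that by (intro sum.cong) auto
    then show ?thesis using ey[of i] that by simp
  qed
  have "(\<Sum>j<Suc k. fscale (?c j) (e j)) x = e k x - (\<Sum>j<k. e k (v j) * e j x)"
    unfolding sum_fscale_apply by (simp add: sum_negf)
  then have yk: "e k y \<noteq> 0" using x ey[of k] by (simp add: mult.commute)
  define z where "z = scale (1 / e k y) y"
  have z: "e i z = (if i = k then 1 else 0)" if "i < Suc k" for i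
  proof -
    interpret e: Vector_Spaces.linear scale "(*)" "e i" by (rule lin[OF that])
    show ?thesis using y0[of i] yk that by (auto simp: z_def e.scale)
  qed
  let ?v = "\<lambda>i. if i = k then z else v i - scale (e k (v i)) z"
  have "e j (?v i) = (if i = j then 1 else 0)" if "i < Suc k" "j < Suc k" for i j
  proof -
    interpret e: Vector_Spaces.linear scale "(*)" "e j" by (rule lin[OF that(2)])
    show ?thesis
    proof (cases "i = k")
      case True
      then show ?thesis using z[OF that(2)] by auto
    next
      case False
      then have i: "i < k" and eq: "e j (?v i) = e j (v i) - e k (v i) * e j z"
        using that by (simp_all add: e.diff e.scale)
      show ?thesis
      proof (cases "j = k")
        case True
        then show ?thesis using eq z[OF that(2)] False by simp
      next
        case False
        then have j: "j < k" using that(2) by simp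
        have "e j (v i) = (if i = j then 1 else 0)" using v i j by blast
        then show ?thesis unfolding eq using z[OF that(2)] False by simp
      qed
    qed
  qed
  then show ?case by (intro exI[of _ ?v] allI impI)
qed

lemma dual_vectors_of_basis:
  assumes "ordered_basis k e E" "E \<subseteq> dual_space scale"
  obtains v where "\<And>i j. i < k \<Longrightarrow> j < k \<Longrightarrow> e j (v i) = (if i = j then 1 else 0)"
proof -
  have inj: "inj_on e {..<k}" and ind: "fs.independent (e ` {..<k})"
    and E: "fs.span (e ` {..<k}) = E" using assms(1) by (auto simp: ordered_basis_def)
  have dual: "e j \<in> dual_space scale" if "j < k" for j
    using ordered_basis_mem[OF assms(1) that] assms(2) by blast
  have indep: "\<forall>j<k. c j = 0" if "(\<Sum>j<k. fscale (c j) (e j)) = 0" for c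
  proof (intro allI impI)
    fix j assume j: "j < k"
    let ?u = "\<lambda>x. c (the_inv_into {..<k} e x)"
    have "(\<Sum>x\<in>e ` {..<k}. fscale (?u x) x) = (\<Sum>j<k. fscale (c j) (e j))"
      using the_inv_into_f_f[OF inj] by (simp add: sum.reindex[OF inj])
    then have "?u (e j) = 0"
      using fs.independentD[OF ind, where t = "e ` {..<k}" and u = ?u and v = "e j"] that j by simp
    then show "c j = 0" using the_inv_into_f_f[OF inj, of j] j by simp
  qed
  from dual_vectors_exist[OF dual indep]
  obtain v where v: "\<forall>i<k. \<forall>j<k. e j (v i) = (if i = j then 1 else 0)" ..
  show ?thesis by (rule that[of v]) (use v in blast)
qed

lemma wedge_dual_vectors:
  assumes "\<And>i j. i < k \<Longrightarrow> j < k \<Longrightarrow> e j (v i) = (if i = j then 1 else 0)"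
  shows "wedge k e v = 1"
proof -
  have "Matrix.mat k k (\<lambda>(i, j). e j (v i)) = 1\<^sub>m k"
    using assms by (intro eq_matI) auto
  then show ?thesis by (simp add: wedge_def)
qed

lemma wedge_change_basis:
  fixes e e' :: "nat \<Rightarrow> 'v \<Rightarrow> complex"
  assumes "ordered_basis k e E" "ordered_basis k e' E"
  shows "\<exists>c. wedge k e' = fscale c (wedge k e)"
proof -
  have inj: "inj_on e {..<k}" and E: "fs.span (e ` {..<k}) = E" "fs.span (e' ` {..<k}) = E"
    using assms by (auto simp: ordered_basis_def)
  have "\<exists>c. e' j = (\<Sum>l<k. fscale (c l) (e l))" if "j < k" for j
    using ordered_basis_mem[OF assms(2) that] span_tuple[OF inj, of "e' j"] E(1) by simp
  then obtain C where C: "\<And>j. j < k \<Longrightarrow> e' j = (\<Sum>l<k. fscale (C j l) (e l))" by metis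
  let ?C = "Matrix.mat k k (\<lambda>(l, j). C j l)"
  have "wedge k e' v = Determinant.det ?C * wedge k e v" for v
  proof -
    have "Matrix.mat k k (\<lambda>(i, j). e' j (v i)) = Matrix.mat k k (\<lambda>(i, j). e j (v i)) * ?C"
      using C by (intro eq_matI)
        (auto simp: scalar_prod_def sum_fscale_apply atLeast0LessThan mult.commute intro!: sum.cong)
    then show ?thesis unfolding wedge_def
      by (simp add: Determinant.det_mult[of _ k] mult.commute)
  qed
  then show ?thesis by (intro exI[of _ "Determinant.det ?C"]) (auto simp: fun_eq_iff fscale_apply)
qed

text \<open>Another basis multiplies the wedge product by the determinant \<open>c\<close> of the base change, and the
  value of a homogeneous polynomial of degree \<open>d\<close> by \<open>c ^ d\<close>.\<close>

lemma plucker_nonzero_basis_independent: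
  assumes "q \<in> hom_polys fscale (dual_exterior_power scale k) d"
    and "E \<in> plucker_nonzero scale k q" "ordered_basis k e E"
  shows "q (wedge k e) \<noteq> 0"
proof
  interpret L: polynomials_on_subspace fscale "dual_exterior_power scale k"
    by unfold_locales (rule subspace_power)
  assume 0: "q (wedge k e) = 0"
  obtain e' where e': "ordered_basis k e' E" "q (wedge k e') \<noteq> 0" and E: "E \<subseteq> dual_space scale"
    using assms(2) by (auto simp: plucker_nonzero_def dual_grassmannian_def)
  obtain c where c: "wedge k e' = fscale c (wedge k e)"
    using wedge_change_basis[OF assms(3) e'(1)] by blast
  have "e j \<in> dual_space scale" if "j < k" for j
    using ordered_basis_mem[OF assms(3) that] E by blast
  then have "wedge k e \<in> dual_exterior_power scale k" by (rule wedge_in_power)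
  then have "q (wedge k e') = c ^ d * q (wedge k e)"
    unfolding c by (rule L.hom_poly_homogeneous[OF assms(1)])
  then show False using 0 e'(2) by simp
qed

lemma basis_of_grassmannian:
  assumes "E \<in> dual_grassmannian scale k" "0 < k"
  obtains e where "ordered_basis k e E" "\<And>j. j < k \<Longrightarrow> e j \<in> dual_space scale"
proof -
  have sub: "fs.subspace E" and dual: "E \<subseteq> dual_space scale" and dim: "fs.dim E = k"
    using assms by (auto simp: dual_grassmannian_def)
  obtain B where B: "B \<subseteq> E" "fs.independent B" "E \<subseteq> fs.span B" "card B = fs.dim E"
    by (rule fs.basis_exists)
  have "finite B" using B(4) dim assms(2) card.infinite by fastforce
  then obtain e where e: "bij_betw e {..<k} B"
    using B(4) dim ex_bij_betw_nat_finite[of B] by (auto simp: atLeast0LessThan)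
  then have im: "e ` {..<k} = B" and inj: "inj_on e {..<k}" by (auto simp: bij_betw_def)
  have "fs.span B = E" using B sub by (simp add: fs.span_minimal subset_antisym)
  then have "ordered_basis k e E" using im inj B(2) by (simp add: ordered_basis_def)
  moreover have "e j \<in> dual_space scale" if "j < k" for j using im B(1) dual that by blast
  ultimately show ?thesis using that by blast
qed

text \<open>Along a line of tuples that ends in a basis of \<open>E\<close>, each of the finitely many polynomials and the
  wedge product itself, evaluated at vectors dual to that basis, are nonzero polynomials in the
  parameter.\<close>

lemma plucker_nonzero_on_tuple_line:
  assumes fin: "finite \<Q>" and hom: "\<And>q. q \<in> \<Q> \<Longrightarrow> \<exists>d. q \<in> hom_polys fscale (dual_exterior_power scale k) d"
    and E: "\<And>q. q \<in> \<Q> \<Longrightarrow> E \<in> plucker_nonzero scale k q" "ordered_basis k e' E" "E \<subseteq> dual_space scale"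
    and e: "\<And>j. j < k \<Longrightarrow> e j \<in> dual_space scale"
  shows "\<exists>B. finite B \<and> (\<forall>t. t \<notin> B \<longrightarrow>
    ordered_basis k (tuple_line e e' t) (fs.span (tuple_line e e' t ` {..<k})) \<and>
    fs.span (tuple_line e e' t ` {..<k}) \<in> dual_grassmannian scale k \<and>
    (\<forall>q\<in>\<Q>. fs.span (tuple_line e e' t ` {..<k}) \<in> plucker_nonzero scale k q))"
proof -
  interpret L: polynomials_on_subspace fscale "dual_exterior_power scale k"
    by unfold_locales (rule subspace_power)
  have e': "e' j \<in> dual_space scale" if "j < k" for j
    using ordered_basis_mem[OF E(2) that] E(3) by blast
  obtain v where v: "\<And>i j. i < k \<Longrightarrow> j < k \<Longrightarrow> e' j (v i) = (if i = j then 1 else 0)"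
    using dual_vectors_of_basis[OF E(2,3)] by metis
  \<comment> \<open>That \<open>ev\<close> is nonzero ensures that the tuple is linearly independent, also when all the other
    polynomials are constant.\<close>
  define ev where "ev = restrict_fun (dual_exterior_power scale k) (\<lambda>\<omega>. \<omega> v)"
  have ev: "ev \<in> hom_polys fscale (dual_exterior_power scale k) 1"
    unfolding ev_def by (rule L.hom_poly_of_linear_form[OF eval_linear_form])
  have in_power: "wedge k (tuple_line e e' t) \<in> dual_exterior_power scale k" for t
    using e e' tuple_line_in_dual by (intro wedge_in_power) auto
  have at1: "tuple_line e e' 1 = e'" by (simp add: tuple_line_def fun_eq_iff fscale_apply)
  let ?Q = "insert ev \<Q>"
  have "\<exists>P. P \<noteq> 0 \<and> (\<forall>t. q (wedge k (tuple_line e e' t)) = poly P t)" if q: "q \<in> ?Q" for q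
  proof -
    obtain d where d: "q \<in> hom_polys fscale (dual_exterior_power scale k) d" using q hom ev by blast
    obtain P where P: "\<And>t. q (wedge k (tuple_line e e' t)) = poly P t"
      using hom_poly_on_tuple_line[where e = e and e' = e', OF d e e'] by blast
    have "q (wedge k e') \<noteq> 0"
    proof (cases "q \<in> \<Q>")
      case True
      then show ?thesis using plucker_nonzero_basis_independent[OF d E(1) E(2)] by blast
    next
      case False
      then show ?thesis
        using q wedge_dual_vectors[of k e' v, OF v] in_power[of 1] by (auto simp: ev_def restrict_fun_apply at1)
    qed
    then have "P \<noteq> 0" using P[of 1] by (auto simp: at1)
    then show ?thesis using P by blast
  qed
  then obtain P where P: "\<And>q. q \<in> ?Q \<Longrightarrow> P q \<noteq> 0"
    "\<And>q t. q \<in> ?Q \<Longrightarrow> q (wedge k (tuple_line e e' t)) = poly (P q) t" by metis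
  define B where "B = (\<Union>q\<in>?Q. {t. poly (P q) t = 0})"
  have "finite B" unfolding B_def using fin P(1) by (auto intro: poly_roots_finite)
  moreover have "ordered_basis k (tuple_line e e' t) (fs.span (tuple_line e e' t ` {..<k})) \<and>
      fs.span (tuple_line e e' t ` {..<k}) \<in> dual_grassmannian scale k \<and>
      (\<forall>q\<in>\<Q>. fs.span (tuple_line e e' t ` {..<k}) \<in> plucker_nonzero scale k q)"
    if t: "t \<notin> B" for t
  proof -
    have nz: "q (wedge k (tuple_line e e' t)) \<noteq> 0" if "q \<in> ?Q" for q
      using t P(2)[OF that] that by (auto simp: B_def)
    have "wedge k (tuple_line e e' t) v \<noteq> 0"
      using nz[of ev] in_power[of t] by (simp add: ev_def restrict_fun_apply)
    note ob = ordered_basis_of_nonzero_wedge[OF tuple_line_in_dual[OF e e'] this]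
    then show ?thesis using nz by (auto simp: plucker_nonzero_def)
  qed
  ultimately show ?thesis by blast
qed

lemma zariski_open_contains_basic:
  assumes "openin (zariski_grassmannian scale k) U" "E \<in> U"
  obtains \<Q> where "finite \<Q>"
    "\<And>q. q \<in> \<Q> \<Longrightarrow> \<exists>d. q \<in> hom_polys fscale (dual_exterior_power scale k) d"
    "\<And>q. q \<in> \<Q> \<Longrightarrow> E \<in> plucker_nonzero scale k q"
    "\<And>E'. E' \<in> dual_grassmannian scale k \<Longrightarrow> (\<And>q. q \<in> \<Q> \<Longrightarrow> E' \<in> plucker_nonzero scale k q) \<Longrightarrow> E' \<in> U"
proof -
  let ?S = "{plucker_nonzero scale k p | p d. p \<in> hom_polys fscale (dual_exterior_power scale k) d}"
  have "generate_topology_on ?S U"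
    using assms(1) openin_topology_generated_by by (auto simp: zariski_grassmannian_def)
  then have "\<exists>\<Q>. finite \<Q> \<and> (\<forall>q\<in>\<Q>. \<exists>d. q \<in> hom_polys fscale (dual_exterior_power scale k) d) \<and>
      (\<forall>q\<in>\<Q>. E \<in> plucker_nonzero scale k q) \<and>
      (\<forall>E'\<in>dual_grassmannian scale k. (\<forall>q\<in>\<Q>. E' \<in> plucker_nonzero scale k q) \<longrightarrow> E' \<in> U)"
    using assms(2)
  proof (induction rule: generate_topology_on.induct)
    case Empty
    then show ?case by simp
  next
    case (Int a b)
    have ab: "E \<in> a" "E \<in> b" using Int.prems by auto
    from Int.IH(1)[OF ab(1)] obtain \<Q>1 where
      1: "finite \<Q>1 \<and> (\<forall>q\<in>\<Q>1. \<exists>d. q \<in> hom_polys fscale (dual_exterior_power scale k) d) \<and>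
      (\<forall>q\<in>\<Q>1. E \<in> plucker_nonzero scale k q) \<and>
      (\<forall>E'\<in>dual_grassmannian scale k. (\<forall>q\<in>\<Q>1. E' \<in> plucker_nonzero scale k q) \<longrightarrow> E' \<in> a)" ..
    from Int.IH(2)[OF ab(2)] obtain \<Q>2 where
      2: "finite \<Q>2 \<and> (\<forall>q\<in>\<Q>2. \<exists>d. q \<in> hom_polys fscale (dual_exterior_power scale k) d) \<and>
      (\<forall>q\<in>\<Q>2. E \<in> plucker_nonzero scale k q) \<and>
      (\<forall>E'\<in>dual_grassmannian scale k. (\<forall>q\<in>\<Q>2. E' \<in> plucker_nonzero scale k q) \<longrightarrow> E' \<in> b)" ..
    show ?case by (rule exI[of _ "\<Q>1 \<union> \<Q>2"]) (use 1 2 in auto)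
  next
    case (UN K)
    then obtain a where "a \<in> K" "E \<in> a" by blast
    from UN.IH[OF this] obtain \<Q> where
      1: "finite \<Q> \<and> (\<forall>q\<in>\<Q>. \<exists>d. q \<in> hom_polys fscale (dual_exterior_power scale k) d) \<and>
      (\<forall>q\<in>\<Q>. E \<in> plucker_nonzero scale k q) \<and>
      (\<forall>E'\<in>dual_grassmannian scale k. (\<forall>q\<in>\<Q>. E' \<in> plucker_nonzero scale k q) \<longrightarrow> E' \<in> a)" ..
    show ?case by (rule exI[of _ \<Q>]) (use 1 \<open>a \<in> K\<close> in auto)
  next
    case (Basis s)
    then obtain p d where p: "s = plucker_nonzero scale k p"
      "p \<in> hom_polys fscale (dual_exterior_power scale k) d" by blast
    show ?case by (rule exI[of _ "{p}"]) (use p Basis(2) in auto)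
  qed
  then show ?thesis using that by metis
qed

text \<open>The Grassmannian is irreducible: between a point \<open>E0\<close> of an arbitrary open set and a point \<open>E1\<close> of the
  given one there is a line of tuples of which all but finitely many members lie in both sets.\<close>

theorem for_generic_of_nonempty_plucker:
  assumes k: "0 < k" and p: "p \<in> hom_polys fscale (dual_exterior_power scale k) d"
    and ne: "plucker_nonzero scale k p \<noteq> {}"
    and imp: "\<And>E. E \<in> plucker_nonzero scale k p \<Longrightarrow> Pr E"
  shows "for_generic_subspace scale k Pr"
  unfolding for_generic_subspace_def
proof (intro exI conjI ballI)
  let ?Z = "zariski_grassmannian scale k" and ?U = "plucker_nonzero scale k p"
  show op: "openin ?Z ?U"
    unfolding zariski_grassmannian_def openin_topology_generated_by_iff
    using p by (intro generate_topology_on.Basis) blast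
  show "?Z closure_of ?U = topspace ?Z"
  proof (rule subset_antisym[OF closure_of_subset_topspace], rule subsetI)
    fix E0 assume E0: "E0 \<in> topspace ?Z"
    then have G0: "E0 \<in> dual_grassmannian scale k" using topspace_zariski_grassmannian[OF k] by blast
    obtain E1 where E1: "E1 \<in> ?U" using ne by blast
    then have G1: "E1 \<in> dual_grassmannian scale k" by (simp add: plucker_nonzero_def)
    obtain e0 where e0: "ordered_basis k e0 E0" "\<And>j. j < k \<Longrightarrow> e0 j \<in> dual_space scale"
      using basis_of_grassmannian[OF G0 k] by metis
    obtain e1 where e1: "ordered_basis k e1 E1" "\<And>j. j < k \<Longrightarrow> e1 j \<in> dual_space scale"
      using basis_of_grassmannian[OF G1 k] by metis
    have dual: "E0 \<subseteq> dual_space scale" "E1 \<subseteq> dual_space scale"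
      using G0 G1 by (auto simp: dual_grassmannian_def)
    have "\<exists>E\<in>?U. E \<in> T" if T: "E0 \<in> T" "openin ?Z T" for T
    proof -
      obtain \<Q> where \<Q>: "finite \<Q>"
        "\<And>q. q \<in> \<Q> \<Longrightarrow> \<exists>d. q \<in> hom_polys fscale (dual_exterior_power scale k) d"
        "\<And>q. q \<in> \<Q> \<Longrightarrow> E0 \<in> plucker_nonzero scale k q"
        "\<And>E'. E' \<in> dual_grassmannian scale k \<Longrightarrow> (\<And>q. q \<in> \<Q> \<Longrightarrow> E' \<in> plucker_nonzero scale k q) \<Longrightarrow> E' \<in> T"
        using zariski_open_contains_basic[OF T(2,1)] by metis
      from plucker_nonzero_on_tuple_line[OF \<Q>(1,2,3) e0(1) dual(1) e1(2)]
      obtain B0 where B0: "finite B0 \<and> (\<forall>t. t \<notin> B0 \<longrightarrow>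
        ordered_basis k (tuple_line e1 e0 t) (fs.span (tuple_line e1 e0 t ` {..<k})) \<and>
        fs.span (tuple_line e1 e0 t ` {..<k}) \<in> dual_grassmannian scale k \<and>
        (\<forall>q\<in>\<Q>. fs.span (tuple_line e1 e0 t ` {..<k}) \<in> plucker_nonzero scale k q))" ..
      have p1: "finite {p}" "\<And>q. q \<in> {p} \<Longrightarrow> \<exists>d. q \<in> hom_polys fscale (dual_exterior_power scale k) d"
        "\<And>q. q \<in> {p} \<Longrightarrow> E1 \<in> plucker_nonzero scale k q" using p E1 by auto
      from plucker_nonzero_on_tuple_line[OF p1 e1(1) dual(2) e0(2)]
      obtain B1 where B1: "finite B1 \<and> (\<forall>t. t \<notin> B1 \<longrightarrow>
        ordered_basis k (tuple_line e0 e1 t) (fs.span (tuple_line e0 e1 t ` {..<k})) \<and>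
        fs.span (tuple_line e0 e1 t ` {..<k}) \<in> dual_grassmannian scale k \<and>
        (\<forall>q\<in>{p}. fs.span (tuple_line e0 e1 t ` {..<k}) \<in> plucker_nonzero scale k q))" ..
      have "finite (B1 \<union> (\<lambda>t. 1 - t) ` B0)" using B0 B1 by simp
      then obtain t where t: "t \<notin> B1" "t \<notin> (\<lambda>t. 1 - t) ` B0"
        using infinite_UNIV_char_0[where 'a = complex] by (metis UNIV_eq_I UnI1 UnI2)
      have "1 - t \<notin> B0" using t(2) by (metis diff_diff_eq2 add_diff_cancel_left' imageI)
      then have "fs.span (tuple_line e1 e0 (1 - t) ` {..<k}) \<in> T"
        using \<Q>(4) B0 by simp
      then have "fs.span (tuple_line e0 e1 t ` {..<k}) \<in> T"
        unfolding tuple_line_swap[of e0 e1 t] .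
      moreover have "fs.span (tuple_line e0 e1 t ` {..<k}) \<in> ?U" using B1 t(1) by simp
      ultimately show ?thesis by blast
    qed
    then show "E0 \<in> ?Z closure_of ?U" using E0 by (auto simp: in_closure_of)
  qed
qed (rule imp)

end

section \<open>Slice rank of generic restrictions\<close>

context polynomials_on_subspace
begin

text \<open>Homogeneity of a function that is defined on the whole space and need not vanish outside \<open>W\<close>.\<close>

definition hom_on :: "nat \<Rightarrow> ('w \<Rightarrow> complex) \<Rightarrow> bool" where
  "hom_on d F \<longleftrightarrow> restrict_fun W F \<in> hom_polys s W d"

lemma hom_on_cmult: "hom_on d F \<Longrightarrow> hom_on d (\<lambda>x. c * F x)"
  and hom_on_add: "hom_on d F \<Longrightarrow> hom_on d G \<Longrightarrow> hom_on d (\<lambda>x. F x + G x)"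
  and hom_on_diff: "hom_on d F \<Longrightarrow> hom_on d G \<Longrightarrow> hom_on d (\<lambda>x. F x - G x)"
  and hom_on_mult: "hom_on d F \<Longrightarrow> hom_on e G \<Longrightarrow> hom_on (d + e) (\<lambda>x. F x * G x)"
  and hom_on_zero: "hom_on d (\<lambda>x. 0)"
  and hom_on_const: "hom_on 0 (\<lambda>x. c)"
proof -
  have eqs: "restrict_fun W (\<lambda>x. c * F x) = fscale c (restrict_fun W F)"
    "restrict_fun W (\<lambda>x. F x + G x) = restrict_fun W F + restrict_fun W G"
    "restrict_fun W (\<lambda>x. F x - G x) = restrict_fun W F - restrict_fun W G"
    "restrict_fun W (\<lambda>x. F x * G x) = restrict_fun W F * restrict_fun W G"
    "restrict_fun W (\<lambda>x. 0) = 0"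
    by (auto simp: fun_eq_iff restrict_fun_apply fscale_apply)
  show "hom_on d F \<Longrightarrow> hom_on d (\<lambda>x. c * F x)"
    unfolding hom_on_def eqs(1) by (rule hom_poly_scale)
  show "hom_on d F \<Longrightarrow> hom_on d G \<Longrightarrow> hom_on d (\<lambda>x. F x + G x)"
    unfolding hom_on_def eqs(2) by (rule hom_poly_add)
  show "hom_on d F \<Longrightarrow> hom_on d G \<Longrightarrow> hom_on d (\<lambda>x. F x - G x)"
    unfolding hom_on_def eqs(3) by (rule hom_poly_diff)
  show "hom_on d F \<Longrightarrow> hom_on e G \<Longrightarrow> hom_on (d + e) (\<lambda>x. F x * G x)"
    unfolding hom_on_def eqs(4) by (rule hom_poly_mult)
  show "hom_on d (\<lambda>x. 0)" unfolding hom_on_def eqs(5) by (rule hom_poly_zero)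
  show "hom_on 0 (\<lambda>x. c)" unfolding hom_on_def by (rule hom_poly_const)
qed

lemma hom_on_sum: "(\<And>i. i \<in> I \<Longrightarrow> hom_on d (F i)) \<Longrightarrow> hom_on d (\<lambda>x. \<Sum>i\<in>I. F i x)"
  by (induction I rule: infinite_finite_induct) (simp_all add: hom_on_zero hom_on_add)

lemma hom_on_prod:
  fixes n :: nat
  shows "(\<And>i. i < n \<Longrightarrow> hom_on (d i) (F i)) \<Longrightarrow> hom_on (\<Sum>i<n. d i) (\<lambda>x. \<Prod>i<n. F i x)"
  by (induction n) (simp_all add: hom_on_const hom_on_mult)

lemma hom_on_det:
  assumes "\<And>i j. i < n \<Longrightarrow> j < n \<Longrightarrow> hom_on (d i) (\<lambda>x. A x i j)"
  shows "hom_on (\<Sum>i<n. d i) (\<lambda>x. Determinant.det (Matrix.mat n n (\<lambda>(i, j). A x i j)))"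
proof -
  have "Determinant.det (Matrix.mat n n (\<lambda>(i, j). A x i j))
      = (\<Sum>p\<in>{p. p permutes {0..<n}}. signof p * (\<Prod>i<n. A x i (p i)))" for x
  proof -
    have "(\<Prod>i = 0..<n. Matrix.mat n n (\<lambda>(i, j). A x i j) $$ (i, p i)) = (\<Prod>i<n. A x i (p i))"
      if "p permutes {0..<n}" for p
    proof (unfold atLeast0LessThan, intro prod.cong refl)
      fix i assume "i \<in> {..<n}"
      then have "i < n" "p i < n" using permutes_in_image[OF that, of i] by auto
      then show "Matrix.mat n n (\<lambda>(i, j). A x i j) $$ (i, p i) = A x i (p i)" by simp
    qed
    then show ?thesis by (subst det_def'[of _ n]) (auto intro!: sum.cong)
  qed
  moreover have "hom_on (\<Sum>i<n. d i) (\<lambda>x. \<Sum>p\<in>{p. p permutes {0..<n}}. signof p * (\<Prod>i<n. A x i (p i)))"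
  proof (intro hom_on_sum hom_on_cmult hom_on_prod assms)
    fix p i assume "p \<in> {p. p permutes {0..<n}}" "i < n"
    then show "p i < n" using permutes_in_image[of p "{0..<n}" i] by auto
  qed
  ultimately show ?thesis by simp
qed

definition coeffs_hom_on :: "nat \<Rightarrow> ('w \<Rightarrow> complex poly) \<Rightarrow> bool" where
  "coeffs_hom_on d P \<longleftrightarrow> (\<forall>i. hom_on d (\<lambda>x. Polynomial.coeff (P x) i))"

lemma coeffs_hom_on_0: "coeffs_hom_on d (\<lambda>x. 0)"
  by (simp add: coeffs_hom_on_def hom_on_zero)

lemma coeffs_hom_on_pCons:
  assumes "hom_on d a" "coeffs_hom_on d P"
  shows "coeffs_hom_on d (\<lambda>x. pCons (a x) (P x))"
  unfolding coeffs_hom_on_def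
proof
  fix i show "hom_on d (\<lambda>x. Polynomial.coeff (pCons (a x) (P x)) i)"
    using assms by (cases i) (auto simp: coeffs_hom_on_def)
qed

lemma coeffs_hom_on_add: "coeffs_hom_on d P \<Longrightarrow> coeffs_hom_on d Q \<Longrightarrow> coeffs_hom_on d (\<lambda>x. P x + Q x)"
  and coeffs_hom_on_diff: "coeffs_hom_on d P \<Longrightarrow> coeffs_hom_on d Q \<Longrightarrow> coeffs_hom_on d (\<lambda>x. P x - Q x)"
  and coeffs_hom_on_mult: "coeffs_hom_on d P \<Longrightarrow> coeffs_hom_on e Q \<Longrightarrow> coeffs_hom_on (d + e) (\<lambda>x. P x * Q x)"
  and coeffs_hom_on_smult: "hom_on d a \<Longrightarrow> coeffs_hom_on e Q \<Longrightarrow>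
    coeffs_hom_on (d + e) (\<lambda>x. Polynomial.smult (a x) (Q x))"
  by (simp_all add: coeffs_hom_on_def hom_on_add hom_on_diff hom_on_mult coeff_mult hom_on_sum)

lemma coeffs_hom_on_monom_mult:
  assumes "coeffs_hom_on d P"
  shows "coeffs_hom_on d (\<lambda>x. Polynomial.monom 1 n * P x)"
  unfolding coeffs_hom_on_def
proof
  fix i show "hom_on d (\<lambda>x. Polynomial.coeff (Polynomial.monom 1 n * P x) i)"
    using assms by (cases "n \<le> i") (auto simp: coeffs_hom_on_def coeff_monom_mult hom_on_zero)
qed

end

locale dual_cubic = dual_identification scale Basis
  for scale :: "complex \<Rightarrow> 'v::ab_group_add \<Rightarrow> 'v" and Basis :: "'v set" +
  fixes f :: "('v \<Rightarrow> complex) \<Rightarrow> complex" and \<phi> :: "'v \<Rightarrow> 'v \<Rightarrow> 'v \<Rightarrow> complex"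
  assumes f_cubic: "f \<in> hom_polys fscale (dual_space scale) 3"
    and trilinear: "trilinear scale \<phi>"
    and sym12: "\<phi> x y z = \<phi> y x z" and sym23: "\<phi> x y z = \<phi> x z y"
    and f_to_dual: "f (to_dual x) = \<phi> x x x"
begin

sublocale cubic_form scale Basis \<phi>
  by unfold_locales (rule sym12 sym23 trilinear_add1[OF trilinear] trilinear_scale1[OF trilinear])+

lemma isotropic_iff: "isotropic L \<longleftrightarrow> subspace L \<and> (\<forall>x\<in>L. f (to_dual x) = 0)"
  by (simp add: isotropic_def f_to_dual)

lemma polynomial_along_line:
  assumes "c \<in> fs.span (\<Union>d. hom_polys fscale (dual_space scale) d)" "x \<in> dual_space scale"
  shows "\<exists>P. \<forall>t. c (fscale t x) = poly P t"
  using assms(1)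
proof (induction rule: fs.span_induct_alt)
  case base
  show ?case by (intro exI[of _ 0]) simp
next
  case (step a g h)
  interpret P: polynomials_on_subspace fscale "dual_space scale" by unfold_locales (rule subspace_dual)
  obtain d where d: "g \<in> hom_polys fscale (dual_space scale) d" using step(1) by blast
  obtain Q where Q: "\<forall>t. h (fscale t x) = poly Q t" using step(2) by blast
  have "(fscale a g + h) (fscale t x) = poly (Polynomial.monom (a * g x) d + Q) t" for t
    using P.hom_poly_homogeneous[OF d assms(2)] Q by (simp add: fscale_apply poly_monom algebra_simps)
  then show ?case by blast
qed

text \<open>A linear form \<open>m\<close> with \<open>f = m h\<close> would be a proper factor of \<open>f\<close> without being a unit: elements
  that vanish at zero are not units, and if \<open>f\<close> divided \<open>m\<close>, then \<open>m\<close>, which has order one at zero along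
  some line, would be a multiple of \<open>f\<close>, whose order is three.\<close>

lemma no_linear_factor:
  assumes irr: "ring_irreducible\<^bsub>poly_ring fscale (dual_space scale)\<^esub> f"
    and l: "Vector_Spaces.linear scale (*) l"
  shows "\<exists>x. l x = 0 \<and> \<phi> x x x \<noteq> 0"
proof (rule ccontr)
  assume none: "\<nexists>x. l x = 0 \<and> \<phi> x x x \<noteq> 0"
  let ?W = "dual_space scale" and ?R = "poly_ring fscale (dual_space scale)"
  interpret P: polynomials_on_subspace fscale ?W by unfold_locales (rule subspace_dual)
  have "slice_rank fscale ?W 3 (restrict_fun ?W f) \<le> 1"
    unfolding slice_rank_restrict_le_iff[OF f_cubic subspace_dual order_refl]
    using l none by (intro exI[of _ "\<lambda>_. l"]) (auto simp: f_to_dual)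
  then have "P.slices 1 f"
    using P.slice_rank_le_iff_slices[OF f_cubic] restrict_dual_self[OF f_cubic] by simp
  then obtain m h where m: "m \<in> hom_polys fscale ?W 1" and h: "h \<in> hom_polys fscale ?W 2"
    and f: "f = m * h" by (auto simp: P.slices_def)
  have f0: "f \<noteq> 0" and irr': "irreducible ?R f"
    using irr by (auto simp: ring_irreducible_def poly_ring_def)
  have zW: "0 \<in> ?W" using subspace_dual by (rule fs.subspace_0)
  have not_unit: "g \<notin> Units ?R" if "g 0 = 0" for g
  proof
    assume "g \<in> Units ?R"
    then obtain g' where "g' * g = restrict_fun ?W (\<lambda>_. 1)" by (auto simp: Units_def poly_ring_def)
    then have "(g' * g) 0 = 1" using zW by (simp add: restrict_fun_apply)
    then show False using that by simp
  qed
  have carr: "m \<in> carrier ?R" "h \<in> carrier ?R"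
    using m h by (auto simp: poly_ring_def intro!: fs.span_base)
  have "m \<notin> Units ?R" using not_unit P.hom_poly_at_0[OF m] by simp
  then have "\<not> properfactor ?R m f" using irr' carr by (auto simp: irreducible_def)
  moreover have "m divides\<^bsub>?R\<^esub> f"
    using carr f by (auto simp: factor_def poly_ring_def)
  ultimately have "f divides\<^bsub>?R\<^esub> m" by (auto simp: properfactor_def)
  then obtain c where c: "c \<in> carrier ?R" "m = f * c" by (auto simp: factor_def poly_ring_def)
  obtain x where x: "f x \<noteq> 0" using f0 by (auto simp: fun_eq_iff)
  then have xW: "x \<in> ?W" using P.hom_poly_outside[OF f_cubic] by blast
  have mx: "m x \<noteq> 0" using x f by auto
  obtain Q where Q: "\<And>t. c (fscale t x) = poly Q t"
    using polynomial_along_line[OF _ xW] c(1) by (auto simp: poly_ring_def)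
  have "[:0, 0, f x:] * Q - [:m x:] = 0"
  proof (rule poly_zero_off_0)
    fix t :: complex assume t: "t \<noteq> 0"
    have "m (fscale t x) = f (fscale t x) * c (fscale t x)" using c(2) by simp
    then have "t * m x = t ^ 3 * f x * poly Q t"
      using P.hom_poly_homogeneous[OF m xW, of t] P.hom_poly_homogeneous[OF f_cubic xW, of t] Q by simp
    then have "m x = t ^ 2 * f x * poly Q t"
      using t by (simp add: power2_eq_square power3_eq_cube)
    then show "poly ([:0, 0, f x:] * Q - [:m x:]) t = 0"
      by (simp add: power2_eq_square algebra_simps)
  qed
  then have "poly ([:0, 0, f x:] * Q - [:m x:]) 0 = 0" by (simp only: poly_0)
  then show False using mx by simp
qed

text \<open>For \<open>\<omega> = e\<^sub>0 \<and> \<dots> \<and> e\<^sub>k\<^sub>-\<^sub>1\<close> this functional lies in the span of the \<open>e j\<close>. So it produces elements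
  of a subspace that are linear in its Pluecker coordinates.\<close>

definition contraction :: "(nat \<Rightarrow> 'v) \<Rightarrow> nat \<Rightarrow> ((nat \<Rightarrow> 'v) \<Rightarrow> complex) \<Rightarrow> 'v \<Rightarrow> complex" where
  "contraction v i \<omega> = (\<lambda>x. \<omega> (v(i := x)))"

text \<open>A fixed linear combination of contractions, as an element of the original space.\<close>

definition combine :: "nat \<Rightarrow> (nat \<Rightarrow> 'v) \<Rightarrow> (nat \<Rightarrow> complex) \<Rightarrow> ((nat \<Rightarrow> 'v) \<Rightarrow> complex) \<Rightarrow> 'v" where
  "combine k v c \<omega> = (\<Sum>i<k. scale (c i) (from_dual (contraction v i \<omega>)))"

text \<open>Laplace expansion along row \<open>i\<close>, whose cofactors do not involve the argument \<open>x\<close>.\<close>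

lemma contraction_wedge:
  assumes "i < k"
  shows "\<exists>c. contraction v i (wedge k e) = (\<Sum>j<k. fscale (c j) (e j))"
proof -
  let ?A = "\<lambda>x. Matrix.mat k k (\<lambda>(a, j). e j ((v(i := x)) a))"
  have "contraction v i (wedge k e) x = (\<Sum>j<k. cofactor (?A 0) i j * e j x)" for x
  proof -
    have "contraction v i (wedge k e) x = (\<Sum>j<k. ?A x $$ (i, j) * cofactor (?A x) i j)"
      unfolding contraction_def wedge_def by (rule laplace_expansion_row) (use assms in auto)
    also have "\<dots> = (\<Sum>j<k. cofactor (?A 0) i j * e j x)"
    proof (intro sum.cong refl)
      fix j assume j: "j \<in> {..<k}"
      have "mat_delete (?A x) i j = mat_delete (?A 0) i j"
        unfolding mat_delete_def by (intro eq_matI) auto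
      then show "?A x $$ (i, j) * cofactor (?A x) i j = cofactor (?A 0) i j * e j x"
        using j assms by (simp add: cofactor_def mult.commute)
    qed
    finally show ?thesis .
  qed
  then show ?thesis
    by (intro exI[of _ "\<lambda>j. cofactor (?A 0) i j"]) (auto simp: fun_eq_iff sum_fscale_apply)
qed

lemma combine_wedge_in:
  assumes E: "fs.subspace E" "E \<subseteq> dual_space scale" "\<And>j. j < k \<Longrightarrow> e j \<in> E"
  shows "to_dual (combine k v c (wedge k e)) \<in> E"
proof -
  interpret T: Vector_Spaces.linear scale fscale to_dual by (rule linear_to_dual)
  have "contraction v i (wedge k e) \<in> E" if i: "i < k" for i
  proof -
    obtain c where c: "contraction v i (wedge k e) = (\<Sum>j<k. fscale (c j) (e j))"
      using contraction_wedge[OF i] by blast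
    show ?thesis unfolding c
      using E(1,3) by (intro fs.subspace_sum fs.subspace_scale) auto
  qed
  then have "to_dual (from_dual (contraction v i (wedge k e))) \<in> E" if "i < k" for i
    using that E(2) to_dual_from_dual by (metis subsetD)
  then show ?thesis unfolding combine_def T.sum T.scale
    by (intro fs.subspace_sum[OF E(1)] fs.subspace_scale[OF E(1)]) simp
qed

text \<open>With vectors \<open>v\<close> dual to the basis \<open>e\<close> the contractions return the basis itself, so that every
  element of the span is attained by a suitable choice of coefficients.\<close>

lemma combine_wedge_dual_basis:
  assumes e: "\<And>j. j < k \<Longrightarrow> e j \<in> dual_space scale"
    and v: "\<And>i j. i < k \<Longrightarrow> j < k \<Longrightarrow> e j (v i) = (if i = j then 1 else 0)"
  shows "combine k v c (wedge k e) = (\<Sum>i<k. scale (c i) (from_dual (e i)))"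
proof -
  have "contraction v i (wedge k e) = e i" if i: "i < k" for i
  proof
    fix x
    obtain c where c: "contraction v i (wedge k e) = (\<Sum>j<k. fscale (c j) (e j))"
      using contraction_wedge[OF i] by blast
    have val: "contraction v i (wedge k e) (v j) = (if j = i then 1 else 0)" if j: "j < k" for j
    proof (cases "j = i")
      case True
      have "v(i := v j) = v" using True by auto
      then show ?thesis using wedge_dual_vectors[of k e v, OF v] True by (simp add: contraction_def)
    next
      case False
      let ?B = "Matrix.mat k k (\<lambda>(a, l). e l ((v(i := v j)) a))"
      have "Determinant.det ?B = 0"
        by (rule det_identical_rows[of ?B k i j]) (use i j False in \<open>auto simp: Matrix.row_def\<close>)
      then show ?thesis using False by (simp add: contraction_def wedge_def)
    qed
    have "c j = (if j = i then 1 else 0)" if j: "j < k" for j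
    proof -
      have "contraction v i (wedge k e) (v j) = (\<Sum>l<k. c l * e l (v j))"
        unfolding c sum_fscale_apply ..
      also have "\<dots> = (\<Sum>l<k. if l = j then c j else 0)"
        using v j by (intro sum.cong) auto
      also have "\<dots> = c j" using j by simp
      finally show ?thesis using val[OF j] by simp
    qed
    then have "(\<Sum>j<k. c j * e j x) = (\<Sum>j<k. if j = i then e i x else 0)"
      by (intro sum.cong) auto
    then show "contraction v i (wedge k e) x = e i x"
      unfolding c sum_fscale_apply using i by simp
  qed
  then show ?thesis by (simp add: combine_def)
qed

definition generic_form :: "nat \<Rightarrow> (nat \<Rightarrow> 'v) \<Rightarrow> (nat \<Rightarrow> complex) \<Rightarrow> (nat \<Rightarrow> complex) \<Rightarrow> (nat \<Rightarrow> complex) \<Rightarrow>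
    ((nat \<Rightarrow> 'v) \<Rightarrow> complex) \<Rightarrow> complex" where
  "generic_form k v a b c = restrict_fun (dual_exterior_power scale k)
     (\<lambda>\<omega>. eliminant (combine k v a \<omega>) (combine k v b \<omega>) (combine k v c \<omega>))"

lemma linear_combine:
  assumes "Vector_Spaces.linear scale (*) a"
  shows "restrict_fun (dual_exterior_power scale k) (\<lambda>\<omega>. a (combine k v c \<omega>))
    \<in> linear_forms fscale (dual_exterior_power scale k)"
proof (rule linear_form_of_linear[OF subspace_power])
  interpret a: Vector_Spaces.linear scale "(*)" a by fact
  interpret U: Vector_Spaces.linear fscale scale from_dual by (rule linear_from_dual)
  have "contraction v i (\<omega> + \<omega>') = contraction v i \<omega> + contraction v i \<omega>'"
    "contraction v i (fscale t \<omega>) = fscale t (contraction v i \<omega>)" for i \<omega> \<omega>' t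
    by (auto simp: contraction_def fscale_apply fun_eq_iff)
  then show "Vector_Spaces.linear fscale (*) (\<lambda>\<omega>. a (combine k v c \<omega>))"
    by (simp add: linear_functional_iff[OF vector_space_fscale] combine_def a.sum a.scale U.add U.scale
        a.add sum.distrib sum_distrib_left algebra_simps)
qed

text \<open>The cubic and its polar values have degree \<open>3\<close>, and the coefficients of the tangent polynomial
  degree \<open>12\<close>. The rows of the Sylvester matrix are homogeneous of these degrees.\<close>

lemma generic_form_hom_poly:
  "\<exists>d. generic_form k v a b c \<in> hom_polys fscale (dual_exterior_power scale k) d"
proof -
  let ?L = "dual_exterior_power scale k"
  interpret L: polynomials_on_subspace fscale ?L by unfold_locales (rule subspace_power)
  let ?p = "combine k v a" and ?q = "combine k v b" and ?r = "combine k v c"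
  have base: "L.hom_on 3 (\<lambda>\<omega>. \<phi> (combine k v a' \<omega>) (combine k v b' \<omega>) (combine k v c' \<omega>))" for a' b' c'
    unfolding L.hom_on_def
    by (rule trilinear_pullback[OF L.polynomials_on_subspace_axioms _ _ _ _ trilinear, of "range (combine k v)"])
      (auto intro: linear_combine)
  have line: "L.coeffs_hom_on 3 (\<lambda>\<omega>. line_poly (?q \<omega>) (?p \<omega>))"
    unfolding line_poly_def
    by (intro L.coeffs_hom_on_pCons L.coeffs_hom_on_0 L.hom_on_cmult base)
  have square: "L.coeffs_hom_on 3 (\<lambda>\<omega>. square_poly (?q \<omega>) (?p \<omega>) (combine k v c' \<omega>))" for c'
    unfolding square_poly_def
    by (intro L.coeffs_hom_on_pCons L.coeffs_hom_on_0 L.hom_on_cmult base)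
  have "L.coeffs_hom_on (3 + (3 + 3 + 3)) (\<lambda>\<omega>. tangent_poly (?q \<omega>) (?p \<omega>) (?r \<omega>))"
    unfolding tangent_poly_def Let_def
    by (intro L.coeffs_hom_on_add L.coeffs_hom_on_diff L.coeffs_hom_on_smult L.coeffs_hom_on_mult
        L.hom_on_cmult square base)
  then have tangent: "L.coeffs_hom_on 12 (\<lambda>\<omega>. tangent_poly (?q \<omega>) (?p \<omega>) (?r \<omega>))" by simp
  let ?R = "\<lambda>\<omega> i. if i < 6 then Polynomial.monom 1 i * line_poly (?q \<omega>) (?p \<omega>)
      else Polynomial.monom 1 (i - 6) * tangent_poly (?q \<omega>) (?p \<omega>) (?r \<omega>)"
  have entry: "L.hom_on (if i < 6 then 3 else 12) (\<lambda>\<omega>. Polynomial.coeff (?R \<omega> i) j)" for i j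
    using L.coeffs_hom_on_monom_mult[OF line, of i] L.coeffs_hom_on_monom_mult[OF tangent, of "i - 6"]
    by (cases "i < 6") (simp_all add: L.coeffs_hom_on_def)
  have "L.hom_on (\<Sum>i<9. if i < (6::nat) then 3 else 12)
      (\<lambda>\<omega>. Determinant.det (Matrix.mat 9 9 (\<lambda>(i, j). Polynomial.coeff (?R \<omega> i) j)))"
    by (rule L.hom_on_det[of 9 _ "\<lambda>\<omega> i j. Polynomial.coeff (?R \<omega> i) j"]) (rule entry)
  from L.hom_on_mult[OF base[of a a a] this] show ?thesis
    unfolding L.hom_on_def generic_form_def eliminant_def sylvester93_def by blast
qed

lemma subspace_between:
  assumes "subspace T" "dim T \<le> k" "k \<le> dim UNIV"
  obtains S where "subspace S" "T \<subseteq> S" "dim S = k"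
proof -
  obtain B where B: "B \<subseteq> T" "independent B" "T \<subseteq> span B" "card B = dim T"
    by (rule basis_exists)
  obtain C where C: "B \<subseteq> C" "C \<subseteq> UNIV" "independent C" "UNIV \<subseteq> span C"
    using maximal_independent_subset_extend[OF subset_UNIV B(2)] by blast
  have fin: "finite C" using C(3) by (rule finiteI_independent)
  have cC: "card C = dim UNIV" by (rule basis_card_eq_dim[OF C(2,4,3)])
  have finB: "finite B" using fin C(1) finite_subset by blast
  have "card (C - B) = dim UNIV - dim T" using card_Diff_subset[OF finB C(1)] cC B(4) by simp
  then have "k - dim T \<le> card (C - B)" using assms(3) by simp
  then obtain D where D: "D \<subseteq> C - B" "card D = k - dim T" "finite D"
    using obtain_subset_with_card_n by metis
  have "card (B \<union> D) = card B + card D" using finB D by (intro card_Un_disjoint) auto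
  then have card: "card (B \<union> D) = k" using B(4) D(2) assms(2) by simp
  have "independent (B \<union> D)" using C(1,3) D(1) by (meson Diff_subset Un_least independent_mono subset_trans)
  then have "dim (span (B \<union> D)) = k" using dim_span_eq_card_independent card by blast
  moreover have "T \<subseteq> span (B \<union> D)" using B(3) span_mono[of B "B \<union> D"] by blast
  ultimately show ?thesis using that[OF subspace_span] by blast
qed

text \<open>Choose \<open>p\<close>, \<open>q\<close>, \<open>r\<close> with nonzero eliminant and a \<open>k\<close>-dimensional subspace that contains them. The
  eliminant of suitable combinations of contractions is a polynomial in the Pluecker coordinates
  which is nonzero there. Where it is nonzero, \<open>f\<close> has no linear factor on the subspace.\<close>

theorem generic_slice_rank_ge_2:
  assumes k: "3 \<le> k" "k \<le> dim UNIV"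
    and no_factor: "\<And>l. Vector_Spaces.linear scale (*) l \<Longrightarrow> \<exists>x. l x = 0 \<and> \<phi> x x x \<noteq> 0"
    and Pr: "\<And>E. E \<in> dual_grassmannian scale k \<Longrightarrow> 2 \<le> slice_rank fscale E 3 (restrict_fun E f) \<Longrightarrow> Pr E"
  shows "for_generic_subspace scale k Pr"
proof -
  obtain p q r where nz: "eliminant p q r \<noteq> 0" using eliminant_nonzero_exists[OF no_factor] by blast
  have k0: "0 < k" using k by simp
  have "dim (span {p, q, r}) \<le> card {p, q, r}" by (rule dim_le_card) (auto simp: span_superset)
  also have "\<dots> \<le> 3" by (simp add: card_insert_if)
  finally have d3: "dim (span {p, q, r}) \<le> k" using k(1) by simp
  obtain S where S: "subspace S" "{p, q, r} \<subseteq> S" "dim S = k"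
  proof -
    obtain S where "subspace S" "span {p, q, r} \<subseteq> S" "dim S = k"
      by (rule subspace_between[OF subspace_span d3 k(2)])
    then show ?thesis using that span_superset[of "{p, q, r}"] by blast
  qed
  have G: "to_dual ` S \<in> dual_grassmannian scale k" by (rule image_to_dual_grassmannian[OF S(1,3)])
  then obtain e where e: "ordered_basis k e (to_dual ` S)" "\<And>j. j < k \<Longrightarrow> e j \<in> dual_space scale"
    using basis_of_grassmannian[OF _ k0] by metis
  have ES: "to_dual ` S \<subseteq> dual_space scale" using to_dual_in_dual by blast
  obtain v where v: "\<And>i j. i < k \<Longrightarrow> j < k \<Longrightarrow> e j (v i) = (if i = j then 1 else 0)"
    using dual_vectors_of_basis[OF e(1) ES] by metis
  interpret U: Vector_Spaces.linear fscale scale from_dual by (rule linear_from_dual)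
  have inj: "inj_on e {..<k}" and span: "fs.span (e ` {..<k}) = to_dual ` S"
    using e(1) by (auto simp: ordered_basis_def)
  have coord: "\<exists>c. combine k v c (wedge k e) = x" if "x \<in> S" for x
  proof -
    have "to_dual x \<in> fs.span (e ` {..<k})" using that span by simp
    then obtain c where "to_dual x = (\<Sum>j<k. fscale (c j) (e j))" using span_tuple[OF inj] by blast
    then have "from_dual (to_dual x) = (\<Sum>j<k. scale (c j) (from_dual (e j)))"
      by (simp only: U.sum U.scale)
    then show ?thesis
      using combine_wedge_dual_basis[OF e(2) v] by (intro exI[of _ c]) simp
  qed
  obtain a b c where abc: "combine k v a (wedge k e) = p" "combine k v b (wedge k e) = q"
    "combine k v c (wedge k e) = r" using coord S(2) by (metis insert_subset)
  obtain d where d: "generic_form k v a b c \<in> hom_polys fscale (dual_exterior_power scale k) d"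
    using generic_form_hom_poly by blast
  have "generic_form k v a b c (wedge k e) = eliminant p q r"
    using wedge_in_power[OF e(2)] by (simp add: generic_form_def restrict_fun_apply abc)
  then have "to_dual ` S \<in> plucker_nonzero scale k (generic_form k v a b c)"
    using G e(1) nz by (auto simp: plucker_nonzero_def)
  then have ne: "plucker_nonzero scale k (generic_form k v a b c) \<noteq> {}" by blast
  show ?thesis
  proof (rule for_generic_of_nonempty_plucker[OF k0 d ne])
    fix E assume "E \<in> plucker_nonzero scale k (generic_form k v a b c)"
    then obtain e' where E: "E \<in> dual_grassmannian scale k" and e': "ordered_basis k e' E"
      and nz': "generic_form k v a b c (wedge k e') \<noteq> 0" by (auto simp: plucker_nonzero_def)
    have sub: "fs.subspace E" "E \<subseteq> dual_space scale" using E by (auto simp: dual_grassmannian_def)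
    let ?x = "\<lambda>c. combine k v c (wedge k e')"
    have mem: "?x c \<in> to_dual -` E" for c
      using combine_wedge_in[OF sub ordered_basis_mem[OF e']] by simp
    have el: "eliminant (?x a) (?x b) (?x c) \<noteq> 0"
      using nz' by (auto simp: generic_form_def restrict_fun_apply split: if_splits)
    have "\<not> slice_rank fscale E 3 (restrict_fun E f) \<le> 1"
    proof
      assume "slice_rank fscale E 3 (restrict_fun E f) \<le> 1"
      from iffD1[OF slice_rank_restrict_le_iff[OF f_cubic sub] this]
      obtain l where l: "(\<forall>i<(1::nat). Vector_Spaces.linear scale (*) (l i)) \<and>
        (\<forall>x. to_dual x \<in> E \<longrightarrow> (\<forall>i<(1::nat). l i x = 0) \<longrightarrow> f (to_dual x) = 0)" ..
      have "Vector_Spaces.linear scale (*) (l 0)" using l by simp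
      then interpret l: Vector_Spaces.linear scale "(*)" "l 0" .
      have "eliminant (?x a) (?x b) (?x c) = 0"
        using l by (intro eliminant_zero_if_linear_factor[OF subspace_vimage_to_dual[OF sub(1)] mem mem mem,
            of "l 0"]) (auto simp: l.add l.scale f_to_dual)
      then show False using el by simp
    qed
    then show "Pr E" using Pr[OF E] by simp
  qed
qed

end

section \<open>Limits of subspaces on which the slice rank is at most two\<close>

text \<open>Division by an entry of maximal absolute value.\<close>

lemma normalised_multiple:
  fixes a :: "nat \<Rightarrow> complex"
  assumes "finite J" "J \<noteq> {}"
  shows "\<exists>a' j c. j \<in> J \<and> a' j = 1 \<and> (\<forall>l\<in>J. norm (a' l) \<le> 1 \<and> a l = c * a' l)"
proof (cases "\<forall>l\<in>J. a l = 0")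
  case True
  obtain j where "j \<in> J" using assms(2) by blast
  then show ?thesis using True
    by (intro exI[of _ "\<lambda>l. if l = j then 1 else 0"] exI[of _ j] exI[of _ 0]) auto
next
  case False
  have "Max ((\<lambda>l. norm (a l)) ` J) \<in> (\<lambda>l. norm (a l)) ` J"
    using assms by (intro Max_in) auto
  then obtain j where "j \<in> J" and max: "Max ((\<lambda>l. norm (a l)) ` J) = norm (a j)" by auto
  moreover have "norm (a l) \<le> norm (a j)" if "l \<in> J" for l
    unfolding max[symmetric] using assms(1) that by (intro Max_ge) auto
  ultimately have j: "j \<in> J" "\<forall>l\<in>J. norm (a l) \<le> norm (a j)" by auto
  then have "a j \<noteq> 0" using False by force
  then show ?thesis using j
    by (intro exI[of _ "\<lambda>l. a l / a j"] exI[of _ j] exI[of _ "a j"])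
      (auto simp: norm_divide divide_simps)
qed

text \<open>Two linear forms with two pivots: \<open>a' i = 1\<close>, \<open>b' i = 0\<close> and \<open>b' j = 1\<close>. These conditions persist in limits
  and keep the forms independent there, while the bound on the entries gives compactness. The new
  forms may cut out a smaller subspace when the given ones are dependent.\<close>

lemma normalised_pair:
  fixes a b :: "nat \<Rightarrow> complex"
  assumes "2 \<le> k"
  shows "\<exists>a' b' i j. i < k \<and> j < k \<and> a' i = 1 \<and> b' i = 0 \<and> b' j = 1 \<and>
    (\<forall>l<k. norm (a' l) \<le> 1 \<and> norm (b' l) \<le> 1) \<and>
    (\<forall>x. (\<Sum>l<k. a' l * x l) = 0 \<longrightarrow> (\<Sum>l<k. b' l * x l) = 0 \<longrightarrow>
      (\<Sum>l<k. a l * x l) = 0 \<and> (\<Sum>l<k. b l * x l) = 0)"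
proof -
  have "{..<k} \<noteq> {}" using assms by (auto simp: lessThan_empty_iff)
  then obtain a' i c where a': "i < k" "a' i = 1" "\<forall>l<k. norm (a' l) \<le> 1 \<and> a l = c * a' l"
    using normalised_multiple[of "{..<k}" a] by auto
  let ?J = "{..<k} - {i}"
  have "card ?J \<noteq> 0" using assms a'(1) by simp
  then have "?J \<noteq> {}" by (metis card.empty)
  then obtain b0 j d where b0: "j \<in> ?J" "b0 j = 1"
    "\<forall>l\<in>?J. norm (b0 l) \<le> 1 \<and> b l - b i * a' l = d * b0 l"
    using normalised_multiple[of ?J "\<lambda>l. b l - b i * a' l"] by (metis finite_Diff finite_lessThan)
  define b' where "b' = b0(i := 0)"
  have b': "b l = d * b' l + b i * a' l" if "l < k" for l
  proof (cases "l = i")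
    case True
    then show ?thesis using a'(2) by (simp add: b'_def)
  next
    case False
    then have "b l - b i * a' l = d * b0 l" using b0(3) that by blast
    then show ?thesis using False by (simp add: b'_def algebra_simps)
  qed
  have "(\<Sum>l<k. a l * x l) = 0 \<and> (\<Sum>l<k. b l * x l) = 0"
    if x: "(\<Sum>l<k. a' l * x l) = 0" "(\<Sum>l<k. b' l * x l) = 0" for x
  proof
    have "(\<Sum>l<k. a l * x l) = c * (\<Sum>l<k. a' l * x l)"
      using a'(3) by (simp add: sum_distrib_left mult.assoc)
    then show "(\<Sum>l<k. a l * x l) = 0" using x by simp
    have "(\<Sum>l<k. b l * x l) = (\<Sum>l<k. (d * b' l + b i * a' l) * x l)"
      using b' by (intro sum.cong) auto
    also have "\<dots> = d * (\<Sum>l<k. b' l * x l) + b i * (\<Sum>l<k. a' l * x l)"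
      by (simp add: sum_distrib_left sum.distrib algebra_simps)
    finally show "(\<Sum>l<k. b l * x l) = 0" using x by simp
  qed
  moreover have "norm (b' l) \<le> 1" if "l < k" for l
    using b0(3) that by (auto simp: b'_def)
  moreover have "b' i = 0" "b' j = 1" "j < k" using b0(1,2) by (auto simp: b'_def)
  ultimately show ?thesis using a' by (intro exI[of _ a'] exI[of _ b'] exI[of _ i] exI[of _ j]) simp
qed

lemma coordinatewise_convergent_subsequence:
  fixes u :: "nat \<Rightarrow> nat \<Rightarrow> complex"
  assumes "\<And>n l. l < m \<Longrightarrow> norm (u n l) \<le> 1"
  shows "\<exists>\<sigma>. strict_mono \<sigma> \<and> (\<forall>l<m. \<exists>L. (\<lambda>n. u (\<sigma> n) l) \<longlonglongrightarrow> L)"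
  using assms
proof (induction m)
  case 0
  show ?case by (intro exI[of _ id]) (simp add: strict_mono_def)
next
  case (Suc m)
  have "\<And>n l. l < m \<Longrightarrow> norm (u n l) \<le> 1" using Suc.prems by simp
  from Suc.IH[OF this] obtain \<sigma> where \<sigma>: "strict_mono \<sigma> \<and> (\<forall>l<m. \<exists>L. (\<lambda>n. u (\<sigma> n) l) \<longlonglongrightarrow> L)" ..
  have "bounded (range (\<lambda>n. u (\<sigma> n) m))"
    using Suc.prems[of m] by (auto simp: bounded_iff)
  then obtain L \<tau> where \<tau>: "strict_mono \<tau>" "((\<lambda>n. u (\<sigma> n) m) \<circ> \<tau>) \<longlonglongrightarrow> L"
    using bounded_imp_convergent_subsequence by blast
  have "\<exists>L. (\<lambda>n. u ((\<sigma> \<circ> \<tau>) n) l) \<longlonglongrightarrow> L" if "l < Suc m" for l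
  proof (cases "l = m")
    case True
    then show ?thesis using \<tau>(2) by (auto simp: o_def)
  next
    case False
    then have "l < m" using that by simp
    then obtain L where "(\<lambda>n. u (\<sigma> n) l) \<longlonglongrightarrow> L" using \<sigma> by blast
    then have "((\<lambda>n. u (\<sigma> n) l) \<circ> \<tau>) \<longlonglongrightarrow> L" using \<tau>(1) by (rule LIMSEQ_subseq_LIMSEQ)
    then show ?thesis by (auto simp: o_def)
  qed
  then show ?case using strict_mono_o[of \<sigma> \<tau>] \<sigma> \<tau>(1) by (intro exI[of _ "\<sigma> \<circ> \<tau>"]) blast
qed

text \<open>After passing to a subsequence the pivots are constant and the normalised forms converge. A point
  of the limit subspace is corrected in the two pivot coordinates to points of the approximating
  subspaces, and the corrections tend to zero.\<close>

lemma limit_of_vanishing_on_codim_two: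
  fixes F :: "nat \<Rightarrow> (nat \<Rightarrow> complex) \<Rightarrow> complex"
  assumes k: "2 \<le> k"
    and cont: "\<And>\<sigma> X x. strict_mono \<sigma> \<Longrightarrow> (\<And>l. l < k \<Longrightarrow> (\<lambda>n. X n l) \<longlonglongrightarrow> x l) \<Longrightarrow>
      (\<lambda>n. F (\<sigma> n) (X n)) \<longlonglongrightarrow> F0 x"
    and van: "\<And>n. \<exists>a b. \<forall>x. (\<Sum>l<k. a l * x l) = 0 \<longrightarrow> (\<Sum>l<k. b l * x l) = 0 \<longrightarrow> F n x = 0"
  shows "\<exists>a b. \<forall>x. (\<Sum>l<k. a l * x l) = 0 \<longrightarrow> (\<Sum>l<k. b l * x l) = 0 \<longrightarrow> F0 x = 0"
proof -
  define P where "P n a b i j \<longleftrightarrow> i < k \<and> j < k \<and> a i = 1 \<and> b i = 0 \<and> b j = 1 \<and>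
    (\<forall>l<k. norm (a l) \<le> 1 \<and> norm (b l) \<le> 1) \<and>
    (\<forall>x. (\<Sum>l<k. a l * x l) = 0 \<longrightarrow> (\<Sum>l<k. b l * x l) = 0 \<longrightarrow> F n x = 0)"
    for n and a b :: "nat \<Rightarrow> complex" and i j :: nat
  have "\<exists>a b i j. P n a b i j" for n
  proof -
    obtain a b where ab: "\<forall>x. (\<Sum>l<k. a l * x l) = 0 \<longrightarrow> (\<Sum>l<k. b l * x l) = 0 \<longrightarrow> F n x = 0"
      using van by blast
    from normalised_pair[OF k, of a b] obtain a' b' i j where
      "i < k \<and> j < k \<and> a' i = 1 \<and> b' i = 0 \<and> b' j = 1 \<and>
      (\<forall>l<k. norm (a' l) \<le> 1 \<and> norm (b' l) \<le> 1) \<and>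
      (\<forall>x. (\<Sum>l<k. a' l * x l) = 0 \<longrightarrow> (\<Sum>l<k. b' l * x l) = 0 \<longrightarrow>
        (\<Sum>l<k. a l * x l) = 0 \<and> (\<Sum>l<k. b l * x l) = 0)" by (elim exE)
    then show ?thesis using ab
      by (intro exI[of _ a'] exI[of _ b'] exI[of _ i] exI[of _ j]) (simp add: P_def)
  qed
  then obtain a b i j where P: "\<And>n. P n (a n) (b n) (i n) (j n)" by metis
  then have ij: "\<And>n. i n < k" "\<And>n. j n < k"
    and piv: "\<And>n. a n (i n) = 1" "\<And>n. b n (i n) = 0" "\<And>n. b n (j n) = 1"
    and bd: "\<And>n l. l < k \<Longrightarrow> norm (a n l) \<le> 1" "\<And>n l. l < k \<Longrightarrow> norm (b n l) \<le> 1"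
    and zero: "\<And>n x. (\<Sum>l<k. a n l * x l) = 0 \<Longrightarrow> (\<Sum>l<k. b n l * x l) = 0 \<Longrightarrow> F n x = 0"
    unfolding P_def by blast+
  have "finite ((\<lambda>n. (i n, j n)) ` UNIV)"
    by (rule finite_subset[of _ "{..<k} \<times> {..<k}"]) (use ij in auto)
  then obtain n0 where inf: "infinite {n. (i n, j n) = (i n0, j n0)}"
    using pigeonhole_infinite[OF infinite_UNIV_nat, of "\<lambda>n. (i n, j n)"] by auto
  define S where "S = {n. (i n, j n) = (i n0, j n0)}"
  define I J where "I = i n0" and "J = j n0"
  define \<sigma> where "\<sigma> = enumerate S"
  have \<sigma>: "strict_mono \<sigma>" unfolding \<sigma>_def by (rule strict_mono_enumerate) (use inf in \<open>simp add: S_def\<close>)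
  have \<sigma>ij: "i (\<sigma> n) = I" "j (\<sigma> n) = J" for n
    using enumerate_in_set[of S n] inf by (auto simp: S_def \<sigma>_def I_def J_def)
  have "norm (if l < k then a (\<sigma> n) l else b (\<sigma> n) (l - k)) \<le> 1" if "l < k + k" for n l
    using bd that by auto
  from coordinatewise_convergent_subsequence[of "k + k" "\<lambda>n l. if l < k then a (\<sigma> n) l else b (\<sigma> n) (l - k)", OF this]
  obtain \<tau> where \<tau>: "strict_mono \<tau>"
    "\<And>l. l < k + k \<Longrightarrow> \<exists>L. (\<lambda>n. if l < k then a (\<sigma> (\<tau> n)) l else b (\<sigma> (\<tau> n)) (l - k)) \<longlonglongrightarrow> L" by blast
  define \<rho> where "\<rho> n = \<sigma> (\<tau> n)" for n
  have \<rho>: "strict_mono \<rho>" using strict_mono_o[OF \<sigma> \<tau>(1)] by (simp add: \<rho>_def[abs_def] o_def)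
  have "\<exists>L. (\<lambda>n. a (\<rho> n) l) \<longlonglongrightarrow> L" if "l < k" for l using \<tau>(2)[of l] that by (simp add: \<rho>_def)
  then obtain A where A: "\<And>l. l < k \<Longrightarrow> (\<lambda>n. a (\<rho> n) l) \<longlonglongrightarrow> A l" by metis
  have "\<exists>L. (\<lambda>n. b (\<rho> n) l) \<longlonglongrightarrow> L" if "l < k" for l using \<tau>(2)[of "k + l"] that by (simp add: \<rho>_def)
  then obtain B where B: "\<And>l. l < k \<Longrightarrow> (\<lambda>n. b (\<rho> n) l) \<longlonglongrightarrow> B l" by metis
  have IJ: "I < k" "J < k" using ij by (auto simp: I_def J_def)
  have pivr: "a (\<rho> n) I = 1" "b (\<rho> n) I = 0" "b (\<rho> n) J = 1" for n
    using piv[of "\<rho> n"] \<sigma>ij[of "\<tau> n"] by (auto simp: \<rho>_def)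
  have shift: "(\<Sum>l<k. c l * (x l - (if l = m then t else 0))) = (\<Sum>l<k. c l * x l) - c m * t"
    if "m < k" for c x :: "nat \<Rightarrow> complex" and m t
  proof -
    have "(\<Sum>l<k. c l * (x l - (if l = m then t else 0)))
        = (\<Sum>l<k. c l * x l) - (\<Sum>l<k. if l = m then c m * t else 0)"
      unfolding sum_subtractf[symmetric] by (intro sum.cong) (auto simp: algebra_simps)
    then show ?thesis using that by simp
  qed
  have "F0 x = 0" if x: "(\<Sum>l<k. A l * x l) = 0" "(\<Sum>l<k. B l * x l) = 0" for x
  proof -
    \<comment> \<open>First the pivot coordinate \<open>J\<close> is corrected for the second form, then \<open>I\<close> for the first; as the second
      form does not involve \<open>I\<close>, it stays zero.\<close>
    define \<beta> where "\<beta> n = (\<Sum>l<k. b (\<rho> n) l * x l)" for n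
    define y where "y n l = x l - (if l = J then \<beta> n else 0)" for n l
    define \<alpha> where "\<alpha> n = (\<Sum>l<k. a (\<rho> n) l * y n l)" for n
    define z where "z n l = y n l - (if l = I then \<alpha> n else 0)" for n l
    have "\<beta> \<longlonglongrightarrow> (\<Sum>l<k. B l * x l)" unfolding \<beta>_def
      by (intro tendsto_sum tendsto_mult tendsto_const B) simp
    then have \<beta>: "\<beta> \<longlonglongrightarrow> 0" using x by simp
    have "(\<lambda>n. y n l) \<longlonglongrightarrow> x l - (if l = J then 0 else 0)" for l
      unfolding y_def by (intro tendsto_diff tendsto_const) (cases "l = J"; simp add: \<beta>)
    then have y: "(\<lambda>n. y n l) \<longlonglongrightarrow> x l" for l by simp
    have "\<alpha> \<longlonglongrightarrow> (\<Sum>l<k. A l * x l)" unfolding \<alpha>_def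
      by (intro tendsto_sum tendsto_mult A y) simp
    then have \<alpha>: "\<alpha> \<longlonglongrightarrow> 0" using x by simp
    have "(\<lambda>n. z n l) \<longlonglongrightarrow> x l - (if l = I then 0 else 0)" for l
      unfolding z_def by (intro tendsto_diff y) (cases "l = I"; simp add: \<alpha>)
    then have z: "(\<lambda>n. z n l) \<longlonglongrightarrow> x l" for l by simp
    have "F (\<rho> n) (z n) = 0" for n
    proof (rule zero)
      show "(\<Sum>l<k. a (\<rho> n) l * z n l) = 0"
        unfolding z_def shift[OF IJ(1)] by (simp add: \<alpha>_def pivr)
      have "(\<Sum>l<k. b (\<rho> n) l * y n l) = 0"
        unfolding y_def shift[OF IJ(2)] by (simp add: \<beta>_def pivr)
      then show "(\<Sum>l<k. b (\<rho> n) l * z n l) = 0"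
        unfolding z_def shift[OF IJ(1)] by (simp add: pivr)
    qed
    moreover have "(\<lambda>n. F (\<rho> n) (z n)) \<longlonglongrightarrow> F0 x" by (rule cont[OF \<rho> z])
    ultimately show ?thesis by (simp add: LIMSEQ_const_iff)
  qed
  then show ?thesis by blast
qed

lemma sequence_to_0_avoiding:
  assumes "finite (B :: complex set)"
  obtains T where "T \<longlonglongrightarrow> 0" "\<And>n. T n \<notin> B"
proof -
  define t where "t n = complex_of_real (inverse (real (Suc n)))" for n
  have "inj t" by (auto simp: inj_def t_def)
  then have "finite (t -` B)" using assms finite_vimageI by blast
  then obtain N where N: "\<forall>n\<in>t -` B. n < N" using finite_nat_set_iff_bounded by blast
  have "t \<longlonglongrightarrow> of_real 0" unfolding t_def by (rule tendsto_of_real[OF LIMSEQ_inverse_real_of_nat])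
  then have "(\<lambda>n. t (n + N)) \<longlonglongrightarrow> 0" using LIMSEQ_ignore_initial_segment by fastforce
  moreover have "t (n + N) \<notin> B" for n using N by fastforce
  ultimately show ?thesis by (rule that)
qed

context dual_cubic
begin

lemma f_on_dual: "\<psi> \<in> dual_space scale \<Longrightarrow> f \<psi> = \<phi> (from_dual \<psi>) (from_dual \<psi>) (from_dual \<psi>)"
  using f_to_dual[of "from_dual \<psi>"] to_dual_from_dual by simp

text \<open>In the coordinates given by the moving tuple the cubics converge, and each vanishes on a subspace
  of codimension two.\<close>

theorem slice_rank_le_2_limit:
  assumes k: "2 \<le> k" and E0: "E0 \<in> dual_grassmannian scale k" "ordered_basis k e0 E0"
    and e1: "\<And>j. j < k \<Longrightarrow> e1 j \<in> dual_space scale" and B: "finite B"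
    and le: "\<And>t. t \<notin> B \<Longrightarrow> fs.span (tuple_line e0 e1 t ` {..<k}) \<in> dual_grassmannian scale k \<and>
      slice_rank fscale (fs.span (tuple_line e0 e1 t ` {..<k})) 3
        (restrict_fun (fs.span (tuple_line e0 e1 t ` {..<k})) f) \<le> 2"
  shows "slice_rank fscale E0 3 (restrict_fun E0 f) \<le> 2"
proof -
  obtain T where T: "T \<longlonglongrightarrow> 0" "\<And>n. T n \<notin> B" using sequence_to_0_avoiding[OF B] by blast
  interpret U: Vector_Spaces.linear fscale scale from_dual by (rule linear_from_dual)
  have sub0: "fs.subspace E0" "E0 \<subseteq> dual_space scale" using E0(1) by (auto simp: dual_grassmannian_def)
  have e0: "e0 j \<in> dual_space scale" if "j < k" for j using ordered_basis_mem[OF E0(2) that] sub0(2) by blast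
  let ?e = "\<lambda>n. tuple_line e0 e1 (T n)" and ?E = "\<lambda>n. fs.span (tuple_line e0 e1 (T n) ` {..<k})"
  define F where "F n x = f (\<Sum>j<k. fscale (x j) (?e n j))" for n x
  define F0 where "F0 x = f (\<Sum>j<k. fscale (x j) (e0 j))" for x
  have dual_sum: "(\<Sum>j<k. fscale (x j) (e j)) \<in> dual_space scale"
    if "\<And>j. j < k \<Longrightarrow> e j \<in> dual_space scale" for x e
    using that by (intro fs.subspace_sum[OF subspace_dual] fs.subspace_scale[OF subspace_dual]) simp
  have e: "?e n j \<in> dual_space scale" if "j < k" for n j
    using that by (intro tuple_line_in_dual e0 e1)
  have "\<exists>a b. \<forall>x. (\<Sum>l<k. a l * x l) = 0 \<longrightarrow> (\<Sum>l<k. b l * x l) = 0 \<longrightarrow> F0 x = 0"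
  proof (rule limit_of_vanishing_on_codim_two[OF k, of F])
    fix \<sigma> :: "nat \<Rightarrow> nat" and X :: "nat \<Rightarrow> nat \<Rightarrow> complex" and x :: "nat \<Rightarrow> complex"
    assume \<sigma>: "strict_mono \<sigma>" and X: "\<And>l. l < k \<Longrightarrow> (\<lambda>n. X n l) \<longlonglongrightarrow> x l"
    have T\<sigma>: "(\<lambda>n. T (\<sigma> n)) \<longlonglongrightarrow> 0" using LIMSEQ_subseq_LIMSEQ[OF T(1) \<sigma>] by (simp add: o_def)
    have "(\<lambda>n. \<phi> (from_dual (\<Sum>j<k. fscale (X n j) (?e (\<sigma> n) j)))
        (from_dual (\<Sum>j<k. fscale (X n j) (?e (\<sigma> n) j)))
        (from_dual (\<Sum>j<k. fscale (X n j) (?e (\<sigma> n) j))))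
      \<longlonglongrightarrow> \<phi> (from_dual (\<Sum>j<k. fscale (x j) (e0 j))) (from_dual (\<Sum>j<k. fscale (x j) (e0 j)))
        (from_dual (\<Sum>j<k. fscale (x j) (e0 j)))"
    proof (rule trilinear_tendsto[OF _ trilinear])
      fix a assume "Vector_Spaces.linear scale (*) (a :: 'v \<Rightarrow> complex)"
      then interpret a: Vector_Spaces.linear scale "(*)" a .
      have "(\<lambda>n. \<Sum>j<k. X n j * ((1 - T (\<sigma> n)) * a (from_dual (e0 j)) + T (\<sigma> n) * a (from_dual (e1 j))))
          \<longlonglongrightarrow> (\<Sum>j<k. x j * ((1 - 0) * a (from_dual (e0 j)) + 0 * a (from_dual (e1 j))))"
        by (intro tendsto_sum tendsto_mult tendsto_add tendsto_diff tendsto_const X T\<sigma>) simp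
      then show "(\<lambda>n. a (from_dual (\<Sum>j<k. fscale (X n j) (?e (\<sigma> n) j))))
          \<longlonglongrightarrow> a (from_dual (\<Sum>j<k. fscale (x j) (e0 j)))"
        by (simp add: U.sum U.scale U.add a.sum a.scale a.add tuple_line_def)
    qed
    then show "(\<lambda>n. F (\<sigma> n) (X n)) \<longlonglongrightarrow> F0 x"
      using f_on_dual[OF dual_sum[OF e]] f_on_dual[OF dual_sum[OF e0]] by (simp add: F_def F0_def)
  next
    fix n
    have G: "?E n \<in> dual_grassmannian scale k"
      and s: "slice_rank fscale (?E n) 3 (restrict_fun (?E n) f) \<le> 2" using le[OF T(2)] by auto
    have sub: "fs.subspace (?E n)" "?E n \<subseteq> dual_space scale" using G by (auto simp: dual_grassmannian_def)
    from iffD1[OF slice_rank_restrict_le_iff[OF f_cubic sub] s]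
    obtain l where l: "(\<forall>i<(2::nat). Vector_Spaces.linear scale (*) (l i)) \<and>
      (\<forall>x. to_dual x \<in> ?E n \<longrightarrow> (\<forall>i<(2::nat). l i x = 0) \<longrightarrow> f (to_dual x) = 0)" ..
    let ?a = "\<lambda>i j. l i (from_dual (?e n j))"
    have van: "F n x = 0" if x: "(\<Sum>j<k. ?a 0 j * x j) = 0" "(\<Sum>j<k. ?a 1 j * x j) = 0" for x
    proof -
      let ?\<psi> = "\<Sum>j<k. fscale (x j) (?e n j)"
      have mem: "?\<psi> \<in> ?E n"
        by (intro fs.span_sum fs.span_scale) (rule fs.span_base, simp)
      then have td: "to_dual (from_dual ?\<psi>) = ?\<psi>" using sub(2) to_dual_from_dual by blast
      have "l i (from_dual ?\<psi>) = (\<Sum>j<k. ?a i j * x j)" if "i < 2" for i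
      proof -
        have "Vector_Spaces.linear scale (*) (l i)" using l that by blast
        then interpret l: Vector_Spaces.linear scale "(*)" "l i" .
        show ?thesis by (simp add: U.sum U.scale l.sum l.scale mult.commute)
      qed
      then have "\<forall>i<2. l i (from_dual ?\<psi>) = 0" using x by (auto simp: less_2_cases_iff)
      moreover have "to_dual (from_dual ?\<psi>) \<in> ?E n" unfolding td by (rule mem)
      ultimately have "f (to_dual (from_dual ?\<psi>)) = 0" using l by blast
      then show ?thesis by (simp add: F_def td)
    qed
    show "\<exists>a b. \<forall>x. (\<Sum>l<k. a l * x l) = 0 \<longrightarrow> (\<Sum>l<k. b l * x l) = 0 \<longrightarrow> F n x = 0"
      by (intro exI[of _ "?a 0"] exI[of _ "?a 1"] allI impI) (rule van)
  qed
  then obtain a b where ab: "\<And>x. (\<Sum>l<k. a l * x l) = 0 \<Longrightarrow> (\<Sum>l<k. b l * x l) = 0 \<Longrightarrow> F0 x = 0" by blast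
  obtain v where v: "\<And>i j. i < k \<Longrightarrow> j < k \<Longrightarrow> e0 j (v i) = (if i = j then 1 else 0)"
    using dual_vectors_of_basis[OF E0(2) sub0(2)] by metis
  have inj: "inj_on e0 {..<k}" and span: "fs.span (e0 ` {..<k}) = E0"
    using E0(2) by (simp_all add: ordered_basis_def)
  interpret D: Vector_Spaces.linear scale fscale to_dual by (rule linear_to_dual)
  define l where "l i x = (\<Sum>j<k. (if i = (0::nat) then a j else b j) * to_dual x (v j))" for i x
  have "Vector_Spaces.linear scale (*) (l i)" for i
    by (simp add: linear_functional_iff[OF vector_space_axioms] l_def D.add D.scale fscale_apply
        sum.distrib sum_distrib_left algebra_simps)
  moreover have "f (to_dual x) = 0" if x: "to_dual x \<in> E0" "\<forall>i<2. l i x = 0" for x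
  proof -
    obtain c where c: "to_dual x = (\<Sum>j<k. fscale (c j) (e0 j))"
      using x(1) span span_tuple[OF inj] by blast
    have cv: "to_dual x (v i) = c i" if i: "i < k" for i
    proof -
      have "to_dual x (v i) = (\<Sum>j<k. c j * e0 j (v i))" unfolding c sum_fscale_apply ..
      also have "\<dots> = (\<Sum>j<k. if j = i then c i else 0)" using v[OF i] by (intro sum.cong) auto
      finally show ?thesis using i by simp
    qed
    have "l 0 x = 0" "l 1 x = 0" using x(2) by auto
    then have "(\<Sum>j<k. a j * c j) = 0" "(\<Sum>j<k. b j * c j) = 0" using cv by (simp_all add: l_def)
    then have "F0 c = 0" by (rule ab)
    then show ?thesis by (simp add: F0_def c)
  qed
  ultimately show ?thesis
    unfolding slice_rank_restrict_le_iff[OF f_cubic sub0] by (intro exI[of _ l]) blast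
qed

theorem slice_rank_le_2_of_subspaces:
  assumes dim: "14 \<le> dim UNIV"
    and le: "\<And>E. E \<in> dual_grassmannian scale 14 \<Longrightarrow> slice_rank fscale E 3 (restrict_fun E f) \<le> 2"
  shows "slice_rank fscale (dual_space scale) 3 f \<le> 2"
proof -
  have "\<exists>L. isotropic L \<and> L \<subseteq> UNIV \<and> dim L + 2 = dim UNIV"
  proof (rule isotropic_codim_two[OF _ subspace_UNIV dim])
    fix S assume S: "subspace S" "dim S = 14"
    have G: "to_dual ` S \<in> dual_grassmannian scale 14" by (rule image_to_dual_grassmannian[OF S])
    have sub: "fs.subspace (to_dual ` S)" "to_dual ` S \<subseteq> dual_space scale"
      using G by (auto simp: dual_grassmannian_def)
    from iffD1[OF slice_rank_restrict_le_iff[OF f_cubic sub] le[OF G]]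
    obtain l where l: "(\<forall>i<(2::nat). Vector_Spaces.linear scale (*) (l i)) \<and>
      (\<forall>x. to_dual x \<in> to_dual ` S \<longrightarrow> (\<forall>i<(2::nat). l i x = 0) \<longrightarrow> f (to_dual x) = 0)" ..
    let ?L = "{x \<in> S. \<forall>i\<in>{..<2}. l i x = 0}"
    have "subspace ?L \<and> dim S \<le> dim ?L + card {..<2::nat}"
      using l by (intro dim_common_kernel[OF _ S(1)]) auto
    then have "isotropic ?L" "12 \<le> dim ?L" using l S(2) by (auto simp: isotropic_iff)
    then show "\<exists>L. isotropic L \<and> L \<subseteq> S \<and> 12 \<le> dim L" by blast
  qed
  then obtain L where L: "isotropic L" "dim L + 2 = dim UNIV" by blast
  from subspace_as_kernel[OF isotropic_subspace[OF L(1)] L(2)]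
  obtain l where l: "(\<forall>i<(2::nat). Vector_Spaces.linear scale (*) (l i :: 'v \<Rightarrow> complex)) \<and>
    (\<forall>x. (\<forall>i<(2::nat). l i x = 0) \<longrightarrow> x \<in> L)" ..
  have "slice_rank fscale (dual_space scale) 3 (restrict_fun (dual_space scale) f) \<le> 2"
    unfolding slice_rank_restrict_le_iff[OF f_cubic subspace_dual order_refl]
    using l L(1) by (intro exI[of _ l]) (auto simp: isotropic_iff)
  then show ?thesis by (simp add: restrict_dual_self[OF f_cubic])
qed

lemma slice_rank_ge_2:
  assumes no_factor: "\<And>l. Vector_Spaces.linear scale (*) l \<Longrightarrow> \<exists>x. l x = 0 \<and> \<phi> x x x \<noteq> 0"
  shows "\<not> slice_rank fscale (dual_space scale) 3 f \<le> 1"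
proof
  assume "slice_rank fscale (dual_space scale) 3 f \<le> 1"
  then have "slice_rank fscale (dual_space scale) 3 (restrict_fun (dual_space scale) f) \<le> 1"
    by (simp add: restrict_dual_self[OF f_cubic])
  from iffD1[OF slice_rank_restrict_le_iff[OF f_cubic subspace_dual order_refl] this]
  obtain l where l: "(\<forall>i<(1::nat). Vector_Spaces.linear scale (*) (l i)) \<and>
    (\<forall>x. to_dual x \<in> dual_space scale \<longrightarrow> (\<forall>i<(1::nat). l i x = 0) \<longrightarrow> f (to_dual x) = 0)" ..
  have "Vector_Spaces.linear scale (*) (l 0)" using l by simp
  from no_factor[OF this] obtain x where "l 0 x = 0 \<and> \<phi> x x x \<noteq> 0" ..
  then show False using l to_dual_in_dual by (auto simp: f_to_dual)
qed

theorem slice_rank_restrict_mono: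
  assumes "slice_rank fscale (dual_space scale) 3 f \<le> r"
    and E: "fs.subspace E" "E \<subseteq> dual_space scale"
  shows "slice_rank fscale E 3 (restrict_fun E f) \<le> r"
proof -
  have "slice_rank fscale (dual_space scale) 3 (restrict_fun (dual_space scale) f) \<le> r"
    using assms(1) by (simp add: restrict_dual_self[OF f_cubic])
  from iffD1[OF slice_rank_restrict_le_iff[OF f_cubic subspace_dual order_refl] this]
  obtain l where l: "(\<forall>i<r. Vector_Spaces.linear scale (*) (l i)) \<and>
    (\<forall>x. to_dual x \<in> dual_space scale \<longrightarrow> (\<forall>i<r. l i x = 0) \<longrightarrow> f (to_dual x) = 0)" ..
  show ?thesis unfolding slice_rank_restrict_le_iff[OF f_cubic E]
    using l to_dual_in_dual by (intro exI[of _ l]) blast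
qed

text \<open>The basis of a given subspace is joined by a line to that of a member of the dense open set. All
  but finitely many subspaces on the line belong to the open set, and the given one is their limit.\<close>

theorem slice_rank_le_2_of_generic:
  assumes k: "2 \<le> k" "k \<le> dim UNIV"
    and gen: "for_generic_subspace scale k (\<lambda>E. slice_rank fscale E 3 (restrict_fun E f) = 2)"
    and E0: "E0 \<in> dual_grassmannian scale k"
  shows "slice_rank fscale E0 3 (restrict_fun E0 f) \<le> 2"
proof -
  have k0: "0 < k" using k by simp
  let ?Z = "zariski_grassmannian scale k"
  obtain U where U: "openin ?Z U" "?Z closure_of U = topspace ?Z"
    "\<forall>E\<in>U. slice_rank fscale E 3 (restrict_fun E f) = 2"
    using gen unfolding for_generic_subspace_def by blast
  have "U \<noteq> {}"
  proof
    assume "U = {}"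
    then have "topspace ?Z = {}" using U(2) by simp
    then show False using E0 topspace_zariski_grassmannian[OF k0] by blast
  qed
  then obtain E1 where E1: "E1 \<in> U" by blast
  have "U \<subseteq> topspace ?Z" using U(1) by (rule openin_subset)
  then have G1: "E1 \<in> dual_grassmannian scale k" using E1 topspace_zariski_grassmannian[OF k0] by blast
  have dual1: "E1 \<subseteq> dual_space scale" using G1 by (auto simp: dual_grassmannian_def)
  obtain e0 where e0: "ordered_basis k e0 E0" "\<And>j. j < k \<Longrightarrow> e0 j \<in> dual_space scale"
    using basis_of_grassmannian[OF E0 k0] by metis
  obtain e1 where e1: "ordered_basis k e1 E1" "\<And>j. j < k \<Longrightarrow> e1 j \<in> dual_space scale"
    using basis_of_grassmannian[OF G1 k0] by metis
  obtain \<Q> where \<Q>: "finite \<Q>"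
    "\<And>q. q \<in> \<Q> \<Longrightarrow> \<exists>d. q \<in> hom_polys fscale (dual_exterior_power scale k) d"
    "\<And>q. q \<in> \<Q> \<Longrightarrow> E1 \<in> plucker_nonzero scale k q"
    "\<And>E'. E' \<in> dual_grassmannian scale k \<Longrightarrow> (\<And>q. q \<in> \<Q> \<Longrightarrow> E' \<in> plucker_nonzero scale k q) \<Longrightarrow> E' \<in> U"
    using zariski_open_contains_basic[OF U(1) E1] by metis
  from plucker_nonzero_on_tuple_line[OF \<Q>(1,2,3) e1(1) dual1 e0(2)]
  obtain B where B: "finite B \<and> (\<forall>t. t \<notin> B \<longrightarrow>
    ordered_basis k (tuple_line e0 e1 t) (fs.span (tuple_line e0 e1 t ` {..<k})) \<and>
    fs.span (tuple_line e0 e1 t ` {..<k}) \<in> dual_grassmannian scale k \<and>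
    (\<forall>q\<in>\<Q>. fs.span (tuple_line e0 e1 t ` {..<k}) \<in> plucker_nonzero scale k q))" ..
  show ?thesis
  proof (rule slice_rank_le_2_limit[OF k(1) E0 e0(1) e1(2)])
    show "finite B" using B by blast
    fix t assume t: "t \<notin> B"
    have "fs.span (tuple_line e0 e1 t ` {..<k}) \<in> U"
      by (rule \<Q>(4)) (use B t in blast)+
    then show "fs.span (tuple_line e0 e1 t ` {..<k}) \<in> dual_grassmannian scale k \<and>
      slice_rank fscale (fs.span (tuple_line e0 e1 t ` {..<k})) 3
        (restrict_fun (fs.span (tuple_line e0 e1 t ` {..<k})) f) \<le> 2"
      using U(3) B t by simp
  qed
qed

end

section \<open>The equivalence\<close>

theorem theorem5p1:
  fixes scale :: "complex \<Rightarrow> 'v::ab_group_add \<Rightarrow> 'v"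
    and n :: nat
    and f :: "('v \<Rightarrow> complex) \<Rightarrow> complex"
  assumes "Vector_Spaces.vector_space scale"
    and "vector_space.dim scale (UNIV :: 'v set) = n + 1"
    and "14 \<le> n + 1"
    and "f \<in> hom_polys fscale (dual_space scale) 3"
    and "ring_irreducible\<^bsub>poly_ring fscale (dual_space scale)\<^esub> f"
  shows "(slice_rank fscale (dual_space scale) 3 f = 2
        \<longleftrightarrow> for_generic_subspace scale 14 (\<lambda>E. slice_rank fscale E 3 (restrict_fun E f) = 2))
    \<and> (for_generic_subspace scale 14 (\<lambda>E. slice_rank fscale E 3 (restrict_fun E f) = 2)
        \<longleftrightarrow> (\<forall>E\<in>dual_grassmannian scale 14. slice_rank fscale E 3 (restrict_fun E f) \<le> 2))"
proof -
  interpret V: Vector_Spaces.vector_space scale by (rule assms(1))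
  obtain Basis where Basis: "Basis \<subseteq> UNIV" "V.independent Basis" "UNIV \<subseteq> V.span Basis"
    "card Basis = V.dim UNIV" by (rule V.basis_exists)
  have "finite Basis" using Basis(4) assms(2) card.infinite by fastforce
  then interpret D: dual_identification scale Basis
    using Basis by unfold_locales auto
  let ?W = "dual_space scale"
  have pull: "restrict_fun UNIV (\<lambda>x. f (D.to_dual x)) \<in> hom_polys scale UNIV 3"
    by (rule hom_poly_pullback[OF D.linear_to_dual V.subspace_UNIV _ D.subspace_dual assms(4)])
      (rule D.to_dual_in_dual)
  obtain \<phi> where \<phi>: "trilinear scale \<phi>" "\<And>x y z. \<phi> x y z = \<phi> y x z" "\<And>x y z. \<phi> x y z = \<phi> x z y"
    "\<And>x. restrict_fun UNIV (\<lambda>x. f (D.to_dual x)) x = \<phi> x x x"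
    by (rule symmetric_trilinear_of_hom_poly[OF assms(1) pull]) blast
  interpret C: dual_cubic scale Basis f \<phi>
    using assms(4) \<phi> by unfold_locales (auto simp: restrict_fun_apply)
  have dim: "14 \<le> V.dim UNIV" using assms(2,3) by simp
  have no_factor: "\<exists>x. l x = 0 \<and> \<phi> x x x \<noteq> 0" if "Vector_Spaces.linear scale (*) l" for l
    by (rule C.no_linear_factor[OF assms(5) that])
  have "\<not> slice_rank fscale ?W 3 f \<le> 1"
    using C.slice_rank_ge_2[OF no_factor] .
  then have i: "slice_rank fscale ?W 3 f = 2 \<longleftrightarrow> slice_rank fscale ?W 3 f \<le> 2" by linarith
  have i_iii: "slice_rank fscale ?W 3 f \<le> 2
      \<longleftrightarrow> (\<forall>E\<in>dual_grassmannian scale 14. slice_rank fscale E 3 (restrict_fun E f) \<le> 2)"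
    using C.slice_rank_le_2_of_subspaces[OF dim] C.slice_rank_restrict_mono[of 2]
    by (auto simp: dual_grassmannian_def)
  have iii_ii: "for_generic_subspace scale 14 (\<lambda>E. slice_rank fscale E 3 (restrict_fun E f) = 2)"
    if le: "\<forall>E\<in>dual_grassmannian scale 14. slice_rank fscale E 3 (restrict_fun E f) \<le> 2"
    by (rule C.generic_slice_rank_ge_2[OF _ dim no_factor]) (use le in \<open>auto intro: antisym\<close>)
  have ii_iii: "\<forall>E\<in>dual_grassmannian scale 14. slice_rank fscale E 3 (restrict_fun E f) \<le> 2"
    if "for_generic_subspace scale 14 (\<lambda>E. slice_rank fscale E 3 (restrict_fun E f) = 2)"
    using C.slice_rank_le_2_of_generic[OF _ dim that] by simp
  show ?thesis using i i_iii iii_ii ii_iii by blast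
qed

end
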